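(* Let $n\ge2$. Let $\sigma:(0,\infty)\to\mathbb{R}$ and $w:(0,\infty)\to\mathbb{R}$ be functions, with $w$ measurable, such that $$C_1=\left(\sup_{t>0,\;k\in\{0,1,2,\dots\}}\left\{\frac1{\sigma(t)^2}\int_0^\infty J_{\nu(k)}(rt)^2\,\frac{r}{w(r)^2}\,dr\right\}\right)^{1/2}<\infty,$$ where $\nu(k)=\frac n2+k-1$ and, for $\lambda>-1/2$, $J_\lambda$ is the Bessel function $$J_\lambda(t)=\frac{t^\lambda}{2^\lambda\,\Gamma(\lambda+1/2)\,\Gamma(1/2)}\int_{-1}^1e^{itr}(1-r^2)^{\lambda-1/2}\,dr.$$ Then for all $\rho>0$ and all $f$ with $\widehat f\in L^1(\mathbb{R}^n)$ and $w(|D_x|)f\in L^2(\mathbb{R}^n)$, $$\|f|_{\rho\mathbb{S}^{n-1}}\|_{L^2(\rho\mathbb{S}^{n-1};\rho^{n-1}d\omega)}\le C_1\sqrt\rho\,|\sigma(\rho)|\,\|w(|D_x|)f\|_{L^2(\mathbb{R}^n)},$$ and the constant $C_1$ cannot be improved, i.e. the estimate for all such $\rho$ and $f$ fails if $C_1$ is replaced by any strictly smaller constant.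
   Context: $\mathbb{S}^{n-1}$ is the unit sphere in $\mathbb{R}^n$, $d\omega$ its standard surface measure, $\rho\mathbb{S}^{n-1}$ the sphere of radius $\rho$ centred at the origin, and $\|g\|^2_{L^2(\rho\mathbb{S}^{n-1};\rho^{n-1}d\omega)}=\int_{\mathbb{S}^{n-1}}|g(\rho\omega)|^2\rho^{n-1}\,d\omega$. Fourier transform: $\widehat f(\xi)=\int_{\mathbb{R}^n}e^{-ix\cdot\xi}f(x)\,dx$, with inverse $\mathcal{F}^{-1}g(x)=(2\pi)^{-n}\int_{\mathbb{R}^n}e^{ix\cdot\xi}g(\xi)\,d\xi$. The functions $f$ are those of the form $f=\mathcal{F}^{-1}F$ with $F=\widehat f\in L^1(\mathbb{R}^n)$, so $f$ is continuous and its restriction to spheres is defined pointwise. $w(|D_x|)$ is the Fourier multiplier with symbol $w(|\xi|)$, so $\|w(|D_x|)f\|_{L^2}^2=(2\pi)^{-n}\int_{\mathbb{R}^n}w(|\xi|)^2|\widehat f(\xi)|^2\,d\xi$, and $w(|D_x|)f\in L^2$ means that this is finite. The expression defining $C_1$ is understood in $[0,\infty]$ with the convention $1/0=+\infty$ (so finiteness of $C_1$ forces $\sigma(t)\neq0$ for all $t>0$ and $w\neq0$ almost everywhere). *)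

theory Defs
  imports "HOL-Analysis.Analysis"
begin

text \<open>
  The integral formula for the Bessel function of order \<open>l > -1/2\<close> is a priori complex; taking
  the real part loses nothing, see \<open>complex_of_real_bessel_J\<close> below.
\<close>

definition bessel_J :: "real \<Rightarrow> real \<Rightarrow> real" where
  "bessel_J l t = Re (complex_of_real (t powr l / (2 powr l * Gamma (l + 1/2) * Gamma (1/2))) *
     (LINT r:{-1..1}|lborel. exp (\<i> * complex_of_real (t * r)) *
        complex_of_real ((1 - r\<^sup>2) powr (l - 1/2))))"

lemma complex_of_real_bessel_J:
  "complex_of_real (bessel_J l t) =
     complex_of_real (t powr l / (2 powr l * Gamma (l + 1/2) * Gamma (1/2))) *
     (LINT r:{-1..1}|lborel. exp (\<i> * complex_of_real (t * r)) *
        complex_of_real ((1 - r\<^sup>2) powr (l - 1/2)))"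
proof -
  define g where "g r = indicator {-1..1::real} r *\<^sub>R (exp (\<i> * complex_of_real (t * r)) *
        complex_of_real ((1 - r\<^sup>2) powr (l - 1/2)))" for r
  have sym: "cnj (g r) = g (- r)" for r
    by (cases "r \<in> {-1..1}") (auto simp: g_def exp_cnj indicator_def)
  have "cnj (integral\<^sup>L lborel g) = (LINT r|lborel. cnj (g r))"
    by simp
  also have "\<dots> = (LINT r|lborel. g (- r))"
    by (simp only: sym)
  also have "\<dots> = integral\<^sup>L lborel g"
    using lborel_integral_real_affine[of "-1" g 0] by simp
  finally have "integral\<^sup>L lborel g \<in> \<real>"
    by (simp add: Reals_cnj_iff)
  then have "complex_of_real c * integral\<^sup>L lborel g \<in> \<real>" for c
    by simp
  then show ?thesis
    unfolding bessel_J_def set_lebesgue_integral_def g_def [symmetric] by (rule of_real_Re)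
qed

definition ennreal_sqrt :: "ennreal \<Rightarrow> ennreal" where
  "ennreal_sqrt x = (if x = \<infinity> then \<infinity> else ennreal (sqrt (enn2real x)))"

lemma ennreal_sqrt_power2: "(ennreal_sqrt x)\<^sup>2 = x"
  by (cases x) (auto simp: ennreal_sqrt_def ennreal_power simp flip: power2_eq_square)

text \<open>
  Division in \<^typ>\<open>ennreal\<close> satisfies \<open>1 / 0 = \<infinity>\<close>, so \<open>\<sigma>\<close> and \<open>w\<close> may vanish here;
  only their values on \<open>(0, \<infinity>)\<close> are used.
\<close>

definition sphere_trace_const :: "nat \<Rightarrow> (real \<Rightarrow> real) \<Rightarrow> (real \<Rightarrow> real) \<Rightarrow> ennreal" where
  "sphere_trace_const n \<sigma> w = ennreal_sqrt
     (SUP (t, k) \<in> {0<..} \<times> (UNIV :: nat set).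
        1 / ennreal ((\<sigma> t)\<^sup>2) *
        (\<integral>\<^sup>+r\<in>{0<..}. ennreal ((bessel_J (real n / 2 + real k - 1) (r * t))\<^sup>2) *
            (ennreal r / ennreal ((w r)\<^sup>2)) \<partial>lebesgue))"

text \<open>
  Surface measure on the unit sphere, as the derivative of volume in polar coordinates:
  the measure of \<open>A\<close> is \<open>DIM('a)\<close> times the volume of the cone
  \<open>{r \<omega> | 0 < r < 1, \<omega> \<in> A}\<close>.  It is a measure on the whole space, concentrated on \<open>sphere 0 1\<close>.
\<close>

definition surface_measure :: "'a::euclidean_space measure" where
  "surface_measure = scale_measure (of_nat DIM('a))
     (distr (restrict_space lborel (ball 0 1 - {0})) borel sgn)"

lemma emeasure_surface_measure:
  fixes A :: "'a::euclidean_space set"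
  assumes "A \<in> sets borel"
  shows "emeasure surface_measure A =
    of_nat DIM('a) * emeasure lborel {x. 0 < norm x \<and> norm x < 1 \<and> x /\<^sub>R norm x \<in> A}"
proof -
  let ?M = "restrict_space lborel (ball (0::'a) 1 - {0})"
  have m: "sgn \<in> measurable ?M (borel :: 'a measure)"
    unfolding sgn_div_norm by (rule measurable_restrict_space1) measurable
  have "emeasure (distr ?M borel sgn) A = emeasure ?M (sgn -` A \<inter> space ?M)"
    using assms m by (simp add: emeasure_distr)
  also have "\<dots> = emeasure lborel (sgn -` A \<inter> (ball (0::'a) 1 - {0}))"
    by (subst emeasure_restrict_space) (auto simp: space_restrict_space)
  also have "sgn -` A \<inter> (ball (0::'a) 1 - {0}) =
      {x. 0 < norm x \<and> norm x < 1 \<and> x /\<^sub>R norm x \<in> A}"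
    by (auto simp: sgn_div_norm)
  finally show ?thesis
    using assms by (simp add: surface_measure_def)
qed

definition sphere_L2_norm :: "real \<Rightarrow> ('a::euclidean_space \<Rightarrow> complex) \<Rightarrow> real" where
  "sphere_L2_norm \<rho> g =
     sqrt (LINT \<omega>|surface_measure. (cmod (g (\<rho> *\<^sub>R \<omega>)))\<^sup>2 * \<rho> ^ (DIM('a) - 1))"

definition inv_fourier :: "('a::euclidean_space \<Rightarrow> complex) \<Rightarrow> 'a \<Rightarrow> complex" where
  "inv_fourier F x = complex_of_real (1 / (2 * pi) ^ DIM('a)) *
     (LINT \<xi>|lebesgue. exp (\<i> * complex_of_real (x \<bullet> \<xi>)) * F \<xi>)"

text \<open>
  \<open>f\<close> is the inverse Fourier transform of the \<open>L\<^sup>1\<close> function \<open>F\<close>.  Since \<open>f\<close> itself need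
  not be integrable, this is the meaning of ``\<open>F\<close> is the Fourier transform of \<open>f\<close>''.
\<close>

definition has_L1_fourier_transform ::
    "('a::euclidean_space \<Rightarrow> complex) \<Rightarrow> ('a \<Rightarrow> complex) \<Rightarrow> bool" where
  "has_L1_fourier_transform f F \<longleftrightarrow> integrable lebesgue F \<and> f = inv_fourier F"

text \<open>
  Membership in \<open>L\<^sup>2\<close> and \<open>L\<^sup>2\<close> norm of \<open>w(|D|) f\<close>, where \<open>F\<close> is the Fourier transform of
  \<open>f\<close>, via Plancherel's formula.
\<close>

definition multiplier_in_L2 :: "(real \<Rightarrow> real) \<Rightarrow> ('a::euclidean_space \<Rightarrow> complex) \<Rightarrow> bool" where
  "multiplier_in_L2 w F \<longleftrightarrow> integrable lebesgue (\<lambda>\<xi>. (w (norm \<xi>))\<^sup>2 * (cmod (F \<xi>))\<^sup>2)"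

definition multiplier_L2_norm :: "(real \<Rightarrow> real) \<Rightarrow> ('a::euclidean_space \<Rightarrow> complex) \<Rightarrow> real" where
  "multiplier_L2_norm w F =
     sqrt (1 / (2 * pi) ^ DIM('a) * (LINT \<xi>|lebesgue. (w (norm \<xi>))\<^sup>2 * (cmod (F \<xi>))\<^sup>2))"

end

theory Submission
  imports Defs
begin

text \<open>
  Write \<open>\<nu> k = n/2 + k - 1\<close>.  The map \<open>g \<mapsto> \<integral> exp (i \<rho> \<omega> \<bullet> \<xi>) g \<omega> d\<omega>\<close>, adjoint to the restriction of
  \<open>\<F>\<^sup>-\<^sup>1 F\<close> to \<open>\<rho> S\<close>, sends a spherical harmonic \<open>Y\<close> of degree \<open>k\<close> to
  \<open>i\<^sup>k (2 \<pi>)\<^bsup>n/2\<^esup> s\<^bsup>1 - n/2\<^esup> J\<^bsub>\<nu> k\<^esub>(s) Y (\<xi>/|\<xi>|)\<close> with \<open>s = \<rho> |\<xi>|\<close>.  Hence, testing the restriction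
  against a finite sum of harmonics, polar coordinates, orthogonality and the Cauchy-Schwarz inequality
  give the bound, and such sums are dense by the Stone-Weierstrass theorem.  The factors for different
  \<open>k\<close> do not interact, so equality in Cauchy-Schwarz for a single harmonic gives sharpness.

  The formula for the adjoint is obtained without rotation invariance or the Laplacian: for \<open>Y\<close>
  orthogonal on the sphere to all homogeneous polynomials of lower degree, the moments
  \<open>\<integral> (x \<bullet> \<theta>)\<^sup>j Y \<theta> d\<theta>\<close> are read off from the Gaussian integral of \<open>exp (x \<bullet> y) Y y\<close>.
\<close>

section \<open>Polar coordinates and Gaussian integrals\<close>

text \<open>After squaring and removing the powers of 2 pi and \<rho>, the estimate at a fixed
  radius amounts to \<open>bessel_weight_integral\<close> n w \<rho> k \<le> (C \<sigma>(\<rho>))^2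
  for every k. Both halves of the theorem are this one comparison: the best constant at one radius
  is a supremum over k, \<sigma> only normalises it, and C1 takes the further supremum over all
  radii.

  The argument divides by w and cancels \<sigma>(t), although neither is assumed to be nonzero. This
  must come out of the finiteness of C1: the Bessel functions concerned are positive on (0, 1], so a
  zero of \<sigma>, or a zero set of w of positive measure, would make C1 infinite.

  Since w is only Lebesgue measurable, composing it with the norm and applying Fubini's theorem are
  not directly available; w and F are therefore replaced by Borel functions that agree with them
  almost everywhere.

  Integrals over the sphere are evaluated as Gaussian integrals over the whole space because
  translations and reflections are at hand for Lebesgue measure, while the surface measure is known
  only as the volume of cones.\<close>

lemma sets_surface_measure [simp, measurable_cong]:
  "sets (surface_measure :: 'a::euclidean_space measure) = sets borel"
  by (simp add: surface_measure_def)

lemma space_surface_measure [simp]: "space (surface_measure :: 'a::euclidean_space measure) = UNIV"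
  by (simp add: surface_measure_def space_scale_measure)

lemma measurable_sgn [measurable]: "(sgn :: 'a::euclidean_space \<Rightarrow> 'a) \<in> borel_measurable borel"
  unfolding sgn_div_norm by measurable

lemma nn_integral_surface_measure:
  fixes F :: "'a::euclidean_space \<Rightarrow> ennreal"
  assumes [measurable]: "F \<in> borel_measurable borel"
  shows "(\<integral>\<^sup>+x. F x \<partial>surface_measure) =
    of_nat DIM('a) * (\<integral>\<^sup>+y. F (sgn y) * indicator (ball 0 1 - {0}) y \<partial>lborel)"
proof -
  have m: "sgn \<in> measurable (restrict_space lborel (ball (0::'a) 1 - {0})) borel"
    by (rule measurable_restrict_space1) simp
  show ?thesis
    unfolding surface_measure_def
    by (subst nn_integral_scale_measure)
       (use m in \<open>auto simp: nn_integral_distr nn_integral_restrict_space\<close>)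
qed

lemma AE_surface_measure_norm: "AE x in (surface_measure :: 'a::euclidean_space measure). norm x = 1"
proof -
  have m [measurable]: "{x::'a. norm x \<noteq> 1} \<in> sets borel"
    by measurable
  have "emeasure surface_measure {x::'a. norm x \<noteq> 1} =
      of_nat DIM('a) * emeasure lborel {x::'a. 0 < norm x \<and> norm x < 1 \<and> norm (x /\<^sub>R norm x) \<noteq> 1}"
    by (subst emeasure_surface_measure[OF m]) simp
  also have "{x::'a. 0 < norm x \<and> norm x < 1 \<and> norm (x /\<^sub>R norm x) \<noteq> 1} = {}"
    by (auto simp: field_simps)
  finally show ?thesis
    by (intro AE_I[where N="{x. norm x \<noteq> 1}"]) (use m in auto)
qed

lemma emeasure_surface_measure_UNIV:
  "emeasure (surface_measure :: 'a::euclidean_space measure) UNIV =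
    ennreal (DIM('a) * unit_ball_vol DIM('a))"
proof -
  have "emeasure (surface_measure :: 'a measure) UNIV =
      of_nat DIM('a) * emeasure lborel (ball (0::'a) 1 - {0})"
    by (subst emeasure_surface_measure)
       (auto intro!: arg_cong[where f="\<lambda>A. of_nat DIM('a) * emeasure lborel A"])
  also have "emeasure lborel (ball (0::'a) 1 - {0}) = emeasure lborel (ball (0::'a) 1)"
    by (subst emeasure_Diff) auto
  also have "\<dots> = ennreal (unit_ball_vol DIM('a))"
    by (simp add: emeasure_ball)
  finally show ?thesis
    by (simp add: ennreal_mult ennreal_of_nat_eq_real_of_nat)
qed

lemma finite_measure_surface_measure: "finite_measure (surface_measure :: 'a::euclidean_space measure)"
  by standard (simp add: emeasure_surface_measure_UNIV)

interpretation surface: finite_measure "surface_measure :: 'a::euclidean_space measure"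
  by (rule finite_measure_surface_measure)

lemma nn_integral_lborel_scale:
  fixes F :: "'a::euclidean_space \<Rightarrow> ennreal"
  assumes [measurable]: "F \<in> borel_measurable borel" and "c \<noteq> 0"
  shows "(\<integral>\<^sup>+x. F x \<partial>lborel) = ennreal (\<bar>c\<bar> ^ DIM('a)) * (\<integral>\<^sup>+x. F (c *\<^sub>R x) \<partial>lborel)"
  by (subst lborel_affine[OF \<open>c \<noteq> 0\<close>, of 0])
     (simp add: nn_integral_density nn_integral_distr nn_integral_cmult)

text \<open>In the proof of polar coordinates this integral, with a = |x|, cancels the weight n
  |x|^n that a point x has accumulated.\<close>

lemma nn_integral_inverse_power_tail:
  assumes "a > (0::real)" "n > 0"
  shows "(\<integral>\<^sup>+t. ennreal (inverse (t ^ Suc n)) * indicator {a<..} t \<partial>lborel) =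
    ennreal (inverse (n * a ^ n))"
proof -
  have "(\<integral>\<^sup>+t. ennreal (inverse (t ^ Suc n)) * indicator {a<..} t \<partial>lborel) =
      (\<integral>\<^sup>+t. ennreal (inverse (t ^ Suc n)) * indicator {a..} t \<partial>lborel)"
  proof (rule nn_integral_cong_AE)
    show "AE t in lborel. ennreal (inverse (t ^ Suc n)) * indicator {a<..} t =
        ennreal (inverse (t ^ Suc n)) * indicator {a..} t"
      using AE_lborel_singleton[of a] by eventually_elim (auto simp: indicator_def)
  qed
  also have "\<dots> = ennreal (0 - (- inverse (n * a ^ n)))"
  proof (rule nn_integral_FTC_atLeast)
    fix t assume "a \<le> t"
    then have t: "t > 0" using assms by simp
    have "inverse (t ^ Suc n) = real n * t ^ (n - 1) * inverse (n * t ^ n) * inverse (t ^ n)"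
    proof -
      have "t ^ n = t * t ^ (n - 1)" using assms by (cases n) auto
      then show ?thesis using t assms by (simp add: field_simps)
    qed
    moreover have "((\<lambda>t. - inverse (n * t ^ n)) has_real_derivative
        real n * t ^ (n - 1) * inverse (n * t ^ n) * inverse (t ^ n)) (at t)"
      using t assms by (auto intro!: derivative_eq_intros simp: field_simps)
    ultimately show "((\<lambda>t. - inverse (n * t ^ n)) has_real_derivative inverse (t ^ Suc n)) (at t)"
      by (simp only:)
    show "0 \<le> inverse (t ^ Suc n)" using t by simp
  next
    have "((\<lambda>t. inverse (t ^ n)) \<longlongrightarrow> (0::real)) at_top"
      using assms by (intro tendsto_inverse_0_at_top filterlim_pow_at_top filterlim_ident) auto
    then have "((\<lambda>t. - (inverse n * inverse (t ^ n))) \<longlongrightarrow> - (inverse n * (0::real))) at_top"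
      by (intro tendsto_intros)
    then show "((\<lambda>t::real. - inverse (n * t ^ n)) \<longlongrightarrow> 0) at_top"
      by simp
  qed auto
  finally show ?thesis by simp
qed

text \<open>The surface measure is defined by cones, so the right-hand side is a double integral
  over a radius r and a point y of the unit ball. Substituting r = t |y| and then x = t y, with
  Fubini's theorem in between, turns the integrand into F x, and each x receives the weight n |x|^n
  times the integral of t^(-n-1) over t > |x|, which is 1.\<close>

theorem nn_integral_polar:
  fixes F :: "'a::euclidean_space \<Rightarrow> ennreal"
  assumes [measurable]: "F \<in> borel_measurable borel"
  shows "(\<integral>\<^sup>+x. F x \<partial>lborel) =
    (\<integral>\<^sup>+r. ennreal (r ^ (DIM('a) - 1)) * indicator {0<..} r *
       (\<integral>\<^sup>+\<omega>. F (r *\<^sub>R \<omega>) \<partial>surface_measure) \<partial>lborel)"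
proof -
  define n where "n = DIM('a)"
  have n: "n > 0" by (simp add: n_def)
  have [measurable]: "ball 0 1 - {0::'a} \<in> sets borel" by auto
  let ?B = "indicator (ball 0 1 - {0}) :: 'a \<Rightarrow> ennreal" and ?P = "indicator {0<..} :: real \<Rightarrow> ennreal"
  have "(\<integral>\<^sup>+r. ennreal (r ^ (n - 1)) * ?P r * (\<integral>\<^sup>+\<omega>. F (r *\<^sub>R \<omega>) \<partial>surface_measure) \<partial>lborel) =
      (\<integral>\<^sup>+r. \<integral>\<^sup>+y. of_nat n * ?B y * (ennreal (r ^ (n - 1)) * ?P r * F (r *\<^sub>R sgn y)) \<partial>lborel \<partial>lborel)"
  proof (rule nn_integral_cong)
    fix r :: real
    have "ennreal (r ^ (n - 1)) * ?P r * (\<integral>\<^sup>+\<omega>. F (r *\<^sub>R \<omega>) \<partial>surface_measure) =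
      (of_nat n * (ennreal (r ^ (n - 1)) * ?P r)) * (\<integral>\<^sup>+y. F (r *\<^sub>R sgn y) * ?B y \<partial>lborel)"
      by (subst nn_integral_surface_measure) (auto simp: n_def ac_simps)
    also have "\<dots> = (\<integral>\<^sup>+y. of_nat n * (ennreal (r ^ (n - 1)) * ?P r) * (F (r *\<^sub>R sgn y) * ?B y) \<partial>lborel)"
      by (rule nn_integral_cmult[symmetric]) measurable
    finally show "ennreal (r ^ (n - 1)) * ?P r * (\<integral>\<^sup>+\<omega>. F (r *\<^sub>R \<omega>) \<partial>surface_measure) =
      (\<integral>\<^sup>+y. of_nat n * ?B y * (ennreal (r ^ (n - 1)) * ?P r * F (r *\<^sub>R sgn y)) \<partial>lborel)"
      by (simp add: ac_simps)
  qed
  also have "\<dots> =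
      (\<integral>\<^sup>+y. \<integral>\<^sup>+r. of_nat n * ?B y * (ennreal (r ^ (n - 1)) * ?P r * F (r *\<^sub>R sgn y)) \<partial>lborel \<partial>lborel)"
    by (rule lborel_pair.Fubini'[symmetric]) (simp add: case_prod_unfold)
  \<comment> \<open>For fixed y the substitution is r = t |y|: it contributes |y| from dr and
    |y|^(n-1) from r^(n-1), and replaces r \<open>sgn\<close> y by t y.\<close>
  also have "\<dots> =
      (\<integral>\<^sup>+y. \<integral>\<^sup>+t. of_nat n * ?B y * (ennreal (norm y ^ n) * ennreal (t ^ (n - 1)) * ?P t * F (t *\<^sub>R y)) \<partial>lborel \<partial>lborel)"
  proof (rule nn_integral_cong)
    fix y :: 'a
    show "(\<integral>\<^sup>+r. of_nat n * ?B y * (ennreal (r ^ (n - 1)) * ?P r * F (r *\<^sub>R sgn y)) \<partial>lborel) =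
      (\<integral>\<^sup>+t. of_nat n * ?B y * (ennreal (norm y ^ n) * ennreal (t ^ (n - 1)) * ?P t * F (t *\<^sub>R y)) \<partial>lborel)"
    proof (cases "y = 0")
      case False
      then have pos: "norm y > 0" by simp
      have "(\<integral>\<^sup>+r. ennreal (r ^ (n - 1)) * ?P r * F (r *\<^sub>R sgn y) \<partial>lborel) =
        ennreal (norm y) * (\<integral>\<^sup>+t. ennreal ((norm y * t) ^ (n - 1)) * ?P (norm y * t) * F ((norm y * t) *\<^sub>R sgn y) \<partial>lborel)"
        using pos by (subst nn_integral_real_affine[where c="norm y" and t=0]) auto
      also have "\<dots> = (\<integral>\<^sup>+t. ennreal (norm y ^ n) * ennreal (t ^ (n - 1)) * ?P t * F (t *\<^sub>R y) \<partial>lborel)"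
      proof (rule trans[OF nn_integral_cmult[symmetric]], measurable, rule nn_integral_cong)
        fix t :: real
        have "norm y * norm y ^ (n - 1) = norm y ^ n"
          using n by (cases n) auto
        moreover have "(norm y * t) *\<^sub>R sgn y = t *\<^sub>R y"
          using pos by (simp add: sgn_div_norm)
        ultimately show "ennreal (norm y) * (ennreal ((norm y * t) ^ (n - 1)) * ?P (norm y * t) * F ((norm y * t) *\<^sub>R sgn y)) =
          ennreal (norm y ^ n) * ennreal (t ^ (n - 1)) * ?P t * F (t *\<^sub>R y)"
          using pos
          by (cases "t > 0")
             (auto simp: zero_less_mult_iff power_mult_distrib ennreal_mult[symmetric]
                mult.assoc[symmetric] indicator_def)
      qed
      finally show ?thesis
        by (simp add: nn_integral_cmult)
    qed simp
  qed
  also have "\<dots> =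
      (\<integral>\<^sup>+t. \<integral>\<^sup>+y. of_nat n * ?B y * (ennreal (norm y ^ n) * ennreal (t ^ (n - 1)) * ?P t * F (t *\<^sub>R y)) \<partial>lborel \<partial>lborel)"
    by (rule lborel_pair.Fubini') (simp add: case_prod_unfold)
  \<comment> \<open>For fixed t the substitution is x = t y; the condition |y| < 1 becomes |x| < t,
    and the powers of t collect to t^(-n-1).\<close>
  also have "\<dots> =
      (\<integral>\<^sup>+t. \<integral>\<^sup>+x. of_nat n * indicator {0<..<t} (norm x) * ennreal (norm x ^ n) * ennreal (inverse (t ^ Suc n)) * F x \<partial>lborel \<partial>lborel)"
  proof (rule nn_integral_cong)
    fix t :: real
    show "(\<integral>\<^sup>+y. of_nat n * ?B y * (ennreal (norm y ^ n) * ennreal (t ^ (n - 1)) * ?P t * F (t *\<^sub>R y)) \<partial>lborel) =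
      (\<integral>\<^sup>+x. of_nat n * indicator {0<..<t} (norm x) * ennreal (norm x ^ n) * ennreal (inverse (t ^ Suc n)) * F x \<partial>lborel)"
    proof (cases "t > 0")
      case True
      have e: "ennreal (norm y ^ n) * ennreal (t ^ (n - 1)) =
        ennreal (t ^ n) * (ennreal ((t * norm y) ^ n) * ennreal (inverse (t ^ Suc n)))" for y :: 'a
      proof -
        have tn: "t ^ n = t * t ^ (n - 1)" using n by (cases n) auto
        have "norm y ^ n * t ^ (n - 1) = t ^ n * ((t * norm y) ^ n * inverse (t ^ Suc n))"
          using True by (simp add: power_mult_distrib tn divide_simps)
        then show ?thesis using True by (simp add: ennreal_mult[symmetric])
      qed
      have "(\<integral>\<^sup>+x. of_nat n * indicator {0<..<t} (norm x) * ennreal (norm x ^ n) * ennreal (inverse (t ^ Suc n)) * F x \<partial>lborel)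
        = ennreal (t ^ n) * (\<integral>\<^sup>+x. of_nat n * indicator {0<..<t} (norm (t *\<^sub>R x)) * ennreal (norm (t *\<^sub>R x) ^ n) *
            ennreal (inverse (t ^ Suc n)) * F (t *\<^sub>R x) \<partial>lborel)"
        using True by (subst nn_integral_lborel_scale[where c=t]) (auto simp: n_def)
      also have "\<dots> = (\<integral>\<^sup>+y. of_nat n * ?B y * (ennreal (norm y ^ n) * ennreal (t ^ (n - 1)) * ?P t * F (t *\<^sub>R y)) \<partial>lborel)"
      proof (rule trans[OF nn_integral_cmult[symmetric]], measurable, rule nn_integral_cong)
        fix y :: 'a
        have "indicator {0<..<t} (norm (t *\<^sub>R y)) = ?B y" "norm (t *\<^sub>R y) = t * norm y"
          using True by (auto simp: indicator_def)
        then show "ennreal (t ^ n) * (of_nat n * indicator {0<..<t} (norm (t *\<^sub>R y)) * ennreal (norm (t *\<^sub>R y) ^ n) *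
            ennreal (inverse (t ^ Suc n)) * F (t *\<^sub>R y)) =
          of_nat n * ?B y * (ennreal (norm y ^ n) * ennreal (t ^ (n - 1)) * ?P t * F (t *\<^sub>R y))"
          using True by (simp only: e) (simp add: ac_simps)
      qed
      finally show ?thesis by simp
    qed (auto simp: indicator_def)
  qed
  also have "\<dots> =
      (\<integral>\<^sup>+x. \<integral>\<^sup>+t. of_nat n * indicator {0<..<t} (norm x) * ennreal (norm x ^ n) * ennreal (inverse (t ^ Suc n)) * F x \<partial>lborel \<partial>lborel)"
    by (rule lborel_pair.Fubini'[symmetric]) (simp add: case_prod_unfold indicator_def)
  also have "\<dots> = (\<integral>\<^sup>+x. F x \<partial>lborel)"
  proof (rule nn_integral_cong_AE, rule AE_mp[OF AE_lborel_singleton[of "0::'a"] AE_I2], rule impI)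
    fix x :: 'a assume "x \<noteq> 0"
    then have x: "norm x > 0" by simp
    have "(\<integral>\<^sup>+t. of_nat n * indicator {0<..<t} (norm x) * ennreal (norm x ^ n) * ennreal (inverse (t ^ Suc n)) * F x \<partial>lborel)
      = (\<integral>\<^sup>+t. (of_nat n * ennreal (norm x ^ n) * F x) * (ennreal (inverse (t ^ Suc n)) * indicator {norm x<..} t) \<partial>lborel)"
      using x by (intro nn_integral_cong) (auto simp: indicator_def ac_simps)
    also have "\<dots> = (of_nat n * ennreal (norm x ^ n) * F x) * ennreal (inverse (n * norm x ^ n))"
      by (subst nn_integral_cmult, measurable) (simp only: nn_integral_inverse_power_tail[OF x n])
    also have "\<dots> = (ennreal n * ennreal (norm x ^ n) * ennreal (inverse (n * norm x ^ n))) * F x"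
      by (simp add: ac_simps ennreal_of_nat_eq_real_of_nat)
    also have "ennreal n * ennreal (norm x ^ n) * ennreal (inverse (n * norm x ^ n)) = 1"
      using n x by (simp add: ennreal_mult[symmetric] field_simps)
    finally show "(\<integral>\<^sup>+t. of_nat n * indicator {0<..<t} (norm x) * ennreal (norm x ^ n) * ennreal (inverse (t ^ Suc n)) * F x \<partial>lborel) = F x"
      by simp
  qed
  finally show ?thesis
    by (simp add: n_def)
qed

text \<open>The value of the integral of r^d exp(-r^2/2) over r > 0.\<close>

definition radial_moment :: "nat \<Rightarrow> real" where
  "radial_moment d = 2 powr ((real d - 1) / 2) * Gamma ((real d + 1) / 2)"

lemma radial_moment_pos: "radial_moment d > 0"
  by (simp add: radial_moment_def Gamma_real_pos)

text \<open>The substitution r = sqrt(2 t) leads to Euler's integral for Gamma((d + 1)/2).\<close>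

lemma nn_integral_radial_moment:
  "(\<integral>\<^sup>+r. ennreal (r ^ d * exp (- r\<^sup>2 / 2)) * indicator {0<..} r \<partial>lborel) = ennreal (radial_moment d)"
proof -
  define s where "s = (real d + 1) / 2"
  have s: "s > 0" by (simp add: s_def)
  define f where "f r = r ^ d * exp (- r\<^sup>2 / 2)" for r :: real
  define G where "G t = t powr (s - 1) / exp t" for t :: real
  have [measurable]: "G \<in> borel_measurable borel" unfolding G_def by measurable
  have G_nn: "(\<integral>\<^sup>+t. ennreal (G t) * indicator {0<..} t \<partial>lborel) = ennreal (Gamma s)"
    unfolding Gamma_conv_nn_integral_real[OF s] G_def
    by (rule nn_integral_cong_AE, rule AE_mp[OF AE_lborel_singleton[of 0] AE_I2])
       (auto simp: indicator_def)
  have G_int: "integrable lborel (\<lambda>t. indicator {0<..} t *\<^sub>R G t)"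
              "(LINT t|lborel. indicator {0<..} t *\<^sub>R G t) = Gamma s"
  proof -
    have "has_bochner_integral lborel (\<lambda>t. indicator {0<..} t *\<^sub>R G t) (Gamma s)"
    proof (rule has_bochner_integral_nn_integral)
      have "(\<integral>\<^sup>+t. ennreal (indicator {0<..} t *\<^sub>R G t) \<partial>lborel) =
          (\<integral>\<^sup>+t. ennreal (G t) * indicator {0<..} t \<partial>lborel)"
        by (rule nn_integral_cong) (auto simp: indicator_def)
      then show "(\<integral>\<^sup>+t. ennreal (indicator {0<..} t *\<^sub>R G t) \<partial>lborel) = ennreal (Gamma s)"
        by (simp add: G_nn)
    qed (use s in \<open>auto simp: G_def Gamma_real_pos less_imp_le\<close>)
    then show "integrable lborel (\<lambda>t. indicator {0<..} t *\<^sub>R G t)"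
              "(LINT t|lborel. indicator {0<..} t *\<^sub>R G t) = Gamma s"
      by (auto simp: has_bochner_integral_iff)
  qed
  have comp: "f (sqrt (2 * t)) * (1 / sqrt (2 * t)) = 2 powr ((real d - 1) / 2) * G t" if "t > 0" for t
  proof -
    have sq: "sqrt (2 * t) = (2 * t) powr (1 / 2)" using that by (simp add: powr_half_sqrt)
    have "sqrt (2 * t) ^ d * (1 / sqrt (2 * t)) = (2 * t) powr (real d / 2) / (2 * t) powr (1 / 2)"
      unfolding sq by (subst powr_power) (use that in auto)
    also have "\<dots> = (2 * t) powr (real d / 2 - 1 / 2)"
      by (simp add: powr_diff)
    also have "real d / 2 - 1 / 2 = (real d - 1) / 2" by (simp add: field_simps)
    also have "(2 * t) powr ((real d - 1) / 2) = 2 powr ((real d - 1) / 2) * t powr ((real d - 1) / 2)"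
      using that by (simp add: powr_mult)
    finally have eq: "sqrt (2 * t) ^ d * (1 / sqrt (2 * t)) = 2 powr ((real d - 1) / 2) * t powr ((real d - 1) / 2)" .
    have "f (sqrt (2 * t)) * (1 / sqrt (2 * t)) = (sqrt (2 * t) ^ d * (1 / sqrt (2 * t))) * exp (- t)"
      using that by (simp add: f_def)
    also have "\<dots> = 2 powr ((real d - 1) / 2) * (t powr ((real d - 1) / 2) / exp t)"
      unfolding eq by (simp only: exp_minus divide_inverse mult.assoc)
    also have "(real d - 1) / 2 = s - 1" by (simp add: s_def field_simps)
    finally show ?thesis
      by (simp add: G_def s_def field_simps)
  qed
  have E0: "einterval 0 \<infinity> = {0<..}" by (auto simp: einterval_def zero_ereal_def)
  have sub: "set_integrable lborel (einterval 0 \<infinity>) f"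
       "(LBINT x=0..\<infinity>. f x) = (LBINT t=0..\<infinity>. f (sqrt (2 * t)) * (1 / sqrt (2 * t)))"
  proof -
    have deriv: "DERIV (\<lambda>t. sqrt (2 * t)) x :> 1 / sqrt (2 * x)" if "0 < ereal x" "ereal x < \<infinity>" for x
      using that by (auto intro!: derivative_eq_intros simp: field_simps)
    have contf: "isCont f (sqrt (2 * x))" for x
      unfolding f_def by (intro continuous_intros) auto
    have contg: "isCont (\<lambda>t. 1 / sqrt (2 * t)) x" if "0 < ereal x" "ereal x < \<infinity>" for x
      using that by (intro continuous_intros) auto
    have f0: "0 \<le> f (sqrt (2 * x))" if "0 < ereal x" "ereal x < \<infinity>" for x
      using that by (simp add: f_def)
    have g0: "0 \<le> 1 / sqrt (2 * x)" if "0 \<le> ereal x" "ereal x \<le> \<infinity>" for x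
      using that by simp
    have "((\<lambda>t. ereal (sqrt (2 * t))) \<longlongrightarrow> ereal (sqrt (2 * 0))) (at_right 0)"
      by (intro tendsto_intros)
    then have lim0: "((ereal \<circ> (\<lambda>t. sqrt (2 * t)) \<circ> real_of_ereal) \<longlongrightarrow> 0) (at_right 0)"
      by (simp add: zero_ereal_def ereal_tendsto_simps1) (simp add: comp_def)
    have "filterlim (\<lambda>t. sqrt (2 * t)) at_top at_top"
      by (intro filterlim_compose[OF sqrt_at_top] filterlim_tendsto_pos_mult_at_top[OF tendsto_const]
          filterlim_ident) auto
    then have limtop: "((ereal \<circ> (\<lambda>t. sqrt (2 * t)) \<circ> real_of_ereal) \<longlongrightarrow> \<infinity>) (at_left \<infinity>)"
      by (simp add: ereal_tendsto_simps1 ereal_tendsto_simps2)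
    have "integrable lborel (\<lambda>t. 2 powr ((real d - 1) / 2) * (indicator {0<..} t *\<^sub>R G t))"
      using G_int by simp
    also have "?this \<longleftrightarrow> set_integrable lborel (einterval 0 \<infinity>) (\<lambda>t. f (sqrt (2 * t)) * (1 / sqrt (2 * t)))"
      unfolding set_integrable_def E0
      by (intro Bochner_Integration.integrable_cong) (auto simp: indicator_def comp[symmetric])
    finally have int: "set_integrable lborel (einterval 0 \<infinity>) (\<lambda>t. f (sqrt (2 * t)) * (1 / sqrt (2 * t)))" .
    note subst = interval_integral_substitution_nonneg[where f=f and g="\<lambda>t. sqrt (2 * t)",
        OF _ deriv contf contg f0 g0 lim0 limtop int]
    show "set_integrable lborel (einterval 0 \<infinity>) f"
         "(LBINT x=0..\<infinity>. f x) = (LBINT t=0..\<infinity>. f (sqrt (2 * t)) * (1 / sqrt (2 * t)))"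
      by (rule subst; simp)+
  qed
  have f_int: "integrable lborel (\<lambda>r. indicator {0<..} r *\<^sub>R f r)"
    using sub(1) unfolding set_integrable_def E0 .
  have "(LINT r|lborel. indicator {0<..} r *\<^sub>R f r) =
      (LINT t|lborel. indicator {0<..} t *\<^sub>R (f (sqrt (2 * t)) * (1 / sqrt (2 * t))))"
    using sub(2) by (simp add: interval_lebesgue_integral_def set_lebesgue_integral_def E0)
  also have "\<dots> = (LINT t|lborel. 2 powr ((real d - 1) / 2) * (indicator {0<..} t *\<^sub>R G t))"
    by (rule Bochner_Integration.integral_cong) (auto simp: indicator_def comp[symmetric])
  also have "\<dots> = radial_moment d"
    using G_int by (simp add: radial_moment_def s_def)
  finally have val: "(LINT r|lborel. indicator {0<..} r *\<^sub>R f r) = radial_moment d" .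
  have "(\<integral>\<^sup>+r. ennreal (f r) * indicator {0<..} r \<partial>lborel) =
      (\<integral>\<^sup>+r. ennreal (indicator {0<..} r *\<^sub>R f r) \<partial>lborel)"
    by (rule nn_integral_cong) (auto simp: indicator_def)
  also have "\<dots> = ennreal (radial_moment d)"
  proof -
    have "AE r in lborel. 0 \<le> indicator {0<..} r *\<^sub>R f r"
      by (simp add: f_def indicator_def)
    from nn_integral_eq_integral[OF f_int this] show ?thesis
      by (simp only: val)
  qed
  finally show ?thesis
    by (simp add: f_def)
qed

lemma integrable_surface_measure:
  fixes h :: "'a::euclidean_space \<Rightarrow> 'b::{banach, second_countable_topology}"
  assumes "continuous_on UNIV h"
  shows "integrable surface_measure h"
proof -
  have "bounded (h ` sphere 0 1)"
    by (intro compact_imp_bounded compact_continuous_image continuous_on_subset[OF assms]) auto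
  then obtain B where "\<forall>x\<in>sphere 0 1. norm (h x) \<le> B"
    by (auto simp: bounded_iff)
  then have B: "norm (h x) \<le> B" if "norm x = 1" for x
    using that by simp
  show ?thesis
  proof (rule surface.integrable_const_bound)
    show "AE x in surface_measure. norm (h x) \<le> B"
      using AE_surface_measure_norm by eventually_elim (rule B)
    show "h \<in> borel_measurable surface_measure"
      using borel_measurable_continuous_onI[OF assms] by simp
  qed
qed

lemma nn_integral_gauss_homogeneous:
  fixes h :: "'a::euclidean_space \<Rightarrow> real"
  assumes [measurable]: "h \<in> borel_measurable borel"
    and hom: "\<And>t x. t > 0 \<Longrightarrow> h (t *\<^sub>R x) = t ^ d * h x"
  shows "(\<integral>\<^sup>+y. ennreal (exp (- (norm y)\<^sup>2 / 2) * h y) \<partial>lborel) =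
    ennreal (radial_moment (DIM('a) - 1 + d)) * (\<integral>\<^sup>+\<omega>. ennreal (h \<omega>) \<partial>surface_measure)"
proof -
  have "(\<integral>\<^sup>+y. ennreal (exp (- (norm y)\<^sup>2 / 2) * h y) \<partial>lborel) =
    (\<integral>\<^sup>+r. ennreal (r ^ (DIM('a) - 1)) * indicator {0<..} r *
       (\<integral>\<^sup>+\<omega>. ennreal (exp (- (norm (r *\<^sub>R \<omega>::'a))\<^sup>2 / 2) * h (r *\<^sub>R \<omega>)) \<partial>surface_measure) \<partial>lborel)"
    by (subst nn_integral_polar) auto
  also have "\<dots> = (\<integral>\<^sup>+r. (ennreal (r ^ (DIM('a) - 1 + d) * exp (- r\<^sup>2 / 2)) * indicator {0<..} r) *
      (\<integral>\<^sup>+\<omega>. ennreal (h (\<omega>::'a)) \<partial>surface_measure) \<partial>lborel)"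
  proof (rule nn_integral_cong)
    fix r :: real
    show "ennreal (r ^ (DIM('a) - 1)) * indicator {0<..} r *
       (\<integral>\<^sup>+\<omega>. ennreal (exp (- (norm (r *\<^sub>R \<omega>::'a))\<^sup>2 / 2) * h (r *\<^sub>R \<omega>)) \<partial>surface_measure) =
      (ennreal (r ^ (DIM('a) - 1 + d) * exp (- r\<^sup>2 / 2)) * indicator {0<..} r) *
      (\<integral>\<^sup>+\<omega>. ennreal (h \<omega>) \<partial>surface_measure)"
    proof (cases "r > 0")
      case True
      have "(\<integral>\<^sup>+\<omega>. ennreal (exp (- (norm (r *\<^sub>R \<omega>::'a))\<^sup>2 / 2) * h (r *\<^sub>R \<omega>)) \<partial>surface_measure) =
          (\<integral>\<^sup>+\<omega>. ennreal (exp (- r\<^sup>2 / 2) * r ^ d) * ennreal (h (\<omega>::'a)) \<partial>surface_measure)"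
      proof (rule nn_integral_cong_AE)
        show "AE \<omega> in surface_measure. ennreal (exp (- (norm (r *\<^sub>R \<omega>::'a))\<^sup>2 / 2) * h (r *\<^sub>R \<omega>)) =
            ennreal (exp (- r\<^sup>2 / 2) * r ^ d) * ennreal (h \<omega>)"
          using AE_surface_measure_norm
          by eventually_elim (use True in \<open>simp add: hom ennreal_mult'[symmetric] mult.assoc\<close>)
      qed
      also have "\<dots> = ennreal (exp (- r\<^sup>2 / 2) * r ^ d) * (\<integral>\<^sup>+\<omega>. ennreal (h (\<omega>::'a)) \<partial>surface_measure)"
        by (rule nn_integral_cmult) simp
      moreover have "ennreal (r ^ (DIM('a) - 1 + d) * exp (- r\<^sup>2 / 2)) =
          ennreal (r ^ (DIM('a) - 1)) * ennreal (exp (- r\<^sup>2 / 2) * r ^ d)"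
        using True by (subst ennreal_mult[symmetric]) (auto simp del: add_diff_assoc2 simp: power_add)
      ultimately show ?thesis
        using True by (simp only: ac_simps)
    qed simp
  qed
  also have "\<dots> = ennreal (radial_moment (DIM('a) - 1 + d)) * (\<integral>\<^sup>+\<omega>. ennreal (h \<omega>) \<partial>surface_measure)"
    by (subst nn_integral_multc, measurable) (simp only: nn_integral_radial_moment)
  finally show ?thesis .
qed

text \<open>In polar coordinates a homogeneous function times a Gaussian separates into a radial and
  a spherical factor. This is the bridge by which properties of Lebesgue measure reach integrals
  over the sphere; the signed case follows by treating h and -h.\<close>

lemma gauss_homogeneous:
  fixes h :: "'a::euclidean_space \<Rightarrow> real"
  assumes cont: "continuous_on UNIV h"
    and hom: "\<And>t x. t > 0 \<Longrightarrow> h (t *\<^sub>R x) = t ^ d * h x"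
  shows "integrable lborel (\<lambda>y. exp (- (norm y)\<^sup>2 / 2) * h y)" (is ?int)
    and "(LINT y|lborel. exp (- (norm y)\<^sup>2 / 2) * h y) =
      radial_moment (DIM('a) - 1 + d) * (LINT \<omega>|surface_measure. h \<omega>)"
proof -
  let ?m = "radial_moment (DIM('a) - 1 + d)"
  have m: "?m \<ge> 0" using radial_moment_pos less_imp_le by blast
  have [measurable]: "h \<in> borel_measurable borel"
    using borel_measurable_continuous_onI[OF cont] .
  have S: "integrable surface_measure h"
    by (rule integrable_surface_measure[OF cont])
  have pos: "(\<integral>\<^sup>+y. ennreal (exp (- (norm y)\<^sup>2 / 2) * h y) \<partial>lborel) =
      ennreal ?m * (\<integral>\<^sup>+\<omega>. ennreal (h \<omega>) \<partial>surface_measure)"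
    by (rule nn_integral_gauss_homogeneous) (auto simp: hom)
  have neg: "(\<integral>\<^sup>+y. ennreal (- (exp (- (norm y)\<^sup>2 / 2) * h y)) \<partial>lborel) =
      ennreal ?m * (\<integral>\<^sup>+\<omega>. ennreal (- h \<omega>) \<partial>surface_measure)"
    using nn_integral_gauss_homogeneous[of "\<lambda>x. - h x" d] by (auto simp: hom)
  have fin: "(\<integral>\<^sup>+\<omega>. ennreal (h \<omega>) \<partial>surface_measure) \<noteq> \<infinity>" "(\<integral>\<^sup>+\<omega>. ennreal (- h \<omega>) \<partial>surface_measure) \<noteq> \<infinity>"
    using S by (auto simp: real_integrable_def)
  show ?int
    unfolding real_integrable_def pos neg using fin by (auto simp: ennreal_mult_eq_top_iff)
  then show "(LINT y|lborel. exp (- (norm y)\<^sup>2 / 2) * h y) = ?m * (LINT \<omega>|surface_measure. h \<omega>)"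
    using m unfolding real_lebesgue_integral_def[OF \<open>?int\<close>] real_lebesgue_integral_def[OF S] pos neg
    by (simp add: enn2real_mult right_diff_distrib)
qed

text \<open>The case of degree 0: the area of the sphere is the dimension times the volume of the
  unit ball, and the Gamma factor of that volume cancels the one in
  \<open>radial_moment\<close>.\<close>

lemma gauss_total:
  "integrable lborel (\<lambda>y::'a::euclidean_space. exp (- (norm y)\<^sup>2 / 2))"
  "(LINT y|lborel. exp (- (norm (y::'a))\<^sup>2 / 2)) = (2 * pi) powr (DIM('a) / 2)"
proof -
  show "integrable lborel (\<lambda>y::'a. exp (- (norm y)\<^sup>2 / 2))"
    using gauss_homogeneous(1)[of "\<lambda>_::'a. 1" 0] by simp
  have m: "measure (surface_measure :: 'a measure) UNIV = DIM('a) * unit_ball_vol DIM('a)"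
    by (simp add: measure_def emeasure_surface_measure_UNIV)
  have "(LINT y|lborel. exp (- (norm (y::'a))\<^sup>2 / 2)) =
      radial_moment (DIM('a) - 1) * (DIM('a) * unit_ball_vol DIM('a))"
    using gauss_homogeneous(2)[of "\<lambda>_::'a. 1" 0] by (simp add: m)
  also have "\<dots> = (2 * pi) powr (DIM('a) / 2)"
  proof -
    define n where "n = real DIM('a)"
    have n: "n > 0" by (simp add: n_def)
    have "real (DIM('a) - 1) = n - 1" by (simp add: n_def of_nat_diff Suc_leI)
    then have "radial_moment (DIM('a) - 1) = 2 powr (n / 2 - 1) * Gamma (n / 2)"
      by (simp add: radial_moment_def diff_divide_distrib)
    also have "2 powr (n / 2 - 1) = 2 powr (n / 2) / (2::real)"
      by (simp add: powr_diff)
    finally have r: "radial_moment (DIM('a) - 1) = 2 powr (n / 2) / 2 * Gamma (n / 2)" .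
    have "Gamma (n / 2 + 1) = n / 2 * Gamma (n / 2)"
      using n by (intro Gamma_plus1) (auto simp: nonpos_Ints_def)
    moreover have g: "Gamma (n / 2) \<noteq> 0" using n by (intro less_imp_neq[THEN not_sym] Gamma_real_pos) simp
    ultimately have "radial_moment (DIM('a) - 1) * (n * unit_ball_vol n) = 2 powr (n / 2) * pi powr (n / 2)"
      unfolding r unit_ball_vol_def using n g by (auto simp: field_simps)
    then show ?thesis
      by (simp add: n_def powr_mult)
  qed
  finally show "(LINT y|lborel. exp (- (norm (y::'a))\<^sup>2 / 2)) = (2 * pi) powr (DIM('a) / 2)" .
qed

text \<open>Dominated convergence, with exp(|z|) |g| dominating all partial sums. The field is left
  general because the expansion is used for real Gaussian integrals as well as for the oscillating
  complex ones.\<close>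

lemma integral_exp_sums:
  fixes z g :: "'a \<Rightarrow> 'c::{real_normed_field, banach, second_countable_topology}"
  assumes [measurable]: "z \<in> borel_measurable M" "g \<in> borel_measurable M"
    and int: "integrable M (\<lambda>x. exp (norm (z x)) * norm (g x))"
  shows "integrable M (\<lambda>x. z x ^ j / fact j * g x)"
    and "(\<lambda>j. LINT x|M. z x ^ j / fact j * g x) sums (LINT x|M. exp (z x) * g x)"
proof -
  have partial: "(\<Sum>j\<in>J. norm (z x ^ j / fact j)) \<le> exp (norm (z x))" if "finite J" for J x
  proof -
    have "(\<Sum>j\<in>J. norm (z x ^ j / fact j)) = (\<Sum>j\<in>J. norm (z x) ^ j /\<^sub>R fact j)"
      by (simp add: norm_mult norm_inverse norm_power divide_inverse mult.commute)
    also have "\<dots> \<le> exp (norm (z x))"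
      unfolding exp_def by (rule sum_le_suminf[OF summable_exp_generic that]) auto
    finally show ?thesis .
  qed
  show each: "integrable M (\<lambda>x. z x ^ j / fact j * g x)" for j
  proof (rule Bochner_Integration.integrable_bound[OF int])
    have "norm (z x ^ j / fact j) * norm (g x) \<le> exp (norm (z x)) * norm (g x)" for x
      using partial[of "{j}" x] by (intro mult_right_mono) auto
    then show "AE x in M. norm (z x ^ j / fact j * g x) \<le> norm (exp (norm (z x)) * norm (g x))"
      by (auto simp: norm_mult simp del: times_divide_eq_left times_divide_eq_right)
  qed measurable
  have "(\<lambda>N. LINT x|M. (\<Sum>j<N. z x ^ j / fact j * g x)) \<longlonglongrightarrow> (LINT x|M. exp (z x) * g x)"
  proof (rule integral_dominated_convergence[OF _ _ int])
    show "AE x in M. (\<lambda>N. \<Sum>j<N. z x ^ j / fact j * g x) \<longlonglongrightarrow> exp (z x) * g x"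
    proof (rule AE_I2)
      fix x
      have "(\<lambda>j. z x ^ j / fact j) sums exp (z x)"
        using exp_converges[of "z x"] by (simp add: scaleR_conv_of_real divide_inverse mult.commute)
      from sums_mult2[OF this, of "g x"]
      show "(\<lambda>N. \<Sum>j<N. z x ^ j / fact j * g x) \<longlonglongrightarrow> exp (z x) * g x"
        by (simp add: sums_def)
    qed
    show "AE x in M. norm (\<Sum>j<N. z x ^ j / fact j * g x) \<le> exp (norm (z x)) * norm (g x)" for N
    proof (rule AE_I2)
      fix x
      have "norm (\<Sum>j<N. z x ^ j / fact j * g x) \<le> (\<Sum>j<N. norm (z x ^ j / fact j)) * norm (g x)"
        by (simp only: sum_distrib_right[symmetric] norm_mult) (intro mult_right_mono norm_sum norm_ge_zero)
      also have "\<dots> \<le> exp (norm (z x)) * norm (g x)"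
        by (intro mult_right_mono partial) auto
      finally show "norm (\<Sum>j<N. z x ^ j / fact j * g x) \<le> exp (norm (z x)) * norm (g x)" .
    qed
  qed measurable
  then show "(\<lambda>j. LINT x|M. z x ^ j / fact j * g x) sums (LINT x|M. exp (z x) * g x)"
    by (simp only: sums_def Bochner_Integration.integral_sum[OF each])
qed

lemma power_series_unique:
  fixes a b :: "nat \<Rightarrow> real"
  assumes "\<And>s. (\<lambda>j. a j * s ^ j) sums f s" "\<And>s. (\<lambda>j. b j * s ^ j) sums f s"
  shows "a j = b j"
proof -
  define d where "d j = a j - b j" for j
  have d: "(\<lambda>j. d j * s ^ j) sums 0" for s
    using sums_diff[OF assms(1)[of s] assms(2)[of s]] by (simp add: d_def left_diff_distrib)
  have "d j = 0"
  proof (induction j rule: less_induct)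
    case (less n)
    have "(\<lambda>i. d (i + n) * s ^ i) sums 0" if "s \<noteq> 0" for s
    proof -
      have "(\<lambda>i. d (i + n) * s ^ (i + n)) sums 0"
        by (subst sums_zero_iff_shift) (auto simp: less d)
      from sums_mult2[OF this, of "inverse (s ^ n)"] show ?thesis
        using that by (simp add: power_add field_simps)
    qed
    then have "((\<lambda>_. 0) \<longlongrightarrow> d (0 + n)) (at (0::real))"
      by (intro powser_limit_0_strong[of 1 "\<lambda>i. d (i + n)" "\<lambda>_. 0"]) auto
    then show ?case
      using tendsto_unique[OF _ tendsto_const, of "at (0::real)" 0 "d n"] by simp
  qed
  then show ?thesis by (simp add: d_def)
qed

section \<open>Homogeneous polynomials and spherical harmonics\<close>

text \<open>Monomials are functions rather than exponent vectors: one coordinate factor is added per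
  degree, which gives finiteness and induction on the degree at once.\<close>

primrec monomials :: "nat \<Rightarrow> ('a::euclidean_space \<Rightarrow> real) set" where
  "monomials 0 = {\<lambda>_. 1}"
| "monomials (Suc k) = (\<Union>b\<in>Basis. (\<lambda>m x. (x \<bullet> b) * m x) ` monomials k)"

text \<open>The linear span of the monomials, built one term at a time. The zero function belongs to
  every degree.\<close>

inductive hom_poly :: "nat \<Rightarrow> ('a::euclidean_space \<Rightarrow> real) \<Rightarrow> bool" for k where
  zero: "hom_poly k (\<lambda>_. 0)"
| add: "hom_poly k p \<Longrightarrow> m \<in> monomials k \<Longrightarrow> hom_poly k (\<lambda>x. p x + c * m x)"

lemma finite_monomials: "finite (monomials k)"
  by (induction k) auto

lemma hom_poly_monomial: "m \<in> monomials k \<Longrightarrow> hom_poly k m"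
  using hom_poly.add[OF hom_poly.zero, of m k 1] by simp

lemma hom_poly_plus:
  assumes "hom_poly k p" "hom_poly k q"
  shows "hom_poly k (\<lambda>x. p x + q x)"
  using assms(2)
proof (induction rule: hom_poly.induct)
  case zero
  then show ?case using assms(1) by simp
next
  case (add q m c)
  then show ?case using hom_poly.add[of k "\<lambda>x. p x + q x" m c] by (simp add: add.assoc)
qed

lemma hom_poly_cmult:
  assumes "hom_poly k p"
  shows "hom_poly k (\<lambda>x. c * p x)"
  using assms
proof (induction rule: hom_poly.induct)
  case zero
  then show ?case using hom_poly.zero by simp
next
  case (add p m d)
  then show ?case using hom_poly.add[of k "\<lambda>x. c * p x" m "c * d"] by (simp add: algebra_simps)
qed

lemma hom_poly_diff:
  assumes "hom_poly k p" "hom_poly k q"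
  shows "hom_poly k (\<lambda>x. p x - q x)"
  using hom_poly_plus[OF assms(1) hom_poly_cmult[OF assms(2), of "-1"]] by simp

lemma hom_poly_sum:
  assumes "\<And>i. i \<in> I \<Longrightarrow> hom_poly k (p i)"
  shows "hom_poly k (\<lambda>x. \<Sum>i\<in>I. p i x)"
  using assms by (induction I rule: infinite_finite_induct) (auto intro: hom_poly.zero hom_poly_plus)

lemma hom_poly_const: "hom_poly 0 (\<lambda>_. c)"
  using hom_poly.add[OF hom_poly.zero, of "\<lambda>_. 1" 0 c] by simp

lemma hom_poly_mult_Basis:
  assumes "hom_poly k p" "b \<in> Basis"
  shows "hom_poly (Suc k) (\<lambda>x. (x \<bullet> b) * p x)"
  using assms(1)
proof (induction rule: hom_poly.induct)
  case zero
  then show ?case using hom_poly.zero by simp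
next
  case (add p m c)
  then have "(\<lambda>x. (x \<bullet> b) * m x) \<in> monomials (Suc k)"
    using assms(2) by auto
  from hom_poly.add[OF add.IH this, of c] show ?case
    by (simp add: algebra_simps)
qed

lemma hom_poly_mult_inner:
  assumes "hom_poly k p"
  shows "hom_poly (Suc k) (\<lambda>x. (a \<bullet> x) * p x)"
proof -
  have "hom_poly (Suc k) (\<lambda>x. \<Sum>b\<in>Basis. (a \<bullet> b) * ((x \<bullet> b) * p x))"
    by (intro hom_poly_sum hom_poly_cmult hom_poly_mult_Basis assms)
  then show ?thesis
    by (subst euclidean_inner) (simp add: sum_distrib_right mult.assoc)
qed

lemma hom_poly_inner_power: "hom_poly j (\<lambda>x. (a \<bullet> x) ^ j)"
  by (induction j) (auto intro: hom_poly_const hom_poly_mult_inner)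

lemma hom_poly_mult_norm2:
  assumes "hom_poly k p"
  shows "hom_poly (Suc (Suc k)) (\<lambda>x. (norm x)\<^sup>2 * p x)"
proof -
  have "hom_poly (Suc (Suc k)) (\<lambda>x. \<Sum>b\<in>Basis. (x \<bullet> b) * ((x \<bullet> b) * p x))"
    by (intro hom_poly_sum hom_poly_mult_Basis assms)
  moreover have "(norm x)\<^sup>2 * p x = (\<Sum>b\<in>Basis. (x \<bullet> b) * ((x \<bullet> b) * p x))" for x
    unfolding power2_norm_eq_inner
    by (subst euclidean_inner) (simp add: sum_distrib_right mult.assoc)
  ultimately show ?thesis by simp
qed

lemma hom_poly_mult:
  assumes "hom_poly k p" "hom_poly l q"
  shows "hom_poly (k + l) (\<lambda>x. p x * q x)"
proof -
  have mono: "hom_poly (k + l) (\<lambda>x. m x * q x)" if "m \<in> monomials k" for m k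
    using that
  proof (induction k arbitrary: m)
    case 0
    then show ?case using assms(2) by simp
  next
    case (Suc k)
    then obtain b m' where b: "b \<in> Basis" "m' \<in> monomials k" "m = (\<lambda>x. (x \<bullet> b) * m' x)"
      by auto
    have "hom_poly (Suc (k + l)) (\<lambda>x. (x \<bullet> b) * (m' x * q x))"
      by (intro hom_poly_mult_Basis Suc b)
    then show ?case by (simp add: b mult.assoc)
  qed
  from assms(1) show ?thesis
  proof (induction rule: hom_poly.induct)
    case zero
    then show ?case using hom_poly.zero by simp
  next
    case (add p m c)
    then have "hom_poly (k + l) (\<lambda>x. p x * q x + c * (m x * q x))"
      by (intro hom_poly_plus hom_poly_cmult mono[OF \<open>m \<in> monomials k\<close>])
    then show ?case by (simp add: algebra_simps)
  qed
qed

text \<open>The rule coming with \<open>hom_poly\<close> keeps the degree fixed. Here the degree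
  varies, so a property is reduced to constants, linear combinations and multiplication by a single
  coordinate.\<close>

lemma hom_poly_induct_mono [consumes 1, case_names zero one add mult]:
  assumes "hom_poly k p"
    and zero: "\<And>k. P k (\<lambda>_. 0)"
    and one: "P 0 (\<lambda>_. 1)"
    and add: "\<And>k p q c. P k p \<Longrightarrow> P k q \<Longrightarrow> P k (\<lambda>x. p x + c * q x)"
    and mult: "\<And>k p b. P k p \<Longrightarrow> b \<in> Basis \<Longrightarrow> P (Suc k) (\<lambda>x. (x \<bullet> b) * p x)"
  shows "P k p"
proof -
  have mono: "P k m" if "m \<in> monomials k" for m k
    using that by (induction k arbitrary: m) (auto intro: one mult)
  show ?thesis
    using assms(1) by (induction rule: hom_poly.induct) (auto intro: zero add mono)
qed

lemma continuous_on_hom_poly: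
  assumes "hom_poly k p"
  shows "continuous_on A p"
  using assms by (induction rule: hom_poly_induct_mono) (auto intro!: continuous_intros)

lemma hom_poly_scaleR:
  assumes "hom_poly k p"
  shows "p (t *\<^sub>R x) = t ^ k * p x"
  using assms by (induction arbitrary: x rule: hom_poly_induct_mono) (auto simp: algebra_simps)

lemma hom_poly_uminus:
  assumes "hom_poly k p"
  shows "p (- x) = (- 1) ^ k * p x"
  using hom_poly_scaleR[OF assms, of "-1" x] by simp

text \<open>A Taylor expansion along the line in direction x. It is what the translation of a
  Gaussian integral needs: the degrees of the coefficients make them integrable against the
  Gaussian, and the top coefficient is constant in z.\<close>

lemma hom_poly_shift:
  assumes "hom_poly k p"
  obtains A where "\<And>s z. p (s *\<^sub>R x + z) = (\<Sum>i\<le>k. s ^ i * A i z)"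
    and "\<And>i. i \<le> k \<Longrightarrow> hom_poly (k - i) (A i)" and "\<And>z. A k z = p x"
proof -
  have "\<exists>A. (\<forall>s z. p (s *\<^sub>R x + z) = (\<Sum>i\<le>k. s ^ i * A i z)) \<and>
      (\<forall>i\<le>k. hom_poly (k - i) (A i)) \<and> (\<forall>z. A k z = p x)"
    using assms
  proof (induction rule: hom_poly_induct_mono)
    case (zero k)
    show ?case by (rule exI[of _ "\<lambda>_ _. 0"]) (auto intro: hom_poly.zero)
  next
    case one
    show ?case by (rule exI[of _ "\<lambda>_ _. 1"]) (auto intro: hom_poly_const)
  next
    case (add k p q c)
    from add.IH(1) obtain A where
      A: "\<forall>s z. p (s *\<^sub>R x + z) = (\<Sum>i\<le>k. s ^ i * A i z)" "\<forall>i\<le>k. hom_poly (k - i) (A i)" "\<forall>z. A k z = p x"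
      by blast
    from add.IH(2) obtain B where
      B: "\<forall>s z. q (s *\<^sub>R x + z) = (\<Sum>i\<le>k. s ^ i * B i z)" "\<forall>i\<le>k. hom_poly (k - i) (B i)" "\<forall>z. B k z = q x"
      by blast
    have "p (s *\<^sub>R x + z) + c * q (s *\<^sub>R x + z) = (\<Sum>i\<le>k. s ^ i * (A i z + c * B i z))" for s z
      by (simp add: A(1) B(1) sum.distrib sum_distrib_left distrib_left mult.left_commute)
    then show ?case
      using A(2,3) B(2,3)
      by (intro exI[of _ "\<lambda>i z. A i z + c * B i z"]) (auto intro!: hom_poly_plus hom_poly_cmult)
  next
    case (mult k p b)
    from mult.IH obtain A where
      A: "\<forall>s z. p (s *\<^sub>R x + z) = (\<Sum>i\<le>k. s ^ i * A i z)" "\<forall>i\<le>k. hom_poly (k - i) (A i)" "\<forall>z. A k z = p x"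
      by blast
    \<comment> \<open>Coefficients of the product with s (x \<bullet> b) + (z \<bullet> b): the
      first summand shifts the index by one, the second keeps it. The guards are needed because
      nothing is known about \<open>A i\<close> for i > k.\<close>
    define B where "B i z = (if i = 0 then 0 else (x \<bullet> b) * A (i - 1) z) +
        (if i \<le> k then (z \<bullet> b) * A i z else 0)" for i z
    have "((s *\<^sub>R x + z) \<bullet> b) * p (s *\<^sub>R x + z) = (\<Sum>i\<le>Suc k. s ^ i * B i z)" for s z
    proof -
      have "(\<Sum>i\<le>Suc k. s ^ i * B i z) =
          (\<Sum>i\<le>Suc k. s ^ i * (if i = 0 then 0 else (x \<bullet> b) * A (i - 1) z)) +
          (\<Sum>i\<le>Suc k. s ^ i * (if i \<le> k then (z \<bullet> b) * A i z else 0))"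
        by (simp only: B_def distrib_left sum.distrib)
      also have "(\<Sum>i\<le>Suc k. s ^ i * (if i = 0 then 0 else (x \<bullet> b) * A (i - 1) z)) =
          (\<Sum>i\<le>k. s * (x \<bullet> b) * (s ^ i * A i z))"
        by (subst sum.atMost_Suc_shift) (simp add: algebra_simps)
      also have "(\<Sum>i\<le>Suc k. s ^ i * (if i \<le> k then (z \<bullet> b) * A i z else 0)) =
          (\<Sum>i\<le>k. (z \<bullet> b) * (s ^ i * A i z))"
        by (simp add: algebra_simps)
      finally have B: "(\<Sum>i\<le>Suc k. s ^ i * B i z) =
        (\<Sum>i\<le>k. s * (x \<bullet> b) * (s ^ i * A i z)) + (\<Sum>i\<le>k. (z \<bullet> b) * (s ^ i * A i z))" .
      show ?thesis
        unfolding B by (simp only: A(1)[rule_format] inner_add_left inner_scaleR_left distrib_right sum_distrib_left sum.distrib)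

    qed
    moreover have "hom_poly (Suc k - i) (B i)" if "i \<le> Suc k" for i
    proof -
      have "hom_poly (Suc k - i) (\<lambda>z. if i = 0 then 0 else (x \<bullet> b) * A (i - 1) z)"
      proof (cases "i = 0")
        case False
        then show ?thesis
          using that A(2)[rule_format, of "i - 1"] by (auto intro!: hom_poly_cmult simp: Suc_diff_le)
      qed (auto intro: hom_poly.zero)
      moreover have "hom_poly (Suc k - i) (\<lambda>z. if i \<le> k then (z \<bullet> b) * A i z else 0)"
        using that A(2)[rule_format, of i] hom_poly_mult_Basis[OF _ mult.hyps, of "k - i" "A i"]
        by (cases "i \<le> k") (auto intro: hom_poly.zero simp: Suc_diff_le)
      ultimately show ?thesis
        unfolding B_def by (rule hom_poly_plus)
    qed
    moreover have "B (Suc k) z = (x \<bullet> b) * p x" for z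
      by (simp add: B_def A(3))
    ultimately show ?case
      by (intro exI[of _ B]) blast
  qed
  then show ?thesis using that by blast
qed

lemma real_polynomial_function_hom_polys:
  fixes g :: "'a::euclidean_space \<Rightarrow> real"
  assumes "real_polynomial_function g"
  obtains N p where "\<And>i. hom_poly i (p i)" and "\<And>x. g x = (\<Sum>i\<le>N. p i x)"
proof -
  \<comment> \<open>The additional conjunct, that the components vanish beyond N, allows two
    decompositions to be extended to a common range in the sum and product cases.\<close>
  have "\<exists>N p. (\<forall>i. hom_poly i (p i)) \<and> (\<forall>i>N. p i = (\<lambda>_. 0)) \<and> (\<forall>x. g x = (\<Sum>i\<le>N. p i x))"
    using assms
  proof (induction rule: real_polynomial_function.induct)
    case (linear f)
    then interpret bounded_linear f .
    define a where "a = (\<Sum>b\<in>Basis. f b *\<^sub>R b)"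
    have f: "f x = a \<bullet> x" for x
    proof -
      have "f x = f (\<Sum>b\<in>Basis. (x \<bullet> b) *\<^sub>R b)" by (simp add: euclidean_representation)
      also have "\<dots> = a \<bullet> x"
        by (simp add: a_def sum scaleR inner_sum_left) (simp add: inner_commute mult.commute)
      finally show ?thesis .
    qed
    have "hom_poly 1 f"
      using hom_poly_inner_power[of 1 a] by (simp add: f[abs_def])
    then show ?case
      by (intro exI[of _ 1] exI[of _ "\<lambda>i. if i = 1 then f else (\<lambda>_. 0)"]) (auto intro: hom_poly.zero)
  next
    case (const c)
    show ?case
      by (intro exI[of _ 0] exI[of _ "\<lambda>i. if i = 0 then (\<lambda>_. c) else (\<lambda>_. 0)"])
         (auto intro: hom_poly.zero hom_poly_const)
  next
    case (add f g)
    then obtain M p N q where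
      p: "\<And>i. hom_poly i (p i)" "\<And>i. i > M \<Longrightarrow> p i = (\<lambda>_. 0)" "\<And>x. f x = (\<Sum>i\<le>M. p i x)" and
      q: "\<And>i. hom_poly i (q i)" "\<And>i. i > N \<Longrightarrow> q i = (\<lambda>_. 0)" "\<And>x. g x = (\<Sum>i\<le>N. q i x)"
      by metis
    have "f x = (\<Sum>i\<le>M + N. p i x)" "g x = (\<Sum>i\<le>M + N. q i x)" for x
      unfolding p q by (intro sum.mono_neutral_left; use p q in auto)+
    then show ?case
      by (intro exI[of _ "M + N"] exI[of _ "\<lambda>i x. p i x + q i x"])
         (auto simp: sum.distrib p q intro: hom_poly_plus)
  next
    case (mult f g)
    then obtain M p N q where
      p: "\<And>i. hom_poly i (p i)" "\<And>i. i > M \<Longrightarrow> p i = (\<lambda>_. 0)" "\<And>x. f x = (\<Sum>i\<le>M. p i x)" and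
      q: "\<And>i. hom_poly i (q i)" "\<And>i. i > N \<Longrightarrow> q i = (\<lambda>_. 0)" "\<And>x. g x = (\<Sum>i\<le>N. q i x)"
      by metis
    define r where "r i x = (\<Sum>(j, l)\<in>{(j, l). j \<le> M \<and> l \<le> N \<and> j + l = i}. p j x * q l x)" for i x
    have fin: "finite {(j, l). j \<le> M \<and> l \<le> N \<and> j + l = i}" for i
      by (rule finite_subset[of _ "{..M} \<times> {..N}"]) auto
    have "hom_poly i (r i)" for i
      unfolding r_def by (rule hom_poly_sum) (auto intro: hom_poly_mult p q)
    moreover have "r i = (\<lambda>_. 0)" if "i > M + N" for i
    proof -
      have e: "{(j, l). j \<le> M \<and> l \<le> N \<and> j + l = i} = {}" using that by auto
      show ?thesis unfolding r_def e by simp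
    qed
    moreover have "f x * g x = (\<Sum>i\<le>M + N. r i x)" for x
    proof -
      have "f x * g x = (\<Sum>z\<in>{..M} \<times> {..N}. p (fst z) x * q (snd z) x)"
        by (simp add: p(3) q(3) sum_product sum.cartesian_product case_prod_unfold)
      also have "\<dots> = (\<Sum>i\<le>M + N. \<Sum>z | z \<in> {..M} \<times> {..N} \<and> fst z + snd z = i. p (fst z) x * q (snd z) x)"
        by (rule sum.group[symmetric]) auto
      also have "\<dots> = (\<Sum>i\<le>M + N. r i x)"
        unfolding r_def by (intro sum.cong) (auto simp: case_prod_unfold)
      finally show ?thesis .
    qed
    ultimately show ?case by blast
  qed
  then show ?thesis using that by blast
qed

section \<open>The inner product on the sphere and orthogonal decomposition of polynomials\<close>

definition surface_inner :: "('a::euclidean_space \<Rightarrow> real) \<Rightarrow> ('a \<Rightarrow> real) \<Rightarrow> real" where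
  "surface_inner f g = (LINT \<omega>|surface_measure. f \<omega> * g \<omega>)"

lemma surface_inner_commute: "surface_inner f g = surface_inner g f"
  by (simp add: surface_inner_def mult.commute)

lemma surface_inner_add_cmult:
  assumes "continuous_on UNIV f" "continuous_on UNIV g" "continuous_on UNIV h"
  shows "surface_inner f (\<lambda>x. g x + t * h x) = surface_inner f g + t * surface_inner f h"
proof -
  have "surface_inner f (\<lambda>x. g x + t * h x) =
      (LINT \<omega>|surface_measure. f \<omega> * g \<omega> + t * (f \<omega> * h \<omega>))"
    by (simp add: surface_inner_def algebra_simps)
  also have "\<dots> = (LINT \<omega>|surface_measure. f \<omega> * g \<omega>) + (LINT \<omega>|surface_measure. t * (f \<omega> * h \<omega>))"
    by (intro Bochner_Integration.integral_add integrable_surface_measure continuous_intros assms)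
  finally show ?thesis by (simp add: surface_inner_def)
qed

lemma surface_inner_diff:
  assumes "continuous_on UNIV f" "continuous_on UNIV g" "continuous_on UNIV h"
  shows "surface_inner f (\<lambda>x. g x - h x) = surface_inner f g - surface_inner f h"
  using surface_inner_add_cmult[OF assms, of "-1"] by simp

lemma surface_inner_cong:
  assumes "\<And>x. norm x = 1 \<Longrightarrow> f x = f' x" "\<And>x. norm x = 1 \<Longrightarrow> g x = g' x"
    and "continuous_on UNIV f" "continuous_on UNIV f'" "continuous_on UNIV g" "continuous_on UNIV g'"
  shows "surface_inner f g = surface_inner f' g'"
  unfolding surface_inner_def
proof (rule integral_cong_AE)
  show "AE \<omega> in surface_measure. f \<omega> * g \<omega> = f' \<omega> * g' \<omega>"
    using AE_surface_measure_norm by eventually_elim (simp add: assms)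
qed (intro borel_measurable_integrable integrable_surface_measure continuous_intros assms)+

text \<open>A function of norm zero is orthogonal to everything. This lets Gram-Schmidt run without
  a proof that the monomials are linearly independent on the sphere.\<close>

lemma surface_inner_self_eq_0:
  assumes "surface_inner e e = 0" "continuous_on UNIV e"
  shows "surface_inner f e = 0"
proof -
  have "AE \<omega> in surface_measure. e \<omega> * e \<omega> = 0"
    using assms(1) unfolding surface_inner_def
    by (subst (asm) integral_nonneg_eq_0_iff_AE)
       (auto intro!: integrable_surface_measure continuous_intros assms(2))
  then have "AE \<omega> in surface_measure. f \<omega> * e \<omega> = 0"
    by eventually_elim auto
  then show ?thesis
    unfolding surface_inner_def by (rule integral_eq_zero_AE)
qed

text \<open>These are the harmonic homogeneous polynomials of degree k, characterised by
  orthogonality instead of by the Laplacian. The zero function is allowed in every degree, so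
  decompositions can be padded; that nonzero ones exist is a separate lemma.\<close>

definition spherical_harmonic :: "nat \<Rightarrow> ('a::euclidean_space \<Rightarrow> real) \<Rightarrow> bool" where
  "spherical_harmonic k Y \<longleftrightarrow> hom_poly k Y \<and> (\<forall>j<k. \<forall>q. hom_poly j q \<longrightarrow> surface_inner Y q = 0)"

lemma spherical_harmonic_hom_poly: "spherical_harmonic k Y \<Longrightarrow> hom_poly k Y"
  by (simp add: spherical_harmonic_def)

lemma spherical_harmonic_orthogonal:
  assumes "spherical_harmonic k Y" "spherical_harmonic l Z" "k \<noteq> l"
  shows "surface_inner Y Z = 0"
  using assms surface_inner_commute[of Y Z]
  unfolding spherical_harmonic_def by (metis linorder_neqE_nat)

lemma spherical_harmonic_zero: "spherical_harmonic k (\<lambda>_. 0)"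
  by (simp add: spherical_harmonic_def hom_poly.zero surface_inner_def)

lemma spherical_harmonic_add:
  fixes Y Z :: "'a::euclidean_space \<Rightarrow> real"
  assumes "spherical_harmonic k Y" "spherical_harmonic k Z"
  shows "spherical_harmonic k (\<lambda>x. Y x + Z x)"
  unfolding spherical_harmonic_def
proof (intro conjI allI impI)
  show "hom_poly k (\<lambda>x. Y x + Z x)"
    using assms by (auto intro: hom_poly_plus simp: spherical_harmonic_def)
  fix j and q :: "'a \<Rightarrow> real" assume "j < k" and q: "hom_poly j q"
  moreover have "surface_inner q (\<lambda>x. Y x + 1 * Z x) = surface_inner q Y + 1 * surface_inner q Z"
    using assms q by (intro surface_inner_add_cmult)
      (auto intro: continuous_on_hom_poly simp: spherical_harmonic_def)
  ultimately show "surface_inner (\<lambda>x. Y x + Z x) q = 0"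
    using assms surface_inner_commute[of q Y] surface_inner_commute[of q Z]
      surface_inner_commute[of q "\<lambda>x. Y x + Z x"]
    by (simp add: spherical_harmonic_def)
qed

lemma spherical_harmonic_sum:
  assumes "\<And>i. i \<in> I \<Longrightarrow> spherical_harmonic k (Y i)"
  shows "spherical_harmonic k (\<lambda>x. \<Sum>i\<in>I. Y i x)"
  using assms by (induction I rule: infinite_finite_induct)
    (auto intro: spherical_harmonic_zero spherical_harmonic_add)

text \<open>The reflection y \<mapsto> -y preserves the Gaussian and Lebesgue measure and changes
  the sign of the integrand. Thus orthogonality between degrees of different parity is automatic,
  and only degrees differing by an even number need work.\<close>

lemma surface_inner_odd:
  fixes p q :: "'a::euclidean_space \<Rightarrow> real"
  assumes p: "hom_poly k p" and q: "hom_poly l q" and "odd (k + l)"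
  shows "surface_inner p q = 0"
proof -
  define h where "h x = p x * q x" for x
  have h: "hom_poly (k + l) h"
    unfolding h_def by (rule hom_poly_mult[OF p q])
  have cont: "continuous_on UNIV h"
    by (rule continuous_on_hom_poly[OF h])
  have [measurable]: "h \<in> borel_measurable borel"
    using borel_measurable_continuous_onI[OF cont] .
  let ?g = "\<lambda>y. exp (- (norm y)\<^sup>2 / 2) * h y"
  have refl: "lborel = distr lborel borel (\<lambda>x::'a. - x)"
    using lborel_affine[of "-1" "0::'a"] by (simp add: density_1)
  have "(LINT y|lborel. ?g y) = (LINT y|distr lborel borel (\<lambda>x::'a. - x). ?g y)"
    by (simp only: refl[symmetric])
  also have "\<dots> = (LINT y|lborel. ?g (- y))"
    by (rule integral_distr) measurable
  also have "\<dots> = - (LINT y|lborel. ?g y)"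
    using \<open>odd (k + l)\<close> by (simp add: hom_poly_uminus[OF h])
  finally have "(LINT y|lborel. ?g y) = 0"
    by simp
  then show ?thesis
    using gauss_homogeneous(2)[of h "k + l"] cont hom_poly_scaleR[OF h]
      radial_moment_pos[of "DIM('a) - 1 + (k + l)"]
    by (simp add: surface_inner_def h_def)
qed

lemma hom_poly_projection:
  fixes p :: "'a::euclidean_space \<Rightarrow> real"
  assumes "continuous_on UNIV p"
  obtains w where "hom_poly k w"
    and "\<And>q. hom_poly k q \<Longrightarrow> surface_inner (\<lambda>x. p x - w x) q = 0"
proof -
  note c = continuous_on_hom_poly
  \<comment> \<open>Gram-Schmidt; the last conjunct says that \<open>w\<close> is, in effect, in the span of \<open>B\<close>.\<close>
  have "\<exists>w. hom_poly k w \<and> (\<forall>b\<in>B. surface_inner (\<lambda>x. p x - w x) b = 0) \<and>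
      (\<forall>f. continuous_on UNIV f \<longrightarrow> (\<forall>b\<in>B. surface_inner f b = 0) \<longrightarrow> surface_inner f w = 0)"
    if "finite B" "B \<subseteq> monomials k" "continuous_on UNIV p" for B and p :: "'a \<Rightarrow> real"
    using that
  proof (induction B arbitrary: p rule: finite_induct)
    case empty
    then show ?case by (intro exI[of _ "\<lambda>_. 0"]) (auto intro: hom_poly.zero simp: surface_inner_def)
  next
    case (insert b B)
    have b: "hom_poly k b"
      using insert.prems by (auto intro: hom_poly_monomial)
    have B: "hom_poly k a" if "a \<in> B" for a
      using that insert.prems by (auto intro: hom_poly_monomial)
    obtain v where v: "hom_poly k v" "\<forall>a\<in>B. surface_inner (\<lambda>x. p x - v x) a = 0"
        "\<forall>f. continuous_on UNIV f \<longrightarrow> (\<forall>b\<in>B. surface_inner f b = 0) \<longrightarrow> surface_inner f v = 0"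
      using insert.IH[of p] insert.prems by blast
    obtain u where u: "hom_poly k u" "\<forall>a\<in>B. surface_inner (\<lambda>x. b x - u x) a = 0"
        "\<forall>f. continuous_on UNIV f \<longrightarrow> (\<forall>b\<in>B. surface_inner f b = 0) \<longrightarrow> surface_inner f u = 0"
      using insert.IH[of b] insert.prems c[OF b] by blast
    define e where "e x = b x - u x" for x
    have e: "hom_poly k e"
      unfolding e_def by (rule hom_poly_diff[OF b u(1)])
    have fe: "surface_inner f e = surface_inner f b - surface_inner f u" if "continuous_on UNIV f" for f
      unfolding e_def by (rule surface_inner_diff[OF that c[OF b] c[OF u(1)]])
    define r where "r x = p x - v x" for x
    have r: "continuous_on UNIV r"
      unfolding r_def by (intro continuous_intros insert.prems c[OF v(1)])
    \<comment> \<open>The Gram-Schmidt coefficient of r along e. If e has norm zero, division by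
      zero makes t = 0, and r is orthogonal to e anyway.\<close>
    define t where "t = surface_inner e r / surface_inner e e"
    define w where "w x = v x + t * e x" for x
    have w: "hom_poly k w"
      unfolding w_def by (intro hom_poly_plus hom_poly_cmult v e)
    define d where "d x = p x - w x" for x
    have d_eq: "d = (\<lambda>x. r x + (- t) * e x)"
      by (auto simp: d_def w_def r_def)
    have d: "continuous_on UNIV d"
      unfolding d_def by (intro continuous_intros insert.prems c[OF w])
    have df: "surface_inner d f = surface_inner f r - t * surface_inner f e" if "continuous_on UNIV f" for f
      unfolding d_eq using surface_inner_add_cmult[OF that r c[OF e], of "-t"]
      by (simp add: surface_inner_commute[of _ f])
    have dB: "surface_inner d a = 0" if "a \<in> B" for a
      using that df[OF c[OF B[OF that]]] v(2) u(2)
      by (simp add: surface_inner_commute[of a] e_def[abs_def] r_def[abs_def])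
    have "surface_inner d e = 0"
      using df[OF c[OF e]] surface_inner_self_eq_0[OF _ c[OF e], of r]
      by (cases "surface_inner e e = 0") (auto simp: t_def surface_inner_commute[of e r])
    \<comment> \<open>Since u behaves like an element of the span of B, orthogonality to B suffices;
      with b = e + u this gives orthogonality to b.\<close>
    moreover have "surface_inner d u = 0"
      using u(3) d dB by blast
    ultimately have "surface_inner d b = 0"
      using fe[OF d] by simp
    moreover have "surface_inner f w = 0"
      if f: "continuous_on UNIV f" and "\<forall>a\<in>insert b B. surface_inner f a = 0" for f
    proof -
      have "surface_inner f w = surface_inner f v + t * (surface_inner f b - surface_inner f u)"
        unfolding w_def surface_inner_add_cmult[OF f c[OF v(1)] c[OF e]] fe[OF f] ..
      then show ?thesis
        using that v(3) u(3) by simp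
    qed
    ultimately show ?case
      using w dB by (intro exI[of _ w]) (auto simp: d_def[abs_def])
  qed
  from this[OF finite_monomials order.refl assms]
  obtain w where w: "hom_poly k w" "\<forall>b\<in>monomials k. surface_inner (\<lambda>x. p x - w x) b = 0"
    by blast
  have cont: "continuous_on UNIV (\<lambda>x. p x - w x)"
    by (intro continuous_intros assms c[OF w(1)])
  have "surface_inner (\<lambda>x. p x - w x) q = 0" if "hom_poly k q" for q
    using that
  proof (induction rule: hom_poly.induct)
    case zero
    then show ?case by (simp add: surface_inner_def)
  next
    case (add q m s)
    then show ?case
      using surface_inner_add_cmult[OF cont c[OF add.hyps(1)] c[OF hom_poly_monomial[OF add.hyps(2)]]] w(2)
      by simp
  qed
  with w(1) show thesis using that by blast
qed

lemma hom_poly_mult_norm_power: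
  assumes "hom_poly j q"
  shows "hom_poly (j + 2 * m) (\<lambda>x. (norm x) ^ (2 * m) * q x)"
proof (induction m)
  case (Suc m)
  then show ?case
    using hom_poly_mult_norm2[OF Suc] by (simp add: power2_eq_square mult.assoc)
qed (use assms in simp)

text \<open>Take w to be the projection of p onto degree k. On the sphere the residual equals p - w.
  A polynomial q of degree j \<le> k with the parity of k agrees there with |x|^(k-j) q, which has
  degree k and is therefore orthogonal to the residual; the other parity is orthogonal by
  reflection.\<close>

lemma spherical_harmonic_residual:
  fixes p :: "'a::euclidean_space \<Rightarrow> real"
  assumes p: "hom_poly (Suc (Suc k)) p"
  obtains w where "hom_poly k w" "spherical_harmonic (Suc (Suc k)) (\<lambda>x. p x - (norm x)\<^sup>2 * w x)"
proof -
  note c = continuous_on_hom_poly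
  obtain w where w: "hom_poly k w"
      "\<And>q. hom_poly k q \<Longrightarrow> surface_inner (\<lambda>x. p x - w x) q = 0"
    using hom_poly_projection[OF c[OF p]] by blast
  let ?Y = "\<lambda>x. p x - (norm x)\<^sup>2 * w x"
  have Y: "hom_poly (Suc (Suc k)) ?Y"
    by (intro hom_poly_diff p hom_poly_mult_norm2 w)
  have "surface_inner ?Y q = 0" if j: "j < Suc (Suc k)" and q: "hom_poly j q" for j q
  proof (cases "odd (Suc (Suc k) + j)")
    case True
    then show ?thesis by (rule surface_inner_odd[OF Y q])
  next
    case False
    then have "j \<le> k" "even (k - j)"
      using j by (auto simp: less_Suc_eq)
    then obtain m where m: "k = j + 2 * m"
      by (metis evenE le_add_diff_inverse)
    have q': "hom_poly k (\<lambda>x. (norm x) ^ (2 * m) * q x)"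
      using hom_poly_mult_norm_power[OF q, of m] m by simp
    have "surface_inner ?Y q = surface_inner (\<lambda>x. p x - w x) (\<lambda>x. (norm x) ^ (2 * m) * q x)"
      by (rule surface_inner_cong)
         (auto intro!: continuous_intros c[OF p] c[OF w(1)] c[OF q])
    then show ?thesis using w(2)[OF q'] by simp
  qed
  with Y have "spherical_harmonic (Suc (Suc k)) ?Y"
    by (auto simp: spherical_harmonic_def)
  with w(1) show thesis by (rule that)
qed

text \<open>Taking residuals repeatedly lowers the degree by two until it is 0 or 1, where parity
  alone gives the orthogonality. Quantifying over all N \<ge> k lets decompositions of different
  polynomials share one range of summation.\<close>

lemma hom_poly_spherical_harmonics:
  fixes p :: "'a::euclidean_space \<Rightarrow> real"
  assumes "hom_poly k p"
  shows "\<exists>Y. (\<forall>i. spherical_harmonic i (Y i)) \<and> (\<forall>N\<ge>k. \<forall>x. norm x = 1 \<longrightarrow> p x = (\<Sum>i\<le>N. Y i x))"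
  using assms
proof (induction k arbitrary: p rule: less_induct)
  case (less k)
  have single: "(\<Sum>i\<le>N. (if i = k then f i else 0)) = f k" if "N \<ge> k" for f :: "nat \<Rightarrow> real" and N
    using that by simp
  show ?case
  proof (cases "k < 2")
    case True
    have "surface_inner p q = 0" if "j < k" "hom_poly j q" for j q
      using that True by (intro surface_inner_odd[OF less.prems]) (auto simp: less_Suc_eq numeral_2_eq_2)
    then have "spherical_harmonic k p"
      using less.prems by (auto simp: spherical_harmonic_def)
    then have "spherical_harmonic i (\<lambda>x. if i = k then p x else 0)" for i
      by (cases "i = k") (auto intro: spherical_harmonic_zero)
    then show ?thesis
      by (intro exI[of _ "\<lambda>i x. if i = k then p x else 0"]) (auto simp: single)
  next
    case False
    then obtain l where k: "k = Suc (Suc l)"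
      by (metis add_2_eq_Suc le_Suc_ex not_less)
    obtain w where w: "hom_poly l w" "spherical_harmonic k (\<lambda>x. p x - (norm x)\<^sup>2 * w x)"
      using spherical_harmonic_residual less.prems unfolding k by blast
    obtain Z where Z: "\<forall>i. spherical_harmonic i (Z i)" "\<forall>N\<ge>l. \<forall>x. norm x = 1 \<longrightarrow> w x = (\<Sum>i\<le>N. Z i x)"
      using less.IH[OF _ w(1)] k by auto
    define Y where "Y i x = Z i x + (if i = k then p x - (norm x)\<^sup>2 * w x else 0)" for i x
    have "spherical_harmonic i (Y i)" for i
      unfolding Y_def using Z(1) w(2)
      by (intro spherical_harmonic_add; cases "i = k") (auto intro: spherical_harmonic_zero)
    moreover have "p x = (\<Sum>i\<le>N. Y i x)" if "N \<ge> k" "norm x = 1" for x N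
      using that Z(2)[rule_format, of N x] k by (simp add: Y_def sum.distrib single)
    ultimately show ?thesis by blast
  qed
qed

lemma real_polynomial_function_spherical_harmonics:
  fixes g :: "'a::euclidean_space \<Rightarrow> real"
  assumes "real_polynomial_function g"
  obtains N Y where "\<And>i. spherical_harmonic i (Y i)" "\<And>x M. norm x = 1 \<Longrightarrow> M \<ge> N \<Longrightarrow> g x = (\<Sum>i\<le>M. Y i x)"
proof -
  obtain N p where p: "\<And>i. hom_poly i (p i)" "\<And>x. g x = (\<Sum>k\<le>N. p k x)"
    by (rule real_polynomial_function_hom_polys[OF assms]) (rule that)
  have "\<forall>k. \<exists>Y. (\<forall>i. spherical_harmonic i (Y i)) \<and>
      (\<forall>M\<ge>k. \<forall>x. norm x = 1 \<longrightarrow> p k x = (\<Sum>i\<le>M. Y i x))"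
    using hom_poly_spherical_harmonics[OF p(1)] by blast
  from choice[OF this] obtain Z where Z: "\<And>k i. spherical_harmonic i (Z k i)"
      "\<And>k M x. M \<ge> k \<Longrightarrow> norm x = 1 \<Longrightarrow> p k x = (\<Sum>i\<le>M. Z k i x)"
    by blast
  show thesis
  proof (rule that[of "\<lambda>i x. \<Sum>k\<le>N. Z k i x" N])
    show "spherical_harmonic i (\<lambda>x. \<Sum>k\<le>N. Z k i x)" for i
      by (intro spherical_harmonic_sum Z(1))
    show "g x = (\<Sum>i\<le>M. \<Sum>k\<le>N. Z k i x)" if "norm x = 1" "M \<ge> N" for x M
    proof -
      have "g x = (\<Sum>k\<le>N. \<Sum>i\<le>M. Z k i x)"
        unfolding p(2) using that by (intro sum.cong Z(2)) auto
      then show ?thesis by (subst sum.swap)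
    qed
  qed
qed

text \<open>If the residual of \<open>(x \<bullet> e)\<^sup>k\<close> vanished on the sphere, then \<open>1 = (1 + t\<^sup>2) q (e + t e')\<close>
  for a polynomial \<open>q\<close> and an orthonormal pair \<open>e, e'\<close>.\<close>

lemma spherical_harmonic_nonzero:
  assumes "DIM('a::euclidean_space) \<ge> 2"
  obtains Y :: "'a::euclidean_space \<Rightarrow> real" and x where "spherical_harmonic k Y" "Y x \<noteq> 0"
proof -
  obtain e e' :: 'a where e: "e \<in> Basis" "e' \<in> Basis" "e \<noteq> e'"
    using assms by (metis One_nat_def card_le_Suc0_iff_eq finite_Basis not_less_eq_eq numeral_2_eq_2)
  have inner: "e \<bullet> (e + t *\<^sub>R e') = 1" "(norm (e + t *\<^sub>R e'))\<^sup>2 = 1 + t\<^sup>2" for t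
    unfolding power2_norm_eq_inner power2_eq_square[of t]
    using e by (auto simp: inner_add_right inner_Basis inner_add_left)
  let ?p = "\<lambda>x. (e \<bullet> x) ^ k"
  have p: "hom_poly k ?p" by (rule hom_poly_inner_power)
  show thesis
  proof (cases "k < 2")
    case True
    have "surface_inner ?p q = 0" if "j < k" "hom_poly j q" for j q
      using that True by (intro surface_inner_odd[OF p]) (auto simp: less_Suc_eq numeral_2_eq_2)
    then have "spherical_harmonic k ?p"
      using p by (auto simp: spherical_harmonic_def)
    then show thesis by (rule that[of _ e]) (use inner(1)[of 0] in simp)
  next
    case False
    then obtain l where k: "k = Suc (Suc l)"
      by (metis add_2_eq_Suc le_Suc_ex not_less)
    obtain w where w: "hom_poly l w" "spherical_harmonic k (\<lambda>x. ?p x - (norm x)\<^sup>2 * w x)"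
      using spherical_harmonic_residual[of l ?p] p unfolding k by blast
    obtain A where A: "\<And>s z. w (s *\<^sub>R e' + z) = (\<Sum>i\<le>l. s ^ i * A i z)"
      by (rule hom_poly_shift[OF w(1), of e']) (rule that)
    define q where "q = (\<Sum>i\<le>l. monom (A i e) i)"
    have q: "w (e + t *\<^sub>R e') = poly q t" for t
      using A[of t e] by (simp add: add.commute q_def poly_sum poly_monom mult.commute)
    have "\<exists>t. ?p (e + t *\<^sub>R e') - (norm (e + t *\<^sub>R e'))\<^sup>2 * w (e + t *\<^sub>R e') \<noteq> 0"
    proof (rule ccontr)
      assume "\<not> ?thesis"
      then have "?p (e + t *\<^sub>R e') - (norm (e + t *\<^sub>R e'))\<^sup>2 * w (e + t *\<^sub>R e') = 0" for t
        by blast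
      then have "(1 + t\<^sup>2) * poly q t = 1" for t
        by (simp only: inner q) (simp add: algebra_simps)
      then have "poly ([:1, 0, 1:] * q) t = poly 1 t" for t
        by (simp add: algebra_simps power2_eq_square)
      then have "poly ([:1, 0, 1:] * q) = poly 1"
        by (rule ext)
      then have eq: "[:1, 0, 1:] * q = 1"
        by (simp only: poly_eq_poly_eq_iff)
      then have "q \<noteq> 0" by auto
      then have "degree ([:1, 0, 1:] * q) = 2 + degree q"
        by (subst degree_mult_eq) auto
      then show False using eq by simp
    qed
    then show thesis using that[OF w(2)] by blast
  qed
qed

section \<open>Bessel functions and the Funk-Hecke formula\<close>

text \<open>Gamma(1/2) is kept instead of sqrt(pi) because it then cancels against the same factor
  in the integral formula for J.\<close>

lemma Gamma_nat_plus_half: "Gamma (real m + 1/2) * (4 ^ m * fact m) = fact (2 * m) * Gamma (1/2)"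
proof (induction m)
  case (Suc m)
  have "Gamma (real m + 1/2 + 1) = (real m + 1/2) * Gamma (real m + 1/2)"
    by (rule Gamma_plus1) (auto simp: nonpos_Ints_def field_simps)
  then have "Gamma (real (Suc m) + 1/2) = (real m + 1/2) * Gamma (real m + 1/2)"
    by (simp add: algebra_simps)
  then have "Gamma (real (Suc m) + 1/2) * (4 ^ Suc m * fact (Suc m)) =
      (real m + 1/2) * 4 * (real m + 1) * (Gamma (real m + 1/2) * (4 ^ m * fact m))"
    by (simp add: algebra_simps)
  also have "\<dots> = (real m + 1/2) * 4 * (real m + 1) * (fact (2 * m) * Gamma (1/2))"
    by (simp only: Suc.IH)
  also have "\<dots> = fact (2 * Suc m) * Gamma (1/2)"
    by (simp add: algebra_simps)
  finally show ?case .
qed simp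

lemma nn_integral_even:
  fixes f :: "real \<Rightarrow> ennreal"
  assumes [measurable]: "f \<in> borel_measurable borel" and even: "\<And>x. f (- x) = f x"
  shows "(\<integral>\<^sup>+x. f x \<partial>lborel) = 2 * (\<integral>\<^sup>+x. f x * indicator {0<..} x \<partial>lborel)"
proof -
  have "(\<integral>\<^sup>+x. f x \<partial>lborel) =
      (\<integral>\<^sup>+x. f x * indicator {0<..} x + f x * indicator {..<0} x \<partial>lborel)"
    by (rule nn_integral_cong_AE, rule AE_mp[OF AE_lborel_singleton[of 0] AE_I2])
       (auto simp: indicator_def)
  also have "\<dots> = (\<integral>\<^sup>+x. f x * indicator {0<..} x \<partial>lborel) + (\<integral>\<^sup>+x. f x * indicator {..<0} x \<partial>lborel)"
    by (rule nn_integral_add) measurable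
  also have "(\<integral>\<^sup>+x. f x * indicator {..<0} x \<partial>lborel) = (\<integral>\<^sup>+x. f x * indicator {0<..} x \<partial>lborel)"
    by (subst nn_integral_real_affine[of _ "-1" 0])
       (auto simp: even indicator_def intro!: nn_integral_cong)
  finally show ?thesis by (simp add: mult_2)
qed

text \<open>The substitution t = x^2 in Euler's Beta integral covers x > 0, and evenness supplies
  the other half.\<close>

lemma nn_integral_even_Beta:
  assumes "b > (-1::real)"
  shows "(\<integral>\<^sup>+x. ennreal (indicator {-1..1} x * (x ^ (2 * m) * (1 - x\<^sup>2) powr b)) \<partial>lborel) =
    ennreal (Beta (real m + 1/2) (b + 1))"
proof -
  have "((\<lambda>t. t powr (real m - 1/2) * (1 - t) powr b) has_integral Beta (real m + 1/2) (b + 1)) {0..1}"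
    using has_integral_Beta_real[of "real m + 1/2" "b + 1"] assms by simp
  from nn_integral_has_integral_lebesgue[OF _ this]
  have "ennreal (Beta (real m + 1/2) (b + 1)) =
      (\<integral>\<^sup>+t. ennreal (t powr (real m - 1/2) * (1 - t) powr b * indicator {0^2..1^2} t) \<partial>lborel)"
    by (simp add: mult_ac ennreal_mult' ennreal_indicator)
  also have "\<dots> = (\<integral>\<^sup>+x. ennreal (x\<^sup>2 powr (real m - 1/2) * (1 - x\<^sup>2) powr b * (2 * x) *
      indicator {0..1} x) \<partial>lborel)"
    by (subst nn_integral_substitution[where g = "\<lambda>x. x ^ 2" and g' = "\<lambda>x. 2 * x"])
       (auto intro!: derivative_eq_intros continuous_intros simp: set_borel_measurable_def)
  also have "\<dots> = (\<integral>\<^sup>+x. 2 * (ennreal (indicator {-1..1} x * (x ^ (2 * m) * (1 - x\<^sup>2) powr b)) *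
      indicator {0<..} x) \<partial>lborel)"
  proof (rule nn_integral_cong)
    fix x :: real
    have "x\<^sup>2 powr (real m - 1/2) * x = x ^ (2 * m)" if "x > 0"
    proof -
      have "x\<^sup>2 powr (real m - 1/2) * x = x powr (2 * (real m - 1/2)) * x powr 1"
        using that powr_realpow[of x 2] powr_powr[of x 2 "real m - 1/2"] by simp
      also have "\<dots> = x powr (real (2 * m))"
        by (subst powr_add[symmetric]) simp
      finally show ?thesis using that by (simp only: powr_realpow)
    qed
    then have eq: "x\<^sup>2 powr (real m - 1/2) * (1 - x\<^sup>2) powr b * (2 * x) = 2 * (x ^ (2 * m) * (1 - x\<^sup>2) powr b)"
      if "x > 0" using that by (simp add: algebra_simps)
    show "ennreal (x\<^sup>2 powr (real m - 1/2) * (1 - x\<^sup>2) powr b * (2 * x) * indicator {0..1} x) =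
        2 * (ennreal (indicator {-1..1} x * (x ^ (2 * m) * (1 - x\<^sup>2) powr b)) * indicator {0<..} x)"
    proof (cases "0 < x \<and> x \<le> 1")
      case True
      then have i: "indicator {0..1} x = (1::real)" "indicator {-1..1} x = (1::real)"
          "indicator {0<..} x = (1::ennreal)"
        by auto
      show ?thesis
        unfolding i eq[OF True[THEN conjunct1]] mult_1 mult_1_right by (subst ennreal_mult') auto
    qed (auto simp: indicator_def)
  qed
  also have "\<dots> = 2 * (\<integral>\<^sup>+x. ennreal (indicator {-1..1} x * (x ^ (2 * m) * (1 - x\<^sup>2) powr b)) *
      indicator {0<..} x \<partial>lborel)"
    by (rule nn_integral_cmult) measurable
  also have "\<dots> = (\<integral>\<^sup>+x. ennreal (indicator {-1..1} x * (x ^ (2 * m) * (1 - x\<^sup>2) powr b)) \<partial>lborel)"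
    by (rule nn_integral_even[symmetric]) (auto simp: indicator_def power_mult)
  finally show ?thesis ..
qed

lemma has_bochner_integral_even_Beta:
  assumes "b > (-1::real)"
  shows "has_bochner_integral lborel (\<lambda>x. indicator {-1..1} x * (x ^ (2 * m) * (1 - x\<^sup>2) powr b))
    (Beta (real m + 1/2) (b + 1))"
proof (rule has_bochner_integral_nn_integral)
  show "0 \<le> Beta (real m + 1/2) (b + 1)"
    using assms by (simp add: Beta_def Gamma_real_pos less_imp_le)
  show "AE x in lborel. 0 \<le> indicator {-1..1} x * (x ^ (2 * m) * (1 - x\<^sup>2) powr b)"
    by (simp add: power_mult)
qed (auto simp: nn_integral_even_Beta[OF assms])

text \<open>Expand exp(i t r) under the integral. Odd moments of the weight vanish by symmetry and
  even ones are Beta values, whose factor Gamma(l + 1/2) cancels against the prefactor. The series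
  is the form in which J is recognised in the Funk-Hecke formula.\<close>

lemma bessel_J_sums:
  assumes l: "l > -1/2" and t: "t > 0"
  shows "(\<lambda>m. (-1) ^ m / (fact m * Gamma (l + real m + 1)) * ((t / 2) powr l * (t / 2) ^ (2 * m)))
    sums bessel_J l t"
proof -
  define wt where "wt r = indicator {-1..1} r * (1 - r\<^sup>2) powr (l - 1/2)" for r :: real
  have [measurable]: "wt \<in> borel_measurable borel" unfolding wt_def by measurable
  define z where "z r = \<i> * complex_of_real (t * r)" for r
  define K where "K = t powr l / (2 powr l * Gamma (l + 1/2) * Gamma (1/2))"
  have wt_int: "integrable lborel wt"
    using has_bochner_integral_even_Beta[of "l - 1/2" 0] l
    by (simp add: has_bochner_integral_iff wt_def[abs_def])
  have mom: "(LINT r|lborel. r ^ (2 * m) * wt r) = Beta (real m + 1/2) (l + 1/2)" for m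
  proof -
    have "(LINT r|lborel. r ^ (2 * m) * wt r) =
        (LINT r|lborel. indicator {-1..1} r * (r ^ (2 * m) * (1 - r\<^sup>2) powr (l - 1/2)))"
      by (rule Bochner_Integration.integral_cong) (auto simp: wt_def)
    also have "\<dots> = Beta (real m + 1/2) (l + 1/2)"
      using has_bochner_integral_even_Beta[of "l - 1/2" m] l
      by (simp add: has_bochner_integral_iff add.commute)
    finally show ?thesis .
  qed
  have wt_even: "wt (- r) = wt r" for r
    by (auto simp: wt_def indicator_def)
  have odd: "(LINT r|lborel. r ^ j * wt r) = 0" if "odd j" for j
  proof -
    have "(LINT r|lborel. r ^ j * wt r) = (LINT r|lborel. (- r) ^ j * wt (- r))"
      using lborel_integral_real_affine[of "-1" "\<lambda>r. r ^ j * wt r" 0] by simp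
    also have "\<dots> = - (LINT r|lborel. r ^ j * wt r)"
      using that by (simp add: wt_even)
    finally show ?thesis by simp
  qed
  have int: "integrable lborel (\<lambda>r. exp (norm (z r)) * norm (complex_of_real (wt r)))"
  proof (rule Bochner_Integration.integrable_bound)
    show "integrable lborel (\<lambda>r. exp t * wt r)"
      using wt_int by simp
    show "AE r in lborel. norm (exp (norm (z r)) * norm (complex_of_real (wt r))) \<le> norm (exp t * wt r)"
      using t by (intro AE_I2)
        (auto simp: z_def wt_def indicator_def norm_mult abs_mult mult_left_le intro!: mult_right_mono)
  qed (auto simp: z_def)
  have sums: "(\<lambda>j. LINT r|lborel. z r ^ j / fact j * complex_of_real (wt r)) sums
      (LINT r|lborel. exp (z r) * complex_of_real (wt r))"
    by (rule integral_exp_sums(2)[OF _ _ int]) (auto simp: z_def)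
  have coef: "(LINT r|lborel. z r ^ j / fact j * complex_of_real (wt r)) =
      (\<i> * complex_of_real t) ^ j / fact j * complex_of_real (LINT r|lborel. r ^ j * wt r)" for j
  proof -
    have "(LINT r|lborel. z r ^ j / fact j * complex_of_real (wt r)) =
      (LINT r|lborel. (\<i> * complex_of_real t) ^ j / fact j * complex_of_real (r ^ j * wt r))"
      by (rule Bochner_Integration.integral_cong) (auto simp: z_def power_mult_distrib)
    then show ?thesis by (simp only: integral_mult_right_zero integral_complex_of_real)
  qed
  have vanish: "(LINT r|lborel. z r ^ j / fact j * complex_of_real (wt r)) = 0" if "\<forall>m. j \<noteq> 2 * m" for j
    using that by (subst coef, subst odd) (auto elim: evenE)
  have "(\<lambda>m. LINT r|lborel. z r ^ (2 * m) / fact (2 * m) * complex_of_real (wt r)) sums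
      (LINT r|lborel. exp (z r) * complex_of_real (wt r))"
    by (subst sums_mono_reindex[where g="\<lambda>m. 2 * m"])
       (use sums in \<open>auto simp: strict_mono_def image_def simp del: times_divide_eq_left intro!: vanish\<close>)
  then have "(\<lambda>m. complex_of_real K * (LINT r|lborel. z r ^ (2 * m) / fact (2 * m) * complex_of_real (wt r))) sums
      (complex_of_real K * (LINT r|lborel. exp (z r) * complex_of_real (wt r)))"
    by (rule sums_mult)
  also have "(LINT r|lborel. exp (z r) * complex_of_real (wt r)) =
     (LINT r:{-1..1}|lborel. exp (\<i> * complex_of_real (t * r)) * complex_of_real ((1 - r\<^sup>2) powr (l - 1/2)))"
    unfolding set_lebesgue_integral_def
    by (rule Bochner_Integration.integral_cong) (auto simp: z_def wt_def indicator_def)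
  also have "complex_of_real K * \<dots> = complex_of_real (bessel_J l t)"
    by (simp only: complex_of_real_bessel_J K_def)
  also have "(\<lambda>m. complex_of_real K * (LINT r|lborel. z r ^ (2 * m) / fact (2 * m) * complex_of_real (wt r))) =
     (\<lambda>m. complex_of_real ((-1) ^ m / (fact m * Gamma (l + real m + 1)) * ((t / 2) powr l * (t / 2) ^ (2 * m))))"
  proof
    fix m
    have pos: "Gamma (l + real m + 1) > 0" "Gamma (l + 1/2) > 0" "Gamma (1/2::real) > 0" "Gamma (real m + 1/2) > 0"
      using l by (auto intro!: Gamma_real_pos)
    have G: "Gamma (real m + 1/2) / (fact (2 * m) * Gamma (1/2)) = 1 / (4 ^ m * fact m)"
      using Gamma_nat_plus_half[of m] less_imp_neq[OF pos(3), THEN not_sym] by (simp add: field_simps)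
    have "complex_of_real K * (LINT r|lborel. z r ^ (2 * m) / fact (2 * m) * complex_of_real (wt r)) =
      complex_of_real (K * ((-1) ^ m * t ^ (2 * m) / fact (2 * m) * Beta (real m + 1/2) (l + 1/2)))"
    proof -
      have i: "(\<i> * complex_of_real t) ^ (2 * m) = complex_of_real ((-1) ^ m * t ^ (2 * m))"
        by (simp only: power_mult_distrib) (simp add: power_mult)
      show ?thesis unfolding coef mom i by simp
    qed
    also have "K * ((-1) ^ m * t ^ (2 * m) / fact (2 * m) * Beta (real m + 1/2) (l + 1/2)) =
      (-1) ^ m * t ^ (2 * m) * (t powr l / 2 powr l) / Gamma (l + real m + 1) *
       (Gamma (real m + 1/2) / (fact (2 * m) * Gamma (1/2)))"
    proof -
      have e: "real m + 1/2 + (l + 1/2) = l + real m + 1" by simp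
      have "T / (P * g * h) * (s * u / f * (G * g / D)) = s * u * (T / P) / D * (G / (f * h))"
        if "g \<noteq> 0" for T P g h s u f G D :: real
        using that by (simp add: mult_ac)
      then show ?thesis
        unfolding K_def Beta_def e using less_imp_neq[OF pos(2), THEN not_sym] .
    qed
    also have "\<dots> = (-1) ^ m / (fact m * Gamma (l + real m + 1)) * ((t / 2) powr l * (t / 2) ^ (2 * m))"
    proof -
      have four: "(4::real) ^ m = (2 ^ m)\<^sup>2"
        using power_mult[of "2::real" 2 m] power_mult[of "2::real" m 2] by (simp add: mult.commute)
      show ?thesis
        unfolding G four using t by (simp add: powr_divide power_divide power_mult mult_ac)
    qed
    finally show "complex_of_real K * (LINT r|lborel. z r ^ (2 * m) / fact (2 * m) * complex_of_real (wt r)) =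
      complex_of_real ((-1) ^ m / (fact m * Gamma (l + real m + 1)) * ((t / 2) powr l * (t / 2) ^ (2 * m)))" .
  qed
  finally show ?thesis
    by (simp only: sums_of_real_iff)
qed

section \<open>Gaussian integrals of spherical harmonics and their moments on the sphere\<close>

lemma integrable_gauss_exp:
  fixes Y :: "'a::euclidean_space \<Rightarrow> real"
  assumes Y: "hom_poly k Y"
  shows "integrable lborel (\<lambda>y. exp (a * norm y) * (exp (- (norm y)\<^sup>2 / 2) * \<bar>Y y\<bar>))"
proof -
  note c = continuous_on_hom_poly[OF Y]
  have [measurable]: "Y \<in> borel_measurable borel"
    using borel_measurable_continuous_onI[OF c] .
  have int: "integrable lborel (\<lambda>y. exp (- (norm y)\<^sup>2 / 2) * \<bar>Y y\<bar>)"
    by (rule gauss_homogeneous(1)[where d=k])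
       (auto intro!: continuous_intros c simp: hom_poly_scaleR[OF Y] abs_mult)
  \<comment> \<open>The wider Gaussian is the given one rescaled by sqrt 2; half of the quadratic
    exponent is thereby left over to absorb the linear term a |y|.\<close>
  have scaled: "integrable lborel (\<lambda>y. exp (- (norm y)\<^sup>2 / 4) * \<bar>Y y\<bar>)"
  proof (rule integrableI_nonneg)
    have "(\<integral>\<^sup>+y. ennreal (exp (- (norm y)\<^sup>2 / 4) * \<bar>Y y\<bar>) \<partial>lborel) =
        ennreal (\<bar>sqrt 2\<bar> ^ DIM('a)) *
          (\<integral>\<^sup>+y. ennreal (exp (- (norm (sqrt 2 *\<^sub>R y))\<^sup>2 / 4) * \<bar>Y (sqrt 2 *\<^sub>R y)\<bar>) \<partial>lborel)"
      by (rule nn_integral_lborel_scale) auto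
    also have "(\<integral>\<^sup>+y. ennreal (exp (- (norm (sqrt 2 *\<^sub>R y))\<^sup>2 / 4) * \<bar>Y (sqrt 2 *\<^sub>R y)\<bar>) \<partial>lborel) =
        (\<integral>\<^sup>+y. ennreal (sqrt 2 ^ k * (exp (- (norm y)\<^sup>2 / 2) * \<bar>Y y\<bar>)) \<partial>lborel)"
      by (rule nn_integral_cong) (auto simp: hom_poly_scaleR[OF Y] abs_mult power_mult_distrib mult_ac)
    also have "ennreal (\<bar>sqrt 2\<bar> ^ DIM('a)) * \<dots> < \<infinity>"
      using int by (subst nn_integral_eq_integral) (auto simp: ennreal_mult_less_top)
    finally show "(\<integral>\<^sup>+y. ennreal (exp (- (norm y)\<^sup>2 / 4) * \<bar>Y y\<bar>) \<partial>lborel) < \<infinity>" .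
  qed auto
  show ?thesis
  proof (rule Bochner_Integration.integrable_bound)
    show "integrable lborel (\<lambda>y. exp (a\<^sup>2) * (exp (- (norm y)\<^sup>2 / 4) * \<bar>Y y\<bar>))"
      using scaled by simp
    have "exp (a * norm y) * exp (- (norm y)\<^sup>2 / 2) \<le> exp (a\<^sup>2) * exp (- (norm y)\<^sup>2 / 4)" for y :: 'a
    proof -
      have "0 \<le> (a - norm y / 2)\<^sup>2" by simp
      then have "a * norm y - (norm y)\<^sup>2 / 2 \<le> a\<^sup>2 - (norm y)\<^sup>2 / 4"
        by (simp add: power2_eq_square algebra_simps)
      then show ?thesis by (simp add: exp_add[symmetric])
    qed
    then have "exp (a * norm y) * exp (- (norm y)\<^sup>2 / 2) * \<bar>Y y\<bar> \<le>
        exp (a\<^sup>2) * exp (- (norm y)\<^sup>2 / 4) * \<bar>Y y\<bar>" for y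
      by (rule mult_right_mono) simp
    then show "AE y in lborel. norm (exp (a * norm y) * (exp (- (norm y)\<^sup>2 / 2) * \<bar>Y y\<bar>)) \<le>
        norm (exp (a\<^sup>2) * (exp (- (norm y)\<^sup>2 / 4) * \<bar>Y y\<bar>))"
      by (simp add: abs_mult mult.assoc)
  qed measurable
qed

text \<open>Taylor coefficients in s of exp(c s^2).\<close>

definition exp_square_coeff :: "real \<Rightarrow> nat \<Rightarrow> real" where
  "exp_square_coeff c l = (if even l then c ^ (l div 2) / fact (l div 2) else 0)"

lemma exp_square_coeff_sums: "(\<lambda>l. exp_square_coeff c l * s ^ l) sums exp (c * s\<^sup>2)"
proof -
  have "(\<lambda>m. (c * s\<^sup>2) ^ m / fact m) sums exp (c * s\<^sup>2)"
    using exp_converges[of "c * s\<^sup>2"] by (simp add: divide_inverse mult.commute)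
  also have "(\<lambda>m. (c * s\<^sup>2) ^ m / fact m) = (\<lambda>m. exp_square_coeff c (2 * m) * s ^ (2 * m))"
    by (simp add: exp_square_coeff_def power_mult_distrib power_mult)
  finally show ?thesis
    by (subst (asm) sums_mono_reindex)
       (auto simp: strict_mono_def exp_square_coeff_def elim: evenE)
qed

text \<open>
  The Gaussian integral of \<open>exp (s x \<bullet> y) Y y\<close> is expanded in powers of \<open>s\<close> in two ways: directly,
  which gives the moments on the sphere, and after the translation \<open>y = s x + z\<close>, which gives
  \<open>exp (s\<^sup>2 |x|\<^sup>2 / 2)\<close> times a polynomial in \<open>s\<close> of degree at most \<open>k\<close> with leading coefficient a
  multiple of \<open>Y x\<close>.  Since the moments of order below \<open>k\<close> vanish, only the leading term of that
  polynomial survives.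
\<close>

lemma spherical_harmonic_moments:
  fixes Y :: "'a::euclidean_space \<Rightarrow> real"
  assumes Y: "spherical_harmonic k Y"
  shows "radial_moment (DIM('a) - 1 + (j + k)) * surface_inner (\<lambda>\<theta>. (x \<bullet> \<theta>) ^ j) Y / fact j =
    (if k \<le> j then (2 * pi) powr (DIM('a) / 2) * Y x * exp_square_coeff ((norm x)\<^sup>2 / 2) (j - k) else 0)"
proof -
  have hY: "hom_poly k Y" by (rule spherical_harmonic_hom_poly[OF Y])
  note cY = continuous_on_hom_poly[OF hY]
  have [measurable]: "Y \<in> borel_measurable borel"
    using borel_measurable_continuous_onI[OF cY] .
  define c where "c = (norm x)\<^sup>2 / 2"
  define G where "G y = exp (- (norm y)\<^sup>2 / 2)" for y :: 'a
  have [measurable]: "G \<in> borel_measurable borel" unfolding G_def by measurable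
  define Q where "Q j = radial_moment (DIM('a) - 1 + (j + k)) * surface_inner (\<lambda>\<theta>. (x \<bullet> \<theta>) ^ j) Y / fact j" for j
  define W where "W s = (LINT y|lborel. exp (s * (x \<bullet> y)) * (G y * Y y))" for s
  have int_exp: "integrable lborel (\<lambda>y. exp \<bar>s * (x \<bullet> y)\<bar> * \<bar>G y * Y y\<bar>)" for s
  proof (rule Bochner_Integration.integrable_bound[OF integrable_gauss_exp[OF hY, of "\<bar>s\<bar> * norm x"]])
    have "\<bar>s * (x \<bullet> y)\<bar> \<le> \<bar>s\<bar> * norm x * norm y" for y
      by (simp add: abs_mult mult_left_mono Cauchy_Schwarz_ineq2 mult.assoc)
    then show "AE y in lborel. norm (exp \<bar>s * (x \<bullet> y)\<bar> * \<bar>G y * Y y\<bar>) \<le>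
        norm (exp (\<bar>s\<bar> * norm x * norm y) * (exp (- (norm y)\<^sup>2 / 2) * \<bar>Y y\<bar>))"
      by (auto simp: G_def abs_mult intro!: mult_right_mono AE_I2)
  qed measurable
  have direct: "(\<lambda>j. Q j * s ^ j) sums W s" for s
  proof -
    have "(\<lambda>j. LINT y|lborel. (s * (x \<bullet> y)) ^ j / fact j * (G y * Y y)) sums W s"
      unfolding W_def by (rule integral_exp_sums(2)) (use int_exp in \<open>auto simp: abs_mult\<close>)
    also have "(\<lambda>j. LINT y|lborel. (s * (x \<bullet> y)) ^ j / fact j * (G y * Y y)) = (\<lambda>j. Q j * s ^ j)"
    proof
      fix j
      define h where "h y = (x \<bullet> y) ^ j * Y y" for y
      have h: "hom_poly (j + k) h"
        unfolding h_def by (intro hom_poly_mult hom_poly_inner_power hY)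
      have "(LINT y|lborel. (s * (x \<bullet> y)) ^ j / fact j * (G y * Y y)) =
          (LINT y|lborel. s ^ j / fact j * (exp (- (norm y)\<^sup>2 / 2) * h y))"
        by (rule Bochner_Integration.integral_cong) (auto simp: G_def h_def power_mult_distrib)
      also have "\<dots> = s ^ j / fact j * (radial_moment (DIM('a) - 1 + (j + k)) * (LINT \<omega>|surface_measure. h \<omega>))"
        by (simp only: integral_mult_right_zero
            gauss_homogeneous(2)[OF continuous_on_hom_poly[OF h] hom_poly_scaleR[OF h]])
      also have "\<dots> = Q j * s ^ j"
        by (simp add: Q_def surface_inner_def h_def)
      finally show "(LINT y|lborel. (s * (x \<bullet> y)) ^ j / fact j * (G y * Y y)) = Q j * s ^ j" .
    qed
    finally show ?thesis .
  qed
  obtain A where A: "\<And>s z. Y (s *\<^sub>R x + z) = (\<Sum>i\<le>k. s ^ i * A i z)"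
      "\<And>i. i \<le> k \<Longrightarrow> hom_poly (k - i) (A i)" "\<And>z. A k z = Y x"
    by (rule hom_poly_shift[OF hY, of x]) (rule that)
  define a where "a i = (LINT z|lborel. G z * A i z)" for i
  have int_A: "integrable lborel (\<lambda>z. G z * A i z)" if "i \<le> k" for i
    unfolding G_def using A(2)[OF that]
    by (intro gauss_homogeneous(1)[where d="k - i"] continuous_on_hom_poly hom_poly_scaleR)
  have a_k: "a k = (2 * pi) powr (DIM('a) / 2) * Y x"
    using gauss_total(2)[where 'a='a] by (simp add: a_def A(3) G_def)
  have W_shift: "W s = (\<Sum>i\<le>k. a i * (s ^ i * exp (c * s\<^sup>2)))" for s
  proof -
    have "W s = (LINT y|(distr lborel borel (\<lambda>z. s *\<^sub>R x + z)). exp (s * (x \<bullet> y)) * (G y * Y y))"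
      unfolding W_def using lborel_distr_plus[of "s *\<^sub>R x"] by simp
    also have "\<dots> = (LINT z|lborel. exp (s * (x \<bullet> (s *\<^sub>R x + z))) * (G (s *\<^sub>R x + z) * Y (s *\<^sub>R x + z)))"
      by (rule integral_distr) measurable
    also have "\<dots> = (LINT z|lborel. (\<Sum>i\<le>k. s ^ i * exp (c * s\<^sup>2) * (G z * A i z)))"
    proof (rule Bochner_Integration.integral_cong)
      fix z :: 'a
      \<comment> \<open>Completing the square: with y = s x + z the terms linear in z cancel,
        leaving s^2 |x|^2 / 2 - |z|^2 / 2.\<close>
      have "s * (x \<bullet> (s *\<^sub>R x + z)) + - (norm (s *\<^sub>R x + z))\<^sup>2 / 2 = c * s\<^sup>2 + - (norm z)\<^sup>2 / 2"
        unfolding power2_norm_eq_inner c_def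
        by (simp add: inner_add_left inner_add_right inner_commute[of z x] field_simps power2_eq_square)
      then have "exp (s * (x \<bullet> (s *\<^sub>R x + z))) * G (s *\<^sub>R x + z) = exp (c * s\<^sup>2) * G z"
        unfolding G_def exp_add[symmetric] by simp
      then show "exp (s * (x \<bullet> (s *\<^sub>R x + z))) * (G (s *\<^sub>R x + z) * Y (s *\<^sub>R x + z)) =
          (\<Sum>i\<le>k. s ^ i * exp (c * s\<^sup>2) * (G z * A i z))"
        unfolding A(1) mult.assoc[symmetric] by (simp add: sum_distrib_left mult_ac)
    qed simp
    also have "\<dots> = (\<Sum>i\<le>k. s ^ i * exp (c * s\<^sup>2) * a i)"
      by (subst Bochner_Integration.integral_sum) (auto intro: int_A simp: a_def)
    finally show ?thesis by (simp add: mult_ac)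
  qed
  \<comment> \<open>Coefficients of the Cauchy product of the polynomial with coefficients
    \<open>a i\<close> and the series of exp(c s^2).\<close>
  define R where "R j = (\<Sum>i\<le>k. a i * (if i \<le> j then exp_square_coeff c (j - i) else 0))" for j
  have shifted: "(\<lambda>j. R j * s ^ j) sums W s" for s
  proof -
    have "(\<lambda>j. (if i \<le> j then exp_square_coeff c (j - i) else 0) * s ^ j) sums (s ^ i * exp (c * s\<^sup>2))" for i
    proof (subst sums_zero_iff_shift[of i, symmetric])
      show "(\<lambda>j. (if i \<le> j + i then exp_square_coeff c (j + i - i) else 0) * s ^ (j + i)) sums (s ^ i * exp (c * s\<^sup>2))"
        using sums_mult[OF exp_square_coeff_sums[of c s], of "s ^ i"] by (simp add: power_add mult_ac)
    qed auto
    then have "(\<lambda>j. \<Sum>i\<le>k. a i * ((if i \<le> j then exp_square_coeff c (j - i) else 0) * s ^ j)) sums W s"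
      unfolding W_shift by (intro sums_sum sums_mult)
    then show ?thesis
      by (simp add: R_def sum_distrib_right mult.assoc)
  qed
  have QR: "Q j = R j" for j
    by (rule power_series_unique[OF direct shifted])
  have low: "Q j = 0" if "j < k" for j
    using Y that hom_poly_inner_power[of j x]
    by (simp add: Q_def spherical_harmonic_def surface_inner_commute[of _ Y])
  \<comment> \<open>A triangular system: the series of exp(c s^2) has constant term 1, so once the
    earlier \<open>a l\<close> vanish, \<open>R i\<close> is just \<open>a i\<close>, and
    \<open>R i\<close> = \<open>Q i\<close> is zero below k.\<close>
  have a_low: "a i = 0" if "i < k" for i
    using that
  proof (induction i rule: less_induct)
    case (less i)
    have "R i = (\<Sum>l\<le>k. if l = i then a i else 0)"
      unfolding R_def using less by (intro sum.cong) (auto simp: exp_square_coeff_def)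
    then show ?case
      using less.prems low[of i] QR[of i] by simp
  qed
  have "R j = (\<Sum>i\<le>k. if i = k then a k * (if k \<le> j then exp_square_coeff c (j - k) else 0) else 0)"
    unfolding R_def using a_low by (intro sum.cong) auto
  then have "R j = a k * (if k \<le> j then exp_square_coeff c (j - k) else 0)"
    by simp
  then show ?thesis
    using QR[of j] by (simp add: Q_def a_k c_def)
qed

text \<open>Expand the exponential in powers of \<omega> \<bullet> \<theta>. By the moment formula
  only the orders k + 2 m survive, each with a multiple of Y \<omega>, so the sum is a scalar times
  Y \<omega>; the powers of i give i^k (-1)^m, and the remaining factors form the Bessel series of
  order n/2 + k - 1.\<close>

theorem funk_hecke:
  fixes Y :: "'a::euclidean_space \<Rightarrow> real"
  assumes Y: "spherical_harmonic k Y" and \<omega>: "norm \<omega> = 1" and s: "s > 0" and n: "DIM('a) \<ge> 2"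
  shows "(LINT \<theta>|surface_measure. exp (\<i> * complex_of_real (s * (\<omega> \<bullet> \<theta>))) * complex_of_real (Y \<theta>)) =
    \<i> ^ k * complex_of_real ((2 * pi) powr (DIM('a) / 2) * s powr (1 - DIM('a) / 2) *
      bessel_J (DIM('a) / 2 + real k - 1) s * Y \<omega>)"
proof -
  define \<nu> where "\<nu> = DIM('a) / 2 + real k - 1"
  define C where "C = (2 * pi) powr (DIM('a) / 2)"
  define p where "p j = surface_inner (\<lambda>\<theta>. (\<omega> \<bullet> \<theta>) ^ j) Y" for j
  have hY: "hom_poly k Y" by (rule spherical_harmonic_hom_poly[OF Y])
  note cY = continuous_on_hom_poly[OF hY]
  have [measurable]: "Y \<in> borel_measurable borel"
    using borel_measurable_continuous_onI[OF cY] .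
  have moments: "p j / fact j =
      (if k \<le> j then C * Y \<omega> * exp_square_coeff (1/2) (j - k) / radial_moment (DIM('a) - 1 + (j + k)) else 0)" for j
    using spherical_harmonic_moments[OF Y, of j \<omega>] radial_moment_pos[of "DIM('a) - 1 + (j + k)"] \<omega>
    by (auto simp: p_def C_def field_simps split: if_splits)
  define z where "z \<theta> = \<i> * complex_of_real (s * (\<omega> \<bullet> \<theta>))" for \<theta>
  define T where "T j = (LINT \<theta>|surface_measure. z \<theta> ^ j / fact j * complex_of_real (Y \<theta>))" for j
  have T: "T j = \<i> ^ j * complex_of_real (s ^ j * (p j / fact j))" for j
  proof -
    have "T j = (LINT \<theta>|surface_measure. \<i> ^ j * complex_of_real (s ^ j / fact j) * complex_of_real ((\<omega> \<bullet> \<theta>) ^ j * Y \<theta>))"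
      unfolding T_def by (rule Bochner_Integration.integral_cong) (auto simp: z_def power_mult_distrib)
    also have "\<dots> = \<i> ^ j * complex_of_real (s ^ j / fact j) * complex_of_real (p j)"
      by (simp only: integral_mult_right_zero integral_complex_of_real p_def surface_inner_def)
    finally show ?thesis by simp
  qed
  have sums: "T sums (LINT \<theta>|surface_measure. exp (z \<theta>) * complex_of_real (Y \<theta>))"
    unfolding T_def
  proof (rule integral_exp_sums(2))
    show "integrable surface_measure (\<lambda>\<theta>. exp (norm (z \<theta>)) * norm (complex_of_real (Y \<theta>)))"
      unfolding z_def by (intro integrable_surface_measure continuous_intros cY)
  qed (auto simp: z_def)
  have "(\<lambda>m. T (k + 2 * m)) sums (LINT \<theta>|surface_measure. exp (z \<theta>) * complex_of_real (Y \<theta>))"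
  proof (subst sums_mono_reindex)
    show "T j = 0" if "j \<notin> range (\<lambda>m. k + 2 * m)" for j
    proof -
      have "\<not> (k \<le> j \<and> even (j - k))"
      proof
        assume "k \<le> j \<and> even (j - k)"
        then have "j = k + 2 * ((j - k) div 2)" by auto
        with that show False by blast
      qed
      then show ?thesis by (auto simp: T moments exp_square_coeff_def)
    qed
  qed (use sums in \<open>auto simp: strict_mono_def\<close>)
  also have "(\<lambda>m. T (k + 2 * m)) = (\<lambda>m. \<i> ^ k * complex_of_real (C * s powr (1 - DIM('a) / 2) * Y \<omega> *
      ((-1) ^ m / (fact m * Gamma (\<nu> + real m + 1)) * ((s / 2) powr \<nu> * (s / 2) ^ (2 * m)))))"
  proof
    fix m
    have d: "real (DIM('a) - 1 + (k + 2 * m + k)) = 2 * (\<nu> + real m) + 1"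
      using n by (simp add: \<nu>_def of_nat_diff)
    \<comment> \<open>The exponent of the radial moment is 2 (\<nu> + m) + 1, which produces exactly
      the Gamma factor of the Bessel series.\<close>
    have rm: "radial_moment (DIM('a) - 1 + (k + 2 * m + k)) = 2 powr (\<nu> + real m) * Gamma (\<nu> + real m + 1)"
    proof -
      have "(2 * (\<nu> + real m) + 1 - 1) / 2 = \<nu> + real m" "(2 * (\<nu> + real m) + 1 + 1) / 2 = \<nu> + real m + 1"
        by simp_all
      then show ?thesis unfolding radial_moment_def d by (simp only:)
    qed
    have sk: "s ^ (k + 2 * m) = s powr (1 - DIM('a) / 2) * (s powr \<nu> * s ^ (2 * m))"
    proof -
      have "s powr (1 - DIM('a) / 2) * (s powr \<nu> * s ^ (2 * m)) = s powr (1 - DIM('a) / 2 + \<nu> + real (2 * m))"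
        using s by (simp only: powr_add powr_realpow mult.assoc)
      also have "1 - DIM('a) / 2 + \<nu> + real (2 * m) = real (k + 2 * m)"
        by (simp add: \<nu>_def)
      finally show ?thesis using s by (simp only: powr_realpow)
    qed
    \<comment> \<open>The coefficient of exp(s^2/2) contributes 2^(-m) and the radial moment
      2^(-\<nu>-m); together they are the power of 2 in (s/2)^(\<nu> + 2 m).\<close>
    have half: "(1/2) ^ m / 2 powr (\<nu> + real m) = (1/2) powr \<nu> * (1/2::real) ^ (2 * m)"
    proof -
      have "(1/2) ^ m / 2 powr (\<nu> + real m) = (1/2) ^ m * ((1/2) powr \<nu> * (1/2::real) ^ m)"
        by (simp add: powr_add powr_realpow powr_divide power_divide)
      then show ?thesis
        by (simp add: power_mult power2_eq_square power_mult_distrib power_add mult_2)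
    qed
    have pk: "p (k + 2 * m) / fact (k + 2 * m) = C * Y \<omega> / (fact m * Gamma (\<nu> + real m + 1)) *
        ((1/2) ^ m / 2 powr (\<nu> + real m))"
      unfolding moments rm by (simp add: exp_square_coeff_def)
    have s2: "(s / 2) powr \<nu> * (s / 2) ^ (2 * m) = (s powr \<nu> * s ^ (2 * m)) * ((1/2) powr \<nu> * (1/2) ^ (2 * m))"
      using s by (simp add: powr_divide power_divide)
    have "s ^ (k + 2 * m) * (p (k + 2 * m) / fact (k + 2 * m)) =
      C * s powr (1 - DIM('a) / 2) * Y \<omega> * (1 / (fact m * Gamma (\<nu> + real m + 1)) * ((s / 2) powr \<nu> * (s / 2) ^ (2 * m)))"
      unfolding sk pk half s2 by simp
    then show "T (k + 2 * m) = \<i> ^ k * complex_of_real (C * s powr (1 - DIM('a) / 2) * Y \<omega> *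
      ((-1) ^ m / (fact m * Gamma (\<nu> + real m + 1)) * ((s / 2) powr \<nu> * (s / 2) ^ (2 * m))))"
      by (simp add: T power_add power_mult)
  qed
  finally have "(\<lambda>m. \<i> ^ k * complex_of_real (C * s powr (1 - DIM('a) / 2) * Y \<omega> *
      ((-1) ^ m / (fact m * Gamma (\<nu> + real m + 1)) * ((s / 2) powr \<nu> * (s / 2) ^ (2 * m))))) sums
    (LINT \<theta>|surface_measure. exp (z \<theta>) * complex_of_real (Y \<theta>))" .
  moreover have "(\<lambda>m. \<i> ^ k * complex_of_real (C * s powr (1 - DIM('a) / 2) * Y \<omega> *
      ((-1) ^ m / (fact m * Gamma (\<nu> + real m + 1)) * ((s / 2) powr \<nu> * (s / 2) ^ (2 * m))))) sums
    (\<i> ^ k * complex_of_real (C * s powr (1 - DIM('a) / 2) * Y \<omega> * bessel_J \<nu> s))"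
    by (intro sums_mult sums_of_real bessel_J_sums s) (use n in \<open>simp add: \<nu>_def\<close>)
  ultimately have "(LINT \<theta>|surface_measure. exp (z \<theta>) * complex_of_real (Y \<theta>)) =
      \<i> ^ k * complex_of_real (C * s powr (1 - DIM('a) / 2) * Y \<omega> * bessel_J \<nu> s)"
    by (rule sums_unique2)
  then show ?thesis
    by (simp add: z_def C_def \<nu>_def mult_ac)
qed

section \<open>Restriction of Fourier transforms to spheres\<close>

lemma measurable_bessel_J [measurable]: "bessel_J l \<in> borel_measurable borel"
  unfolding bessel_J_def set_lebesgue_integral_def by measurable

lemma nn_integral_polar_sgn:
  fixes \<Phi> :: "real \<Rightarrow> 'a::euclidean_space \<Rightarrow> ennreal"
  assumes [measurable]: "case_prod \<Phi> \<in> borel_measurable (borel \<Otimes>\<^sub>M borel)"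
  shows "(\<integral>\<^sup>+\<xi>. \<Phi> (norm \<xi>) (sgn \<xi>) \<partial>lborel) =
    (\<integral>\<^sup>+r. ennreal (r ^ (DIM('a) - 1)) * indicator {0<..} r * (\<integral>\<^sup>+\<omega>. \<Phi> r \<omega> \<partial>surface_measure) \<partial>lborel)"
proof -
  have [measurable]: "(\<lambda>\<xi>. \<Phi> (norm \<xi>) (sgn \<xi>)) \<in> borel_measurable borel"
    by measurable
  show ?thesis
  proof (subst nn_integral_polar, measurable, rule nn_integral_cong)
    fix r :: real
    show "ennreal (r ^ (DIM('a) - 1)) * indicator {0<..} r *
        (\<integral>\<^sup>+\<omega>. \<Phi> (norm (r *\<^sub>R \<omega>)) (sgn (r *\<^sub>R \<omega>)) \<partial>surface_measure) =
      ennreal (r ^ (DIM('a) - 1)) * indicator {0<..} r * (\<integral>\<^sup>+\<omega>. \<Phi> r \<omega> \<partial>surface_measure)"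
    proof (cases "r > 0")
      case True
      have "(\<integral>\<^sup>+\<omega>. \<Phi> (norm (r *\<^sub>R \<omega>)) (sgn (r *\<^sub>R \<omega>)) \<partial>surface_measure) =
          (\<integral>\<^sup>+\<omega>. \<Phi> r \<omega> \<partial>surface_measure)"
      proof (rule nn_integral_cong_AE)
        show "AE \<omega> in surface_measure. \<Phi> (norm (r *\<^sub>R \<omega>)) (sgn (r *\<^sub>R \<omega>)) = \<Phi> r \<omega>"
          using AE_surface_measure_norm
          by eventually_elim (use True in \<open>simp add: sgn_scaleR\<close>, simp add: sgn_div_norm)
      qed
      then show ?thesis by simp
    qed simp
  qed
qed

text \<open>In polar coordinates the radial integral over a null set of radii vanishes. Statements
  about almost every radius thus carry over to almost every point.\<close>

lemma AE_norm_lborel: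
  assumes [measurable]: "Measurable.pred borel P" and "AE r in lborel. 0 < r \<longrightarrow> P r"
  shows "AE \<xi> in (lborel :: 'a::euclidean_space measure). \<xi> \<noteq> 0 \<longrightarrow> P (norm \<xi>)"
proof -
  let ?N = "{\<xi>::'a. \<not> P (norm \<xi>) \<and> \<xi> \<noteq> 0}"
  have [measurable]: "?N \<in> sets borel" by measurable
  have "emeasure lborel ?N = (\<integral>\<^sup>+\<xi>. indicator ?N \<xi> \<partial>lborel)"
    by simp
  also have "\<dots> \<le> (\<integral>\<^sup>+(\<xi>::'a). indicator {r. \<not> P r} (norm \<xi>) \<partial>lborel)"
    by (rule nn_integral_mono) (auto simp: indicator_def)
  also have "\<dots> = (\<integral>\<^sup>+r. ennreal (r ^ (DIM('a) - 1)) * indicator {0<..} r *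
      (\<integral>\<^sup>+\<omega>. indicator {r. \<not> P r} r \<partial>(surface_measure :: 'a measure)) \<partial>lborel)"
    by (rule nn_integral_polar_sgn) measurable
  also have "\<dots> = (\<integral>\<^sup>+r. 0 \<partial>(lborel :: real measure))"
  proof (rule nn_integral_cong_AE)
    show "AE r in lborel. ennreal (r ^ (DIM('a) - 1)) * indicator {0<..} r *
      (\<integral>\<^sup>+\<omega>. indicator {r. \<not> P r} r \<partial>(surface_measure :: 'a measure)) = 0"
      using assms(2) by eventually_elim (auto simp: indicator_def)
  qed
  finally have "emeasure lborel ?N = 0" by simp
  then show ?thesis
    by (intro AE_I[of _ _ ?N]) auto
qed

section \<open>The trace on a sphere and its action on spherical harmonics\<close>

definition adjoint_trace :: "real \<Rightarrow> ('a::euclidean_space \<Rightarrow> complex) \<Rightarrow> 'a \<Rightarrow> complex" where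
  "adjoint_trace \<rho> g \<xi> = (LINT \<omega>|surface_measure. exp (\<i> * complex_of_real (\<rho> * (\<omega> \<bullet> \<xi>))) * g \<omega>)"

text \<open>Up to the factor (2 pi)^(-n), restored only at the end, this is the inverse Fourier
  transform at \<rho> \<omega>. It is defined for all \<omega>, so continuity can be stated on the
  whole space. \<open>adjoint_trace\<close> is its transpose for the bilinear pairing, which is why
  both have the same sign in the exponent and no conjugate occurs.\<close>

definition fourier_trace :: "real \<Rightarrow> ('a::euclidean_space \<Rightarrow> complex) \<Rightarrow> 'a \<Rightarrow> complex" where
  "fourier_trace \<rho> F \<omega> = (LINT \<xi>|lborel. exp (\<i> * complex_of_real (\<rho> * (\<omega> \<bullet> \<xi>))) * F \<xi>)"

lemma continuous_on_fourier_trace: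
  fixes F :: "'a::euclidean_space \<Rightarrow> complex"
  assumes "integrable lborel F"
  shows "continuous_on UNIV (fourier_trace \<rho> F)"
proof -
  have [measurable]: "F \<in> borel_measurable borel"
    using borel_measurable_integrable[OF assms] by simp
  show ?thesis
    unfolding continuous_on_sequentially
  proof (intro allI ballI impI, elim conjE)
    fix x :: "nat \<Rightarrow> 'a" and a assume x: "x \<longlonglongrightarrow> a"
    show "(fourier_trace \<rho> F \<circ> x) \<longlonglongrightarrow> fourier_trace \<rho> F a"
      unfolding fourier_trace_def comp_def
    proof (rule integral_dominated_convergence[where w="\<lambda>\<xi>. norm (F \<xi>)"])
      show "AE \<xi> in lborel. (\<lambda>j. exp (\<i> * complex_of_real (\<rho> * (x j \<bullet> \<xi>))) * F \<xi>) \<longlonglongrightarrow>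
          exp (\<i> * complex_of_real (\<rho> * (a \<bullet> \<xi>))) * F \<xi>"
        by (intro AE_I2 tendsto_intros x)
    qed (use assms in \<open>auto simp: norm_mult\<close>)
  qed
qed

lemma fourier_trace_pairing:
  fixes F g :: "'a::euclidean_space \<Rightarrow> complex"
  assumes F: "integrable lborel F" and g: "continuous_on UNIV g"
  shows "(LINT \<omega>|surface_measure. fourier_trace \<rho> F \<omega> * g \<omega>) = (LINT \<xi>|lborel. F \<xi> * adjoint_trace \<rho> g \<xi>)"
    and "integrable lborel (\<lambda>\<xi>. F \<xi> * adjoint_trace \<rho> g \<xi>)"
proof -
  interpret pair: pair_sigma_finite "surface_measure :: 'a measure" "lborel :: 'a measure"
    by (intro pair_sigma_finite.intro surface.sigma_finite_measure_axioms lborel.sigma_finite_measure_axioms)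
  have [measurable]: "F \<in> borel_measurable borel"
    using borel_measurable_integrable[OF F] by simp
  have [measurable]: "g \<in> borel_measurable borel"
    using borel_measurable_continuous_onI[OF g] .
  let ?h = "\<lambda>(\<omega>, \<xi>). exp (\<i> * complex_of_real (\<rho> * (\<omega> \<bullet> \<xi>))) * F \<xi> * g \<omega>"
  have int: "integrable (surface_measure \<Otimes>\<^sub>M lborel) ?h"
  proof (rule pair.Fubini_integrable)
    have "integrable surface_measure (\<lambda>\<omega>. (LINT \<xi>|lborel. norm (F \<xi>)) * norm (g \<omega>))"
      by (intro integrable_mult_right integrable_surface_measure continuous_intros g)
    then show "integrable surface_measure (\<lambda>\<omega>. LINT \<xi>|lborel. norm (?h (\<omega>, \<xi>)))"
      by (simp add: norm_mult)
    show "AE \<omega> in surface_measure. integrable lborel (\<lambda>\<xi>. ?h (\<omega>, \<xi>))"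
      by (rule AE_I2, rule Bochner_Integration.integrable_bound[of _ "\<lambda>\<xi>. norm (F \<xi>) * norm (g _)"])
         (use F in \<open>auto simp: norm_mult\<close>)
  qed measurable
  have "(LINT \<omega>|surface_measure. fourier_trace \<rho> F \<omega> * g \<omega>) =
      (LINT \<omega>|surface_measure. LINT \<xi>|lborel. ?h (\<omega>, \<xi>))"
    by (simp add: fourier_trace_def)
  also have "\<dots> = (LINT \<xi>|lborel. LINT \<omega>|surface_measure. ?h (\<omega>, \<xi>))"
    using pair.Fubini_integral[of "\<lambda>\<omega> \<xi>. ?h (\<omega>, \<xi>)"] int by simp
  also have "\<dots> = (LINT \<xi>|lborel. F \<xi> * adjoint_trace \<rho> g \<xi>)"
    by (simp add: adjoint_trace_def mult_ac flip: integral_mult_right_zero)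
  finally show "(LINT \<omega>|surface_measure. fourier_trace \<rho> F \<omega> * g \<omega>) = (LINT \<xi>|lborel. F \<xi> * adjoint_trace \<rho> g \<xi>)" .
  have "integrable lborel (\<lambda>\<xi>. LINT \<omega>|surface_measure. ?h (\<omega>, \<xi>))"
    using pair.integrable_snd[of "\<lambda>\<omega> \<xi>. ?h (\<omega>, \<xi>)"] int by simp
  then show "integrable lborel (\<lambda>\<xi>. F \<xi> * adjoint_trace \<rho> g \<xi>)"
    by (simp add: adjoint_trace_def mult_ac flip: integral_mult_right_zero)
qed

text \<open>The real scalar in the Funk-Hecke formula, without the factor i^k.\<close>

definition bessel_amplitude :: "nat \<Rightarrow> nat \<Rightarrow> real \<Rightarrow> real" where
  "bessel_amplitude n k s = (2 * pi) powr (n / 2) * s powr (1 - n / 2) * bessel_J (real n / 2 + real k - 1) s"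

lemma measurable_bessel_amplitude [measurable]: "bessel_amplitude n k \<in> borel_measurable borel"
  unfolding bessel_amplitude_def by measurable

text \<open>The factor r^(2-n) from the amplitude and the r^(n-1) from polar coordinates combine to
  r. This explains the weight r in C1 and the power of \<rho> in the bounds below.\<close>

lemma bessel_amplitude_square:
  assumes "\<rho> > 0" "r > 0" "n > 0"
  shows "(bessel_amplitude n k (\<rho> * r))\<^sup>2 * r ^ (n - 1) =
    (2 * pi) ^ n * \<rho> powr (2 - real n) * ((bessel_J (real n / 2 + real k - 1) (r * \<rho>))\<^sup>2 * r)"
proof -
  have sq: "(x powr (a / 2))\<^sup>2 = x powr a" if "x > 0" for x a :: real
    using that by (simp add: power2_eq_square powr_add[symmetric])
  have "((2 * pi) powr (n / 2))\<^sup>2 = (2 * pi) ^ n"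
    by (simp add: sq powr_realpow)
  moreover have "((\<rho> * r) powr (1 - n / 2))\<^sup>2 = \<rho> powr (2 - real n) * r powr (2 - real n)"
    using assms sq[of "\<rho> * r" "2 - real n"] by (simp add: diff_divide_distrib powr_mult)
  moreover have "r powr (2 - real n) * r ^ (n - 1) = r"
  proof -
    have "r powr (2 - real n) * r ^ (n - 1) = r powr (2 - real n) * r powr (real n - 1)"
      using assms by (simp add: powr_realpow[symmetric] of_nat_diff Suc_leI)
    then show ?thesis using assms by (simp add: powr_add[symmetric])
  qed
  ultimately show ?thesis
    unfolding bessel_amplitude_def power_mult_distrib by (simp add: mult_ac)
qed

lemma adjoint_trace_spherical_harmonic:
  fixes Y :: "'a::euclidean_space \<Rightarrow> real"
  assumes "spherical_harmonic k Y" "\<rho> > 0" "\<xi> \<noteq> 0" "DIM('a) \<ge> 2"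
  shows "adjoint_trace \<rho> (\<lambda>\<omega>. complex_of_real (Y \<omega>)) \<xi> =
    \<i> ^ k * complex_of_real (bessel_amplitude DIM('a) k (\<rho> * norm \<xi>) * Y (sgn \<xi>))"
proof -
  have e: "\<rho> * norm \<xi> * (sgn \<xi> \<bullet> \<theta>) = \<rho> * (\<theta> \<bullet> \<xi>)" for \<theta>
    using assms(3) by (simp add: sgn_div_norm inner_commute)
  have "norm (sgn \<xi>) = 1" "\<rho> * norm \<xi> > 0"
    using assms(2,3) by (auto simp: norm_sgn)
  from funk_hecke[OF assms(1) this assms(4)] show ?thesis
    unfolding e adjoint_trace_def bessel_amplitude_def .
qed

text \<open>Complex test functions are assembled from real harmonics. When real and imaginary part
  have the same degree, the transpose multiplies both by the same scalar.\<close>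

definition harmonic_pair :: "('a::euclidean_space \<Rightarrow> real) \<Rightarrow> ('a \<Rightarrow> real) \<Rightarrow> 'a \<Rightarrow> complex" where
  "harmonic_pair Y Z \<omega> = complex_of_real (Y \<omega>) + \<i> * complex_of_real (Z \<omega>)"

lemma continuous_on_harmonic_pair:
  assumes "spherical_harmonic k Y" "spherical_harmonic k Z"
  shows "continuous_on UNIV (harmonic_pair Y Z)"
  unfolding harmonic_pair_def
  by (intro continuous_intros continuous_on_hom_poly[OF spherical_harmonic_hom_poly[OF assms(1)]]
      continuous_on_hom_poly[OF spherical_harmonic_hom_poly[OF assms(2)]])

lemma harmonic_pair_orthogonal:
  assumes Y: "\<And>k. spherical_harmonic k (Y k)" and Z: "\<And>k. spherical_harmonic k (Z k)" and "k \<noteq> l"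
  shows "(LINT \<omega>|surface_measure. harmonic_pair (Y k) (Z k) \<omega> * cnj (harmonic_pair (Y l) (Z l) \<omega>)) = 0"
proof -
  note c = continuous_on_hom_poly[OF spherical_harmonic_hom_poly[OF Y]]
    continuous_on_hom_poly[OF spherical_harmonic_hom_poly[OF Z]]
  let ?I = "\<lambda>f g. surface_inner f g"
  have int: "integrable surface_measure (\<lambda>\<omega>. complex_of_real (f \<omega> * g \<omega>))"
    if "f \<in> range Y \<union> range Z" "g \<in> range Y \<union> range Z" for f g
    using that by (intro integrable_surface_measure) (auto intro!: continuous_intros c)
  have "(LINT \<omega>|surface_measure. harmonic_pair (Y k) (Z k) \<omega> * cnj (harmonic_pair (Y l) (Z l) \<omega>)) =
    (LINT \<omega>|surface_measure. complex_of_real (Y k \<omega> * Y l \<omega>) + complex_of_real (Z k \<omega> * Z l \<omega>) +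
      \<i> * complex_of_real (Z k \<omega> * Y l \<omega>) - \<i> * complex_of_real (Y k \<omega> * Z l \<omega>))"
    by (rule Bochner_Integration.integral_cong) (auto simp: harmonic_pair_def algebra_simps)
  also have "\<dots> = complex_of_real (?I (Y k) (Y l)) + complex_of_real (?I (Z k) (Z l)) +
      \<i> * complex_of_real (?I (Z k) (Y l)) - \<i> * complex_of_real (?I (Y k) (Z l))"
    using int[of "Y k" "Y l"] int[of "Z k" "Z l"] int[of "Z k" "Y l"] int[of "Y k" "Z l"]
    by (simp del: of_real_mult add: surface_inner_def)
  also have "\<dots> = 0"
    using spherical_harmonic_orthogonal[OF Y Y \<open>k \<noteq> l\<close>] spherical_harmonic_orthogonal[OF Z Z \<open>k \<noteq> l\<close>]
      spherical_harmonic_orthogonal[OF Y Z \<open>k \<noteq> l\<close>] spherical_harmonic_orthogonal[OF Z Y \<open>k \<noteq> l\<close>]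
    by simp
  finally show ?thesis .
qed

text \<open>The coefficients are needed in two cases: i^k times the amplitude, for the transpose of
  a test function at a given radius, and 1, for the test function itself.\<close>

lemma harmonic_pair_parseval:
  fixes Y Z :: "nat \<Rightarrow> 'a::euclidean_space \<Rightarrow> real"
  assumes Y: "\<And>k. spherical_harmonic k (Y k)" and Z: "\<And>k. spherical_harmonic k (Z k)"
  shows "(LINT \<omega>|surface_measure. (cmod (\<Sum>k\<le>N. c k * harmonic_pair (Y k) (Z k) \<omega>))\<^sup>2) =
    (\<Sum>k\<le>N. (cmod (c k))\<^sup>2 * (LINT \<omega>|surface_measure. (cmod (harmonic_pair (Y k) (Z k) \<omega>))\<^sup>2))"
proof -
  let ?h = "\<lambda>k. harmonic_pair (Y k) (Z k)"
  note c = continuous_on_harmonic_pair[OF Y Z]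
  have int: "integrable surface_measure (\<lambda>\<omega>. a * (?h k \<omega> * cnj (?h l \<omega>)))" for a k l
    by (intro integrable_surface_measure continuous_intros c)
  have sq: "complex_of_real (LINT \<omega>|surface_measure. (cmod (f \<omega>))\<^sup>2) = (LINT \<omega>|surface_measure. f \<omega> * cnj (f \<omega>))"
    for f :: "'a \<Rightarrow> complex"
    by (simp only: integral_complex_of_real[symmetric] complex_norm_square)
  have "complex_of_real (LINT \<omega>|surface_measure. (cmod (\<Sum>k\<le>N. c k * ?h k \<omega>))\<^sup>2) =
    (LINT \<omega>|surface_measure. (\<Sum>k\<le>N. \<Sum>l\<le>N. (c k * cnj (c l)) * (?h k \<omega> * cnj (?h l \<omega>))))"
    unfolding sq cnj_sum complex_cnj_mult sum_product by (simp only: mult_ac)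
  also have "\<dots> = (\<Sum>k\<le>N. \<Sum>l\<le>N. (c k * cnj (c l)) * (LINT \<omega>|surface_measure. ?h k \<omega> * cnj (?h l \<omega>)))"
    by (subst Bochner_Integration.integral_sum, intro Bochner_Integration.integrable_sum int)
       (subst Bochner_Integration.integral_sum, rule int, simp only: integral_mult_right_zero)
  also have "\<dots> = (\<Sum>k\<le>N. \<Sum>l\<le>N. if l = k then (c k * cnj (c k)) * (LINT \<omega>|surface_measure. ?h k \<omega> * cnj (?h k \<omega>)) else 0)"
    by (intro sum.cong) (auto simp: harmonic_pair_orthogonal[OF Y Z])
  also have "\<dots> = (\<Sum>k\<le>N. (c k * cnj (c k)) * (LINT \<omega>|surface_measure. ?h k \<omega> * cnj (?h k \<omega>)))"
    by simp
  also have "\<dots> = complex_of_real (\<Sum>k\<le>N. (cmod (c k))\<^sup>2 * (LINT \<omega>|surface_measure. (cmod (?h k \<omega>))\<^sup>2))"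
    by (simp only: of_real_sum of_real_mult sq complex_norm_square)
  finally show ?thesis
    by (simp only: of_real_eq_iff)
qed

text \<open>The integral from \<open>sphere_trace_const\<close>, taken over \<open>lborel\<close>
  because it is applied to a Borel version of the weight.\<close>

definition bessel_weight_integral :: "nat \<Rightarrow> (real \<Rightarrow> real) \<Rightarrow> real \<Rightarrow> nat \<Rightarrow> ennreal" where
  "bessel_weight_integral n w t k =
     (\<integral>\<^sup>+r. ennreal ((bessel_J (real n / 2 + real k - 1) (r * t))\<^sup>2) * (ennreal r / ennreal ((w r)\<^sup>2)) *
        indicator {0<..} r \<partial>lborel)"

lemma nn_integral_radial_energy:
  fixes w :: "real \<Rightarrow> real"
  assumes [measurable]: "w \<in> borel_measurable borel"
    and w0: "AE r in lborel. 0 < r \<longrightarrow> w r \<noteq> 0" and "\<rho> > 0" "n > 0"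
  shows "(\<integral>\<^sup>+r. ennreal (r ^ (n - 1) * (bessel_amplitude n k (\<rho> * r))\<^sup>2 / (w r)\<^sup>2) * indicator {0<..} r \<partial>lborel) =
    ennreal ((2 * pi) ^ n * \<rho> powr (2 - real n)) * bessel_weight_integral n w \<rho> k"
  unfolding bessel_weight_integral_def
proof (subst nn_integral_cmult[symmetric], measurable, rule nn_integral_cong_AE)
  let ?D = "(2 * pi) ^ n * \<rho> powr (2 - real n)"
  show "AE r in lborel. ennreal (r ^ (n - 1) * (bessel_amplitude n k (\<rho> * r))\<^sup>2 / (w r)\<^sup>2) * indicator {0<..} r =
    ennreal ?D * (ennreal ((bessel_J (real n / 2 + real k - 1) (r * \<rho>))\<^sup>2) *
      (ennreal r / ennreal ((w r)\<^sup>2)) * indicator {0<..} r)"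
    using w0
  proof eventually_elim
    fix r assume w: "0 < r \<longrightarrow> w r \<noteq> 0"
    show "ennreal (r ^ (n - 1) * (bessel_amplitude n k (\<rho> * r))\<^sup>2 / (w r)\<^sup>2) * indicator {0<..} r =
      ennreal ?D * (ennreal ((bessel_J (real n / 2 + real k - 1) (r * \<rho>))\<^sup>2) *
        (ennreal r / ennreal ((w r)\<^sup>2)) * indicator {0<..} r)"
    proof (cases "r > 0")
      case True
      have eq: "r ^ (n - 1) * (bessel_amplitude n k (\<rho> * r))\<^sup>2 / (w r)\<^sup>2 =
          ?D * ((bessel_J (real n / 2 + real k - 1) (r * \<rho>))\<^sup>2 * (r / (w r)\<^sup>2))"
        using bessel_amplitude_square[OF \<open>\<rho> > 0\<close> True \<open>n > 0\<close>, of k] by (simp add: mult_ac)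
      have "ennreal (a * (b * c)) = ennreal a * (ennreal b * ennreal c)"
        if "a \<ge> 0" "b \<ge> 0" "c \<ge> 0" for a b c
        using that by (simp add: ennreal_mult)
      note mult3 = this[of ?D "(bessel_J (real n / 2 + real k - 1) (r * \<rho>))\<^sup>2" "r / (w r)\<^sup>2"]
      \<comment> \<open>Here w r \<noteq> 0 matters: at a zero of w the real quotient would be 0 and
        the extended one infinite.\<close>
      have "ennreal r / ennreal ((w r)\<^sup>2) = ennreal (r / (w r)\<^sup>2)"
        using True w by (simp add: divide_ennreal)
      then show ?thesis
        unfolding eq using True mult3 by simp
    qed simp
  qed
qed

text \<open>K bounds the weight integrals of all degrees at once. The contributions of the
  components of g therefore add up again to the norm of g, and the constant depends neither on N nor
  on g.\<close>

lemma fourier_trace_dual_bound: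
  fixes F :: "'a::euclidean_space \<Rightarrow> complex" and Y Z :: "nat \<Rightarrow> 'a \<Rightarrow> real" and w :: "real \<Rightarrow> real" and N :: nat
  assumes n: "DIM('a) \<ge> 2" and \<rho>: "\<rho> > 0"
    and [measurable]: "w \<in> borel_measurable borel" and w0: "AE r in lborel. 0 < r \<longrightarrow> w r \<noteq> 0"
    and F: "integrable lborel F"
    and M: "integrable lborel (\<lambda>\<xi>. (w (norm \<xi>))\<^sup>2 * (cmod (F \<xi>))\<^sup>2)"
    and K: "\<And>k. bessel_weight_integral DIM('a) w \<rho> k \<le> ennreal K" "K \<ge> 0"
    and Y: "\<And>k. spherical_harmonic k (Y k)" and Z: "\<And>k. spherical_harmonic k (Z k)"
  defines "g \<equiv> \<lambda>\<omega>. \<Sum>k\<le>N. harmonic_pair (Y k) (Z k) \<omega>"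
  shows "(cmod (LINT \<omega>|surface_measure. fourier_trace \<rho> F \<omega> * g \<omega>))\<^sup>2 \<le>
    (2 * pi) ^ DIM('a) * \<rho> powr (2 - real DIM('a)) * K * (LINT \<xi>|lborel. (w (norm \<xi>))\<^sup>2 * (cmod (F \<xi>))\<^sup>2) *
      (LINT \<omega>|surface_measure. (cmod (g \<omega>))\<^sup>2)"
proof -
  define n where "n = DIM('a)"
  define D where "D = (2 * pi) ^ n * \<rho> powr (2 - real n)"
  have D: "D \<ge> 0" by (simp add: D_def)
  let ?hp = "\<lambda>k. harmonic_pair (Y k) (Z k)"
  have [measurable]: "F \<in> borel_measurable borel"
    using borel_measurable_integrable[OF F] by simp
  note c = continuous_on_harmonic_pair[OF Y Z]
  note [measurable] = borel_measurable_continuous_onI[OF c]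
  have cg: "continuous_on UNIV g"
    unfolding g_def by (intro continuous_intros c)
  \<comment> \<open>The transpose of g written in radius and direction, so that the polar formula
    and Parseval's identity at each radius apply.\<close>
  define h where "h r \<eta> = (\<Sum>k\<le>N. (\<i> ^ k * complex_of_real (bessel_amplitude n k (\<rho> * r))) * ?hp k \<eta>)" for r \<eta>
  have [measurable]: "case_prod h \<in> borel_measurable (borel \<Otimes>\<^sub>M borel)"
    unfolding h_def case_prod_unfold by measurable
  have adj: "adjoint_trace \<rho> g \<xi> = h (norm \<xi>) (sgn \<xi>)" if "\<xi> \<noteq> 0" for \<xi>
  proof -
    have cY: "continuous_on UNIV (Y k)" "continuous_on UNIV (Z k)" for k
      using Y Z by (auto intro: continuous_on_hom_poly spherical_harmonic_hom_poly)
    let ?e = "\<lambda>\<omega>. exp (\<i> * complex_of_real (\<rho> * (\<omega> \<bullet> \<xi>)))"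
    have int: "integrable surface_measure (\<lambda>\<omega>. ?e \<omega> * complex_of_real (f \<omega>))" if "continuous_on UNIV f" for f
      by (intro integrable_surface_measure continuous_intros that)
    have "adjoint_trace \<rho> g \<xi> = (LINT \<omega>|surface_measure.
        (\<Sum>k\<le>N. ?e \<omega> * complex_of_real (Y k \<omega>) + \<i> * (?e \<omega> * complex_of_real (Z k \<omega>))))"
      unfolding adjoint_trace_def g_def harmonic_pair_def
      by (simp add: sum_distrib_left algebra_simps)
    also have "\<dots> = (\<Sum>k\<le>N. (LINT \<omega>|surface_measure. ?e \<omega> * complex_of_real (Y k \<omega>)) +
        \<i> * (LINT \<omega>|surface_measure. ?e \<omega> * complex_of_real (Z k \<omega>)))"
      using int[OF cY(1)] int[OF cY(2)] by (subst Bochner_Integration.integral_sum) auto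
    also have "\<dots> = h (norm \<xi>) (sgn \<xi>)"
      unfolding adjoint_trace_def[symmetric] adjoint_trace_spherical_harmonic[OF Y \<rho> that n]
        adjoint_trace_spherical_harmonic[OF Z \<rho> that n] h_def harmonic_pair_def n_def
      by (simp add: algebra_simps)
    finally show ?thesis .
  qed
  have w0': "AE \<xi> in (lborel :: 'a measure). \<xi> \<noteq> 0 \<and> w (norm \<xi>) \<noteq> 0"
    using AE_norm_lborel[of "\<lambda>r. w r \<noteq> 0", OF _ w0] AE_lborel_singleton[of "0::'a"]
    by (auto elim: eventually_elim2)
  have parseval: "(LINT \<eta>|surface_measure. (cmod (h r \<eta>))\<^sup>2) =
      (\<Sum>k\<le>N. (bessel_amplitude n k (\<rho> * r))\<^sup>2 * (LINT \<omega>|surface_measure. (cmod (?hp k \<omega>))\<^sup>2))" for r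
    unfolding h_def harmonic_pair_parseval[OF Y Z] by (simp add: norm_mult norm_power)
  define \<mu> where "\<mu> k = (LINT \<omega>|surface_measure. (cmod (?hp k \<omega>))\<^sup>2)" for k
  have \<mu>: "\<mu> k \<ge> 0" for k by (simp add: \<mu>_def)
  have \<mu>_sum: "(LINT \<omega>|surface_measure. (cmod (g \<omega>))\<^sup>2) = (\<Sum>k\<le>N. \<mu> k)"
    using harmonic_pair_parseval[OF Y Z, where c="\<lambda>_. 1" and N=N] by (simp add: g_def \<mu>_def)
  \<comment> \<open>Parseval's identity at each radius removes the cross terms. What is left is a
    sum of \<open>\<mu> k\<close> times the k-th weight integral; this is why C1 contains a supremum
    over k and not a sum.\<close>
  have energy: "(\<integral>\<^sup>+\<xi>. (ennreal (cmod (h (norm \<xi>) (sgn \<xi>)) / \<bar>w (norm \<xi>)\<bar>))\<^sup>2 \<partial>lborel) \<le> ennreal (D * K * (\<Sum>k\<le>N. \<mu> k))"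
  proof -
    have "(\<integral>\<^sup>+\<xi>. (ennreal (cmod (h (norm \<xi>) (sgn \<xi>)) / \<bar>w (norm \<xi>)\<bar>))\<^sup>2 \<partial>lborel) =
      (\<integral>\<^sup>+r. ennreal (r ^ (n - 1)) * indicator {0<..} r *
        (\<integral>\<^sup>+\<eta>. (ennreal (cmod (h r \<eta>) / \<bar>w r\<bar>))\<^sup>2 \<partial>surface_measure) \<partial>lborel)"
      unfolding n_def by (rule nn_integral_polar_sgn) measurable
    also have "\<dots> = (\<integral>\<^sup>+r. (\<Sum>k\<le>N. ennreal (\<mu> k) *
        (ennreal (r ^ (n - 1) * (bessel_amplitude n k (\<rho> * r))\<^sup>2 / (w r)\<^sup>2) * indicator {0<..} r)) \<partial>lborel)"
    proof (rule nn_integral_cong)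
      fix r :: real
      have "(\<integral>\<^sup>+\<eta>. (ennreal (cmod (h r \<eta>) / \<bar>w r\<bar>))\<^sup>2 \<partial>surface_measure) =
          (\<integral>\<^sup>+\<eta>. ennreal ((cmod (h r \<eta>))\<^sup>2 / (w r)\<^sup>2) \<partial>surface_measure)"
        by (simp add: ennreal_power power_divide)
      also have "\<dots> = ennreal (LINT \<eta>|surface_measure. (cmod (h r \<eta>))\<^sup>2 / (w r)\<^sup>2)"
        unfolding h_def by (intro nn_integral_eq_integral integrable_divide integrable_surface_measure continuous_intros c) auto
      also have "(LINT \<eta>|surface_measure. (cmod (h r \<eta>))\<^sup>2 / (w r)\<^sup>2) =
          (\<Sum>k\<le>N. \<mu> k * ((bessel_amplitude n k (\<rho> * r))\<^sup>2 / (w r)\<^sup>2))"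
        by (simp add: parseval \<mu>_def sum_divide_distrib mult_ac)
      finally have inner: "(\<integral>\<^sup>+\<eta>. (ennreal (cmod (h r \<eta>) / \<bar>w r\<bar>))\<^sup>2 \<partial>surface_measure) =
          ennreal (\<Sum>k\<le>N. \<mu> k * ((bessel_amplitude n k (\<rho> * r))\<^sup>2 / (w r)\<^sup>2))" .
      show "ennreal (r ^ (n - 1)) * indicator {0<..} r *
          (\<integral>\<^sup>+\<eta>. (ennreal (cmod (h r \<eta>) / \<bar>w r\<bar>))\<^sup>2 \<partial>surface_measure) =
        (\<Sum>k\<le>N. ennreal (\<mu> k) *
          (ennreal (r ^ (n - 1) * (bessel_amplitude n k (\<rho> * r))\<^sup>2 / (w r)\<^sup>2) * indicator {0<..} r))"
        unfolding inner
        by (cases "r > 0")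
           (auto simp: \<mu> ennreal_mult[symmetric] sum_distrib_left mult_ac sum_nonneg simp flip: sum_ennreal)
    qed
    also have "\<dots> = (\<Sum>k\<le>N. ennreal (\<mu> k) *
        (\<integral>\<^sup>+r. ennreal (r ^ (n - 1) * (bessel_amplitude n k (\<rho> * r))\<^sup>2 / (w r)\<^sup>2) * indicator {0<..} r \<partial>lborel))"
      by (subst nn_integral_sum) (auto simp: nn_integral_cmult)
    also have "\<dots> = (\<Sum>k\<le>N. ennreal (\<mu> k) * (ennreal D * bessel_weight_integral n w \<rho> k))"
      unfolding D_def using n by (subst nn_integral_radial_energy[OF _ w0 \<rho>]) (auto simp: n_def)
    also have "\<dots> \<le> (\<Sum>k\<le>N. ennreal (\<mu> k) * (ennreal D * ennreal K))"
      using K(1) by (intro sum_mono mult_left_mono) (auto simp: n_def)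
    also have "\<dots> = ennreal (D * K * (\<Sum>k\<le>N. \<mu> k))"
      using D K(2) \<mu> by (simp add: ennreal_mult[symmetric] sum_distrib_left mult_ac)
    finally show ?thesis .
  qed
  let ?M = "LINT \<xi>|lborel. (w (norm \<xi>))\<^sup>2 * (cmod (F \<xi>))\<^sup>2"
  have "ennreal (cmod (LINT \<omega>|surface_measure. fourier_trace \<rho> F \<omega> * g \<omega>)) \<le>
      (\<integral>\<^sup>+\<xi>. ennreal (cmod (F \<xi> * adjoint_trace \<rho> g \<xi>)) \<partial>lborel)"
    unfolding fourier_trace_pairing(1)[OF F cg]
    by (rule integral_norm_bound_ennreal[OF fourier_trace_pairing(2)[OF F cg]])
  \<comment> \<open>The factor w/w is inserted almost everywhere, preparing Cauchy-Schwarz with w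
    attached to F and 1/w to the transpose.\<close>
  also have "\<dots> = (\<integral>\<^sup>+\<xi>. ennreal (\<bar>w (norm \<xi>)\<bar> * cmod (F \<xi>)) *
      ennreal (cmod (h (norm \<xi>) (sgn \<xi>)) / \<bar>w (norm \<xi>)\<bar>) \<partial>lborel)"
  proof (rule nn_integral_cong_AE)
    show "AE \<xi> in lborel. ennreal (cmod (F \<xi> * adjoint_trace \<rho> g \<xi>)) =
      ennreal (\<bar>w (norm \<xi>)\<bar> * cmod (F \<xi>)) * ennreal (cmod (h (norm \<xi>) (sgn \<xi>)) / \<bar>w (norm \<xi>)\<bar>)"
      using w0' by eventually_elim (simp add: adj norm_mult ennreal_mult[symmetric])
  qed
  finally have "(ennreal (cmod (LINT \<omega>|surface_measure. fourier_trace \<rho> F \<omega> * g \<omega>)))\<^sup>2 \<le>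
    (\<integral>\<^sup>+\<xi>. ennreal (\<bar>w (norm \<xi>)\<bar> * cmod (F \<xi>)) *
      ennreal (cmod (h (norm \<xi>) (sgn \<xi>)) / \<bar>w (norm \<xi>)\<bar>) \<partial>lborel)\<^sup>2"
    by (rule power_mono) simp
  also have "\<dots> \<le> (\<integral>\<^sup>+\<xi>. (ennreal (\<bar>w (norm \<xi>)\<bar> * cmod (F \<xi>)))\<^sup>2 \<partial>lborel) *
      (\<integral>\<^sup>+\<xi>. (ennreal (cmod (h (norm \<xi>) (sgn \<xi>)) / \<bar>w (norm \<xi>)\<bar>))\<^sup>2 \<partial>lborel)"
    by (rule Cauchy_Schwarz_nn_integral) measurable
  also have "(\<integral>\<^sup>+\<xi>. (ennreal (\<bar>w (norm \<xi>)\<bar> * cmod (F \<xi>)))\<^sup>2 \<partial>lborel) = ennreal ?M"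
    by (simp add: ennreal_power power_mult_distrib nn_integral_eq_integral[OF M])
  also have "ennreal ?M * (\<integral>\<^sup>+\<xi>. (ennreal (cmod (h (norm \<xi>) (sgn \<xi>)) / \<bar>w (norm \<xi>)\<bar>))\<^sup>2 \<partial>lborel) \<le>
      ennreal ?M * ennreal (D * K * (\<Sum>k\<le>N. \<mu> k))"
    by (rule mult_left_mono[OF energy]) simp
  also have "\<dots> = ennreal (D * K * ?M * (\<Sum>k\<le>N. \<mu> k))"
    using D K(2) \<mu> by (simp add: ennreal_mult[symmetric] sum_nonneg mult_ac)
  finally show ?thesis
    using D K(2) \<mu> unfolding \<mu>_sum
    by (subst (asm) ennreal_power, simp, subst (asm) ennreal_le_iff)
       (auto simp: D_def n_def intro!: mult_nonneg_nonneg sum_nonneg)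
qed

lemma harmonic_pair_approximation:
  fixes E :: "'a::euclidean_space \<Rightarrow> complex"
  assumes E: "continuous_on UNIV E" and "e > 0"
  obtains N Y Z where "\<And>k. spherical_harmonic k (Y k)" "\<And>k. spherical_harmonic k (Z k)"
    "\<And>x. norm x = 1 \<Longrightarrow> cmod ((\<Sum>k\<le>N. harmonic_pair (Y k) (Z k) x) - E x) < e"
proof -
  have "continuous_on (sphere 0 1) (\<lambda>x. Re (E x))" "continuous_on (sphere 0 1) (\<lambda>x. Im (E x))"
    by (intro continuous_intros continuous_on_subset[OF E]; simp)+
  note sw = this[THEN Stone_Weierstrass_real_polynomial_function[OF compact_sphere]]
  obtain p where p: "real_polynomial_function p" "\<And>x. x \<in> sphere 0 1 \<Longrightarrow> \<bar>Re (E x) - p x\<bar> < e / 2"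
    using sw(1)[of "e / 2"] \<open>e > 0\<close> by auto
  obtain q where q: "real_polynomial_function q" "\<And>x. x \<in> sphere 0 1 \<Longrightarrow> \<bar>Im (E x) - q x\<bar> < e / 2"
    using sw(2)[of "e / 2"] \<open>e > 0\<close> by auto
  obtain L Y where Y: "\<And>k. spherical_harmonic k (Y k)"
      "\<And>x M. norm x = 1 \<Longrightarrow> M \<ge> L \<Longrightarrow> p x = (\<Sum>k\<le>M. Y k x)"
    using real_polynomial_function_spherical_harmonics[OF p(1)] by metis
  obtain M Z where Z: "\<And>k. spherical_harmonic k (Z k)"
      "\<And>x N. norm x = 1 \<Longrightarrow> N \<ge> M \<Longrightarrow> q x = (\<Sum>k\<le>N. Z k x)"
    using real_polynomial_function_spherical_harmonics[OF q(1)] by metis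
  \<comment> \<open>Both expansions stay valid for larger bounds, so the common N is the maximum of
    L and M.\<close>
  show thesis
  proof (rule that[OF Y(1) Z(1)])
    fix x :: 'a assume x: "norm x = 1"
    have "(\<Sum>k\<le>max L M. harmonic_pair (Y k) (Z k) x) = complex_of_real (p x) + \<i> * complex_of_real (q x)"
      using Y(2)[OF x, of "max L M"] Z(2)[OF x, of "max L M"]
      by (simp add: harmonic_pair_def sum.distrib sum_distrib_left)
    then have "cmod ((\<Sum>k\<le>max L M. harmonic_pair (Y k) (Z k) x) - E x) \<le> \<bar>p x - Re (E x)\<bar> + \<bar>q x - Im (E x)\<bar>"
      using cmod_le[of "(\<Sum>k\<le>max L M. harmonic_pair (Y k) (Z k) x) - E x"] by simp
    also have "\<dots> < e"
      using p(2)[of x] q(2)[of x] x by (simp add: abs_minus_commute)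
    finally show "cmod ((\<Sum>k\<le>max L M. harmonic_pair (Y k) (Z k) x) - E x) < e" .
  qed
qed

text \<open>The dual bound is applied to test functions converging to the conjugate of the trace
  uniformly on the sphere. In the limit it says A^2 \<le> B A, where A is the integral to be
  bounded, and A cancels unless it is zero.\<close>

theorem fourier_trace_bound:
  fixes F :: "'a::euclidean_space \<Rightarrow> complex" and w :: "real \<Rightarrow> real"
  assumes n: "DIM('a) \<ge> 2" and \<rho>: "\<rho> > 0"
    and w: "w \<in> borel_measurable borel" and w0: "AE r in lborel. 0 < r \<longrightarrow> w r \<noteq> 0"
    and F: "integrable lborel F"
    and M: "integrable lborel (\<lambda>\<xi>. (w (norm \<xi>))\<^sup>2 * (cmod (F \<xi>))\<^sup>2)"
    and K: "\<And>k. bessel_weight_integral DIM('a) w \<rho> k \<le> ennreal K" "K \<ge> 0"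
  shows "(LINT \<omega>|surface_measure. (cmod (fourier_trace \<rho> F \<omega>))\<^sup>2) \<le>
    (2 * pi) ^ DIM('a) * \<rho> powr (2 - real DIM('a)) * K * (LINT \<xi>|lborel. (w (norm \<xi>))\<^sup>2 * (cmod (F \<xi>))\<^sup>2)"
    (is "?A \<le> ?B")
proof -
  define E where "E = fourier_trace \<rho> F"
  have E: "continuous_on UNIV E"
    unfolding E_def by (rule continuous_on_fourier_trace[OF F])
  have "\<exists>g. continuous_on UNIV g \<and> (\<forall>x. norm x = 1 \<longrightarrow> cmod (g x - cnj (E x)) < 1 / Suc j) \<and>
      (cmod (LINT \<omega>|surface_measure. E \<omega> * g \<omega>))\<^sup>2 \<le> ?B * (LINT \<omega>|surface_measure. (cmod (g \<omega>))\<^sup>2)" for j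
  proof -
    have cE: "continuous_on UNIV (\<lambda>x. cnj (E x))"
      by (intro continuous_intros E)
    obtain N Y Z where Y: "\<And>k. spherical_harmonic k (Y k)" and Z: "\<And>k. spherical_harmonic k (Z k)"
      and close: "\<And>x. norm x = 1 \<Longrightarrow> cmod ((\<Sum>k\<le>N. harmonic_pair (Y k) (Z k) x) - cnj (E x)) < 1 / Suc j"
      by (rule harmonic_pair_approximation[OF cE, of "1 / Suc j"]) (simp, rule that)
    show ?thesis
      using fourier_trace_dual_bound[OF n \<rho> w w0 F M K Y Z, of N] close
      by (intro exI[of _ "\<lambda>x. \<Sum>k\<le>N. harmonic_pair (Y k) (Z k) x"])
         (auto simp: E_def intro!: continuous_intros continuous_on_harmonic_pair[OF Y Z])
  qed
  then have "\<forall>j. \<exists>g. continuous_on UNIV g \<and> (\<forall>x. norm x = 1 \<longrightarrow> cmod (g x - cnj (E x)) < 1 / Suc j) \<and>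
      (cmod (LINT \<omega>|surface_measure. E \<omega> * g \<omega>))\<^sup>2 \<le> ?B * (LINT \<omega>|surface_measure. (cmod (g \<omega>))\<^sup>2)" by blast
  from choice[OF this] obtain G where G: "\<And>j. continuous_on UNIV (G j)"
      "\<And>j x. norm x = 1 \<Longrightarrow> cmod (G j x - cnj (E x)) < 1 / Suc j"
      "\<And>j. (cmod (LINT \<omega>|surface_measure. E \<omega> * G j \<omega>))\<^sup>2 \<le> ?B * (LINT \<omega>|surface_measure. (cmod (G j \<omega>))\<^sup>2)"
    by blast
  note [measurable] = borel_measurable_continuous_onI[OF E] borel_measurable_continuous_onI[OF G(1)]
  have lim: "(\<lambda>j. G j x) \<longlonglongrightarrow> cnj (E x)" if "norm x = 1" for x
  proof -
    have "(\<lambda>j. norm (G j x - cnj (E x))) \<longlonglongrightarrow> 0"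
      by (rule real_tendsto_sandwich[OF _ _ tendsto_const LIMSEQ_inverse_real_of_nat])
         (use G(2)[OF that] in \<open>auto simp: divide_inverse intro!: always_eventually less_imp_le\<close>)
    then show ?thesis
      by (rule LIM_zero_cancel[OF tendsto_norm_zero_cancel])
  qed
  have bound: "cmod (G j x) \<le> cmod (E x) + 1" if "norm x = 1" for j x
  proof -
    have "cmod (G j x) \<le> cmod (cnj (E x)) + cmod (G j x - cnj (E x))"
      by (metis add.commute diff_add_cancel norm_triangle_ineq)
    also have "cmod (G j x - cnj (E x)) \<le> 1"
      using G(2)[OF that, of j] by (smt (verit) divide_le_eq_1 of_nat_Suc of_nat_0_le_iff)
    finally show ?thesis by simp
  qed
  have "(\<lambda>j. LINT \<omega>|surface_measure. E \<omega> * G j \<omega>) \<longlonglongrightarrow> (LINT \<omega>|surface_measure. E \<omega> * cnj (E \<omega>))"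
  proof (rule integral_dominated_convergence[where w="\<lambda>\<omega>. cmod (E \<omega>) * (cmod (E \<omega>) + 1)"])
    show "integrable surface_measure (\<lambda>\<omega>. cmod (E \<omega>) * (cmod (E \<omega>) + 1))"
      by (intro integrable_surface_measure continuous_intros E)
    show "AE \<omega> in surface_measure. (\<lambda>j. E \<omega> * G j \<omega>) \<longlonglongrightarrow> E \<omega> * cnj (E \<omega>)"
      using AE_surface_measure_norm by eventually_elim (intro tendsto_intros lim)
    show "AE \<omega> in surface_measure. norm (E \<omega> * G j \<omega>) \<le> cmod (E \<omega>) * (cmod (E \<omega>) + 1)" for j
      using AE_surface_measure_norm
      by eventually_elim (auto simp: norm_mult intro!: mult_left_mono bound)
  qed (intro borel_measurable_integrable integrable_surface_measure continuous_intros E G(1))+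
  also have "(LINT \<omega>|surface_measure. E \<omega> * cnj (E \<omega>)) = complex_of_real ?A"
    unfolding E_def by (simp only: integral_complex_of_real[symmetric] complex_norm_square)
  finally have "(\<lambda>j. (cmod (LINT \<omega>|surface_measure. E \<omega> * G j \<omega>))\<^sup>2) \<longlonglongrightarrow> (cmod (complex_of_real ?A))\<^sup>2"
    by (intro tendsto_intros)
  moreover have "(\<lambda>j. LINT \<omega>|surface_measure. (cmod (G j \<omega>))\<^sup>2) \<longlonglongrightarrow> (LINT \<omega>|surface_measure. (cmod (cnj (E \<omega>)))\<^sup>2)"
  proof (rule integral_dominated_convergence[where w="\<lambda>\<omega>. (cmod (E \<omega>) + 1)\<^sup>2"])
    show "integrable surface_measure (\<lambda>\<omega>. (cmod (E \<omega>) + 1)\<^sup>2)"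
      by (intro integrable_surface_measure continuous_intros E)
    show "AE \<omega> in surface_measure. (\<lambda>j. (cmod (G j \<omega>))\<^sup>2) \<longlonglongrightarrow> (cmod (cnj (E \<omega>)))\<^sup>2"
      using AE_surface_measure_norm by eventually_elim (intro tendsto_intros lim)
    show "AE \<omega> in surface_measure. norm ((cmod (G j \<omega>))\<^sup>2) \<le> (cmod (E \<omega>) + 1)\<^sup>2" for j
      using AE_surface_measure_norm
      by eventually_elim (auto intro!: power_mono bound)
  qed (intro borel_measurable_integrable integrable_surface_measure continuous_intros E G(1))+
  then have "(\<lambda>j. ?B * (LINT \<omega>|surface_measure. (cmod (G j \<omega>))\<^sup>2)) \<longlonglongrightarrow> ?B * ?A"
    unfolding complex_mod_cnj E_def by (intro tendsto_intros)
  ultimately have "(cmod (complex_of_real ?A))\<^sup>2 \<le> ?B * ?A"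
    by (rule LIMSEQ_le) (use G(3) in blast)
  then have AB: "?A * ?A \<le> ?B * ?A"
    unfolding norm_of_real power2_abs by (simp only: power2_eq_square)
  have "?A \<ge> 0" "?B \<ge> 0"
    using K(2) by (auto intro!: mult_nonneg_nonneg integral_nonneg_AE)
  then show ?thesis
    using AB by (cases "?A = 0") (auto simp only: mult_le_cancel_right)
qed

section \<open>Sharpness at a fixed radius and degree\<close>

lemma surface_integral_Cauchy_Schwarz:
  fixes E g :: "'a::euclidean_space \<Rightarrow> complex"
  assumes E: "continuous_on UNIV E" and g: "continuous_on UNIV g"
  shows "(cmod (LINT \<omega>|surface_measure. E \<omega> * g \<omega>))\<^sup>2 \<le>
    (LINT \<omega>|surface_measure. (cmod (E \<omega>))\<^sup>2) * (LINT \<omega>|surface_measure. (cmod (g \<omega>))\<^sup>2)"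
proof -
  note [measurable] = borel_measurable_continuous_onI[OF E] borel_measurable_continuous_onI[OF g]
  have int: "integrable surface_measure (\<lambda>\<omega>. E \<omega> * g \<omega>)" "integrable surface_measure (\<lambda>\<omega>. (cmod (E \<omega>))\<^sup>2)"
      "integrable surface_measure (\<lambda>\<omega>. (cmod (g \<omega>))\<^sup>2)"
    by (intro integrable_surface_measure continuous_intros E g)+
  have "(ennreal (cmod (LINT \<omega>|surface_measure. E \<omega> * g \<omega>)))\<^sup>2 \<le>
      (\<integral>\<^sup>+\<omega>. ennreal (cmod (E \<omega> * g \<omega>)) \<partial>surface_measure)\<^sup>2"
    by (intro power_mono integral_norm_bound_ennreal int) simp
  also have "\<dots> = (\<integral>\<^sup>+\<omega>. ennreal (cmod (E \<omega>)) * ennreal (cmod (g \<omega>)) \<partial>surface_measure)\<^sup>2"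
    by (simp add: norm_mult ennreal_mult)
  also have "\<dots> \<le> (\<integral>\<^sup>+\<omega>. (ennreal (cmod (E \<omega>)))\<^sup>2 \<partial>surface_measure) *
      (\<integral>\<^sup>+\<omega>. (ennreal (cmod (g \<omega>)))\<^sup>2 \<partial>surface_measure)"
    by (rule Cauchy_Schwarz_nn_integral) measurable
  also have "\<dots> = ennreal ((LINT \<omega>|surface_measure. (cmod (E \<omega>))\<^sup>2) * (LINT \<omega>|surface_measure. (cmod (g \<omega>))\<^sup>2))"
    by (simp add: ennreal_power nn_integral_eq_integral int ennreal_mult)
  finally show ?thesis
    by (simp add: ennreal_power)
qed

text \<open>
  The extremisers are truncations of \<open>F \<xi> = J(\<rho>|\<xi>|) |\<xi>|\<^bsup>1 - n/2\<^esup> w(|\<xi>|)\<^bsup>-2\<^esup> Y (\<xi>/|\<xi>|)\<close>, for which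
  the pairing of the trace of \<open>F\<close> with \<open>Y\<close> and the weighted \<open>L\<^sup>2\<close> norm of \<open>F\<close> are the same integral.
\<close>

theorem fourier_trace_sharp:
  fixes w :: "real \<Rightarrow> real"
  assumes n: "DIM('a::euclidean_space) \<ge> 2" and \<rho>: "\<rho> > 0"
    and [measurable]: "w \<in> borel_measurable borel" and w0: "AE r in lborel. 0 < r \<longrightarrow> w r \<noteq> 0"
    and fin: "bessel_weight_integral DIM('a) w \<rho> k < \<infinity>" and B: "B \<ge> 0"
    and bound: "\<And>F :: 'a \<Rightarrow> complex. integrable lborel F \<Longrightarrow>
      integrable lborel (\<lambda>\<xi>. (w (norm \<xi>))\<^sup>2 * (cmod (F \<xi>))\<^sup>2) \<Longrightarrow>
      (LINT \<omega>|surface_measure. (cmod (fourier_trace \<rho> F \<omega>))\<^sup>2) \<le>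
        B * (LINT \<xi>|lborel. (w (norm \<xi>))\<^sup>2 * (cmod (F \<xi>))\<^sup>2)"
  shows "ennreal ((2 * pi) ^ DIM('a) * \<rho> powr (2 - real DIM('a))) * bessel_weight_integral DIM('a) w \<rho> k \<le> ennreal B"
proof -
  define n where "n = DIM('a)"
  have n0: "n > 0" by (simp add: n_def)
  obtain Y :: "'a \<Rightarrow> real" and x0 where Y: "spherical_harmonic k Y" and x0: "Y x0 \<noteq> 0"
    using spherical_harmonic_nonzero[OF n] by metis
  note hY = spherical_harmonic_hom_poly[OF Y]
  note cY = continuous_on_hom_poly[OF hY]
  have [measurable]: "Y \<in> borel_measurable borel"
    using borel_measurable_continuous_onI[OF cY] .
  define \<mu> where "\<mu> = (LINT \<omega>|surface_measure. (Y \<omega>)\<^sup>2)"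
  have intY: "integrable surface_measure (\<lambda>\<omega>. (Y \<omega>)\<^sup>2)"
    by (intro integrable_surface_measure continuous_intros cY)
  \<comment> \<open>If Y had norm zero on the sphere, its moment against the k-th power of x0
    \<bullet> \<theta> would vanish; but by the moment formula this moment is a nonzero multiple of
    Y x0.\<close>
  have "surface_inner Y Y \<noteq> 0"
  proof
    assume "surface_inner Y Y = 0"
    from surface_inner_self_eq_0[OF this cY, of "\<lambda>\<theta>. (x0 \<bullet> \<theta>) ^ k"] show False
      using spherical_harmonic_moments[OF Y, of k x0] x0 by (simp add: exp_square_coeff_def)
  qed
  moreover have "\<mu> \<ge> 0"
    by (simp add: \<mu>_def)
  moreover have "\<mu> = surface_inner Y Y"
    by (simp add: \<mu>_def surface_inner_def power2_eq_square)
  ultimately have \<mu>: "\<mu> > 0"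
    by (simp add: less_le)
  let ?b = "\<lambda>r. bessel_amplitude n k (\<rho> * r)"
  \<comment> \<open>The truncation makes F integrable: on a bounded set |F| \<le> 1 + |F|^2, and 1
    \<le> N w^2 bounds |F|^2 by N w^2 |F|^2, which is integrable.\<close>
  define A where "A N = {r. 0 < r \<and> r \<le> real N \<and> 1 \<le> real N * (w r)\<^sup>2}" for N
  have [measurable]: "A N \<in> sets borel" for N
    unfolding A_def by measurable
  define e where "e N = (\<integral>\<^sup>+r. ennreal (r ^ (n - 1) * (?b r)\<^sup>2 / (w r)\<^sup>2) * indicator (A N) r \<partial>lborel)" for N
  have energy: "(\<integral>\<^sup>+r. ennreal (r ^ (n - 1) * (?b r)\<^sup>2 / (w r)\<^sup>2) * indicator {0<..} r \<partial>lborel) =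
      ennreal ((2 * pi) ^ n * \<rho> powr (2 - real n)) * bessel_weight_integral n w \<rho> k"
    by (rule nn_integral_radial_energy[OF _ w0 \<rho> n0]) measurable
  have e_le: "e N \<le> ennreal B" for N
  proof -
    have "e N \<le> (\<integral>\<^sup>+r. ennreal (r ^ (n - 1) * (?b r)\<^sup>2 / (w r)\<^sup>2) * indicator {0<..} r \<partial>lborel)"
      unfolding e_def by (intro nn_integral_mono) (auto simp: A_def indicator_def)
    also have "\<dots> < \<infinity>"
      unfolding energy using fin by (simp add: n_def ennreal_mult_less_top)
    finally obtain eN where eN: "e N = ennreal eN" "eN \<ge> 0"
      by (cases "e N") auto
    define q where "q \<xi> = indicator (A N) (norm \<xi>) * ((?b (norm \<xi>))\<^sup>2 / (w (norm \<xi>))\<^sup>2) * (Y (sgn \<xi>))\<^sup>2" for \<xi> :: 'a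
    have [measurable]: "q \<in> borel_measurable borel"
      unfolding q_def by measurable
    have "(\<integral>\<^sup>+\<xi>. ennreal (q \<xi>) \<partial>lborel) =
      (\<integral>\<^sup>+r. ennreal (r ^ (n - 1)) * indicator {0<..} r *
        (\<integral>\<^sup>+\<eta>. ennreal (indicator (A N) r * ((?b r)\<^sup>2 / (w r)\<^sup>2) * (Y \<eta>)\<^sup>2) \<partial>surface_measure) \<partial>lborel)"
      unfolding q_def n_def by (rule nn_integral_polar_sgn) measurable
    also have "\<dots> = (\<integral>\<^sup>+r. (ennreal (r ^ (n - 1) * (?b r)\<^sup>2 / (w r)\<^sup>2) * indicator (A N) r) * ennreal \<mu> \<partial>lborel)"
    proof (rule nn_integral_cong)
      fix r :: real
      have "(\<integral>\<^sup>+\<eta>. ennreal (indicator (A N) r * ((?b r)\<^sup>2 / (w r)\<^sup>2) * (Y \<eta>)\<^sup>2) \<partial>surface_measure) =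
          ennreal (indicator (A N) r * ((?b r)\<^sup>2 / (w r)\<^sup>2) * \<mu>)"
        unfolding \<mu>_def by (subst nn_integral_eq_integral) (use intY in \<open>auto simp: indicator_def\<close>)
      then show "ennreal (r ^ (n - 1)) * indicator {0<..} r *
        (\<integral>\<^sup>+\<eta>. ennreal (indicator (A N) r * ((?b r)\<^sup>2 / (w r)\<^sup>2) * (Y \<eta>)\<^sup>2) \<partial>surface_measure) =
        (ennreal (r ^ (n - 1) * (?b r)\<^sup>2 / (w r)\<^sup>2) * indicator (A N) r) * ennreal \<mu>"
        using \<mu> by (cases "r \<in> A N") (auto simp: A_def ennreal_mult[symmetric] mult_ac)
    qed
    also have "\<dots> = e N * ennreal \<mu>"
      unfolding e_def by (rule nn_integral_multc) measurable
    finally have q_nn: "(\<integral>\<^sup>+\<xi>. ennreal (q \<xi>) \<partial>lborel) = ennreal (eN * \<mu>)"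
      using eN \<mu> by (simp add: ennreal_mult)
    have q_nonneg: "q \<xi> \<ge> 0" for \<xi> by (simp add: q_def)
    have q_int: "integrable lborel q" "(LINT \<xi>|lborel. q \<xi>) = eN * \<mu>"
      using has_bochner_integral_nn_integral[OF _ _ _ q_nn] eN \<mu> q_nonneg
      by (auto simp: has_bochner_integral_iff)
    define F where "F \<xi> = complex_of_real (indicator (A N) (norm \<xi>) * (?b (norm \<xi>) / (w (norm \<xi>))\<^sup>2) * Y (sgn \<xi>))" for \<xi> :: 'a
    have [measurable]: "F \<in> borel_measurable borel"
      unfolding F_def by measurable
    have wF: "(w (norm \<xi>))\<^sup>2 * (cmod (F \<xi>))\<^sup>2 = q \<xi>" for \<xi>
    proof -
      have "(cmod (F \<xi>))\<^sup>2 = (indicator (A N) (norm \<xi>) * (?b (norm \<xi>) / (w (norm \<xi>))\<^sup>2) * Y (sgn \<xi>))\<^sup>2"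
        by (simp only: F_def norm_of_real power2_abs)
      moreover have "x\<^sup>2 * (i * (b / x\<^sup>2) * y)\<^sup>2 = i\<^sup>2 * (b\<^sup>2 / x\<^sup>2) * y\<^sup>2" for x i b y :: real
        by (cases "x = 0") (auto simp: power2_eq_square field_simps)
      ultimately show ?thesis
        by (simp only: q_def) (simp add: indicator_def)
    qed
    have F_int: "integrable lborel F"
    proof (rule Bochner_Integration.integrable_bound)
      show "integrable lborel (\<lambda>\<xi>. indicator (cball 0 (real N)) \<xi> + real N * q \<xi>)"
        using q_int by (intro Bochner_Integration.integrable_add integrable_mult_right) (auto intro!: integrable_real_indicator emeasure_lborel_cball_finite)
      show "AE \<xi> in lborel. norm (F \<xi>) \<le> norm (indicator (cball 0 (real N)) \<xi> + real N * q \<xi>)"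
      proof (rule AE_I2)
        fix \<xi> :: 'a
        show "norm (F \<xi>) \<le> norm (indicator (cball 0 (real N)) \<xi> + real N * q \<xi>)"
        proof (cases "norm \<xi> \<in> A N")
          case True
          have "cmod (F \<xi>) \<le> 1 + (cmod (F \<xi>))\<^sup>2"
          proof -
            have "x \<le> 1 + x\<^sup>2" for x :: real
              using zero_le_power2[of "x - 1/2"] by (simp add: power2_eq_square algebra_simps)
            then show ?thesis .
          qed
          also have "(cmod (F \<xi>))\<^sup>2 \<le> real N * (w (norm \<xi>))\<^sup>2 * (cmod (F \<xi>))\<^sup>2"
            using True mult_right_mono[of 1 "real N * (w (norm \<xi>))\<^sup>2" "(cmod (F \<xi>))\<^sup>2"] by (simp add: A_def)
          also have "\<dots> = real N * q \<xi>" by (simp add: wF[symmetric])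
          finally show ?thesis
            using True q_nonneg[of \<xi>] by (simp add: A_def)
        qed (simp add: F_def)
      qed
    qed measurable
    let ?E = "fourier_trace \<rho> F" and ?Y = "\<lambda>\<omega>. complex_of_real (Y \<omega>)"
    have cYc: "continuous_on UNIV ?Y" by (intro continuous_intros cY)
    have "(LINT \<omega>|surface_measure. ?E \<omega> * ?Y \<omega>) = (LINT \<xi>|lborel. F \<xi> * adjoint_trace \<rho> ?Y \<xi>)"
      by (rule fourier_trace_pairing(1)[OF F_int cYc])
    also have "\<dots> = (LINT \<xi>|lborel. \<i> ^ k * complex_of_real (q \<xi>))"
    proof (rule integral_cong_AE)
      show "(\<lambda>\<xi>. F \<xi> * adjoint_trace \<rho> ?Y \<xi>) \<in> borel_measurable lborel"
        using fourier_trace_pairing(2)[OF F_int cYc] by simp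
      show "AE \<xi> in lborel. F \<xi> * adjoint_trace \<rho> ?Y \<xi> = \<i> ^ k * complex_of_real (q \<xi>)"
        using AE_lborel_singleton[of "0::'a"]
        by eventually_elim
           (simp add: adjoint_trace_spherical_harmonic[OF Y \<rho> _ n] F_def q_def n_def power2_eq_square indicator_def)
    qed measurable
    also have "\<dots> = \<i> ^ k * complex_of_real (eN * \<mu>)"
      by (simp only: integral_mult_right_zero integral_complex_of_real q_int)
    finally have pair: "cmod (LINT \<omega>|surface_measure. ?E \<omega> * ?Y \<omega>) = eN * \<mu>"
      using eN \<mu> by (simp add: norm_mult norm_power)
    \<comment> \<open>The pairing and the weighted square norm of F are both
      \<open>eN * \<mu>\<close>. Cauchy-Schwarz against Y followed by the assumed bound leaves one
      surplus factor \<open>eN\<close>, which is compared with B.\<close>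
    have "(eN * \<mu>)\<^sup>2 \<le> (LINT \<omega>|surface_measure. (cmod (?E \<omega>))\<^sup>2) * \<mu>"
      using surface_integral_Cauchy_Schwarz[OF continuous_on_fourier_trace[OF F_int] cYc, of \<rho>]
      unfolding pair by (simp add: \<mu>_def)
    also have "\<dots> \<le> (B * (eN * \<mu>)) * \<mu>"
      using bound[OF F_int] q_int \<mu> by (intro mult_right_mono) (auto simp: wF)
    finally have "(eN * \<mu>\<^sup>2) * eN \<le> (eN * \<mu>\<^sup>2) * B"
      by (simp add: power2_eq_square mult_ac)
    then have "eN \<le> B"
      using eN \<mu> B by (cases "eN = 0") auto
    then show ?thesis by (simp add: eN(1) ennreal_leI)
  qed
  \<comment> \<open>The sets \<open>A N\<close> increase to the positive half-line without the zeros
    of w, so monotone convergence removes the truncation.\<close>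
  have "(\<integral>\<^sup>+r. ennreal (r ^ (n - 1) * (?b r)\<^sup>2 / (w r)\<^sup>2) * indicator {0<..} r \<partial>lborel) =
    (\<integral>\<^sup>+r. (SUP N. ennreal (r ^ (n - 1) * (?b r)\<^sup>2 / (w r)\<^sup>2) * indicator (A N) r) \<partial>lborel)"
  proof (rule nn_integral_cong_AE)
    show "AE r in lborel. ennreal (r ^ (n - 1) * (?b r)\<^sup>2 / (w r)\<^sup>2) * indicator {0<..} r =
      (SUP N. ennreal (r ^ (n - 1) * (?b r)\<^sup>2 / (w r)\<^sup>2) * indicator (A N) r)"
      using w0
    proof eventually_elim
      fix r assume w: "0 < r \<longrightarrow> w r \<noteq> 0"
      show "ennreal (r ^ (n - 1) * (?b r)\<^sup>2 / (w r)\<^sup>2) * indicator {0<..} r =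
        (SUP N. ennreal (r ^ (n - 1) * (?b r)\<^sup>2 / (w r)\<^sup>2) * indicator (A N) r)" (is "?x * _ = _")
      proof (cases "r > 0")
        case True
        obtain N where N: "max r (1 / (w r)\<^sup>2) \<le> real N"
          using real_arch_simple by blast
        have "r \<in> A N"
          using True w N by (auto simp: A_def field_simps)
        then have "?x \<le> (SUP N. ?x * indicator (A N) r)"
          by (intro SUP_upper2[of N]) auto
        moreover have "(SUP N. ?x * indicator (A N) r) \<le> ?x"
          by (rule SUP_least) (auto simp: indicator_def)
        ultimately show ?thesis using True by simp
      qed (auto simp: A_def)
    qed
  qed
  also have "\<dots> = (SUP N. e N)"
    unfolding e_def
  proof (rule nn_integral_monotone_convergence_SUP)
    have "A M \<subseteq> A N" if "M \<le> N" for M N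
    proof
      fix r assume r: "r \<in> A M"
      have "real M * (w r)\<^sup>2 \<le> real N * (w r)\<^sup>2"
        using that by (intro mult_right_mono) auto
      then show "r \<in> A N" using r that by (auto simp: A_def)
    qed
    then show "incseq (\<lambda>N r. ennreal (r ^ (n - 1) * (?b r)\<^sup>2 / (w r)\<^sup>2) * indicator (A N) r)"
      by (auto simp: incseq_def le_fun_def indicator_def)
  qed measurable
  also have "\<dots> \<le> ennreal B"
    by (rule SUP_least) (rule e_le)
  finally show ?thesis
    unfolding energy by (simp add: n_def)
qed

section \<open>Nonvanishing forced by the finiteness of the constant\<close>

lemma bessel_J_pos:
  assumes l: "l > -1/2" and t: "0 < t" "t \<le> 1"
  shows "bessel_J l t > 0"
proof -
  define wt where "wt r = indicator {-1..1} r * (1 - r\<^sup>2) powr (l - 1/2)" for r :: real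
  have [measurable]: "wt \<in> borel_measurable borel" unfolding wt_def by measurable
  have wt: "integrable lborel wt" "(LINT r|lborel. wt r) = Beta (1/2) (l + 1/2)"
    using has_bochner_integral_even_Beta[of "l - 1/2" 0] l
    by (simp_all add: has_bochner_integral_iff wt_def[abs_def] add.commute)
  define z where "z r = exp (\<i> * complex_of_real (t * r)) * complex_of_real (wt r)" for r
  have [measurable]: "z \<in> borel_measurable borel" unfolding z_def by measurable
  have z_int: "integrable lborel z"
    by (rule Bochner_Integration.integrable_bound[OF wt(1)]) (auto simp: z_def norm_mult)
  have Re_z: "Re (z r) = cos (t * r) * wt r" for r
    by (simp add: z_def Re_exp cis_conv_exp[symmetric])
  have cos1: "cos 1 > (0::real)"
    using pi_gt3 by (intro cos_gt_zero) auto
  \<comment> \<open>For t and |r| at most 1 the cosine is at least cos 1, which is positive because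
    1 < pi/2; hence the integral defining J is bounded below by a positive multiple of the total
    weight.\<close>
  have lower: "cos 1 * wt r \<le> cos (t * r) * wt r" for r
  proof (cases "r \<in> {-1..1}")
    case True
    then have "\<bar>t * r\<bar> \<le> 1"
      using t by (auto simp: abs_mult intro: mult_le_one)
    then have "cos 1 \<le> cos \<bar>t * r\<bar>"
      using pi_gt3 by (intro cos_monotone_0_pi_le) auto
    then show ?thesis
      by (intro mult_right_mono) (auto simp: wt_def)
  qed (simp add: wt_def)
  have "0 < cos 1 * Beta (1/2) (l + 1/2)"
    using cos1 l by (simp add: Beta_def Gamma_real_pos)
  also have "\<dots> = (LINT r|lborel. cos 1 * wt r)"
    by (simp add: wt(2))
  also have "\<dots> \<le> (LINT r|lborel. Re (z r))"
    unfolding Re_z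
    by (rule integral_mono) (use wt(1) integrable_Re[OF z_int] lower in \<open>auto simp: Re_z\<close>)
  finally have "0 < Re (LINT r|lborel. z r)"
    using integral_Re[OF z_int] by simp
  also have "(LINT r|lborel. z r) =
      (LINT r:{-1..1}|lborel. exp (\<i> * complex_of_real (t * r)) * complex_of_real ((1 - r\<^sup>2) powr (l - 1/2)))"
    unfolding set_lebesgue_integral_def
    by (rule Bochner_Integration.integral_cong) (auto simp: z_def wt_def indicator_def)
  finally have pos: "0 < Re (LINT r:{-1..1}|lborel. exp (\<i> * complex_of_real (t * r)) *
      complex_of_real ((1 - r\<^sup>2) powr (l - 1/2)))" .
  have "0 < t powr l / (2 powr l * Gamma (l + 1/2) * Gamma (1/2))"
    using l t by (intro divide_pos_pos mult_pos_pos Gamma_real_pos) auto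
  from mult_pos_pos[OF this pos] show ?thesis
    unfolding bessel_J_def times_complex.sel Re_complex_of_real Im_complex_of_real mult_zero_left diff_zero .
qed

text \<open>The integrand is strictly positive on (0, 1/t], where J is positive. Consequently a zero
  of \<sigma> would make the expression for C1 infinite, and C1 itself is positive.\<close>

lemma bessel_weight_integral_nonzero:
  assumes [measurable]: "w \<in> borel_measurable borel" and "t > 0" "n \<ge> 2"
  shows "bessel_weight_integral n w t k \<noteq> 0"
proof
  assume "bessel_weight_integral n w t k = 0"
  then have "AE r in lborel. ennreal ((bessel_J (real n / 2 + real k - 1) (r * t))\<^sup>2) *
      (ennreal r / ennreal ((w r)\<^sup>2)) * indicator {0<..} r = 0"
    unfolding bessel_weight_integral_def by (subst (asm) nn_integral_0_iff_AE) measurable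
  then have "AE r in lborel. r \<notin> {0<..1 / t}"
  proof eventually_elim
    fix r assume *: "ennreal ((bessel_J (real n / 2 + real k - 1) (r * t))\<^sup>2) *
      (ennreal r / ennreal ((w r)\<^sup>2)) * indicator {0<..} r = 0"
    show "r \<notin> {0<..1 / t}"
    proof
      assume r: "r \<in> {0<..1 / t}"
      then have "bessel_J (real n / 2 + real k - 1) (r * t) > 0"
        using assms by (intro bessel_J_pos) (auto simp: field_simps)
      with * r show False
        by (auto simp: ennreal_divide_eq_0_iff ennreal_eq_0_iff)
    qed
  qed
  then have "emeasure lborel {0<..1 / t} = 0"
    by (subst (asm) AE_iff_null_sets[symmetric]) auto
  then show False
    using \<open>t > 0\<close> by simp
qed

text \<open>Where J is positive, a zero of w makes the integrand infinite. Small t stretches the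
  interval of positivity, so countably many t cover the half-line, and degree 0 alone is
  enough.\<close>

lemma AE_weight_nonzero:
  assumes [measurable]: "w \<in> borel_measurable borel" and n: "n \<ge> 2"
    and fin: "\<And>t. t > 0 \<Longrightarrow> bessel_weight_integral n w t 0 < \<infinity>"
  shows "AE r in lborel. 0 < r \<longrightarrow> w r \<noteq> 0"
proof -
  have "AE r in lborel. 0 < r \<and> r \<le> real (Suc m) \<longrightarrow> w r \<noteq> 0" for m
  proof -
    \<comment> \<open>Chosen so that r t \<le> 1 for all r \<le> m + 1.\<close>
    define t where "t = 1 / real (Suc m)"
    have t: "t > 0" by (simp add: t_def)
    have "AE r in lborel. ennreal ((bessel_J (real n / 2 + real 0 - 1) (r * t))\<^sup>2) *
      (ennreal r / ennreal ((w r)\<^sup>2)) * indicator {0<..} r \<noteq> \<infinity>"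
      using fin[OF t] unfolding bessel_weight_integral_def
      by (intro nn_integral_PInf_AE) auto
    then show ?thesis
    proof (eventually_elim, intro impI notI)
      fix r assume *: "ennreal ((bessel_J (real n / 2 + real 0 - 1) (r * t))\<^sup>2) *
          (ennreal r / ennreal ((w r)\<^sup>2)) * indicator {0<..} r \<noteq> \<infinity>"
        and r: "0 < r \<and> r \<le> real (Suc m)" and w: "w r = 0"
      have "bessel_J (real n / 2 + real 0 - 1) (r * t) > 0"
        using n r by (intro bessel_J_pos) (auto simp: t_def field_simps)
      with * r w show False
        by (auto simp: ennreal_mult_eq_top_iff)
    qed
  qed
  then have "AE r in lborel. \<forall>m. 0 < r \<and> r \<le> real (Suc m) \<longrightarrow> w r \<noteq> 0"
    unfolding AE_all_countable by blast
  then show ?thesis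
  proof eventually_elim
    fix r assume *: "\<forall>m. 0 < r \<and> r \<le> real (Suc m) \<longrightarrow> w r \<noteq> 0"
    obtain m where "r \<le> real m" using real_arch_simple by blast
    then have "r \<le> real (Suc m)" by simp
    with * show "0 < r \<longrightarrow> w r \<noteq> 0" by blast
  qed
qed

section \<open>From Lebesgue measurable to Borel functions\<close>

lemma borel_weight:
  fixes w :: "real \<Rightarrow> real"
  assumes "w \<in> borel_measurable (lebesgue_on {0<..})"
  obtains w' where "w' \<in> borel_measurable borel" "AE r in lborel. 0 < r \<longrightarrow> w r = w' r"
proof -
  have "(\<lambda>r. if r \<in> {0<..} then w r else 0) \<in> borel_measurable lebesgue"
    using assms by (subst borel_measurable_if) auto
  then obtain w' where "w' \<in> borel_measurable lborel" "AE r in lborel. (if r \<in> {0<..} then w r else 0) = w' r"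
    using completion_ex_borel_measurable_real by blast
  then show thesis
    by (intro that[of w']) (auto elim!: eventually_mono)
qed

lemma AE_norm_eq:
  fixes w w' :: "real \<Rightarrow> real"
  assumes "AE r in lborel. 0 < r \<longrightarrow> w r = w' r"
  shows "AE \<xi> in (lborel :: 'a::euclidean_space measure). w (norm \<xi>) = w' (norm \<xi>)"
proof -
  \<comment> \<open>The exceptional set of radii need not be Borel, so it is enclosed in a Borel
    null set before passing to norms.\<close>
  obtain N where N: "{r \<in> space lborel. \<not> (0 < r \<longrightarrow> w r = w' r)} \<subseteq> N" "emeasure lborel N = 0" "N \<in> sets lborel"
    using assms by (rule AE_E)
  have [measurable]: "N \<in> sets borel" using N(3) by simp
  have "AE r in lborel. r \<notin> N"
    using N by (subst AE_iff_null_sets[symmetric]) auto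
  then have "AE r in lborel. 0 < r \<longrightarrow> r \<notin> N"
    by eventually_elim simp
  then have "AE \<xi> in (lborel :: 'a measure). \<xi> \<noteq> 0 \<longrightarrow> norm \<xi> \<notin> N"
    by (rule AE_norm_lborel[rotated]) measurable
  with AE_lborel_singleton[of "0::'a"] show ?thesis
  proof eventually_elim
    fix \<xi> :: 'a assume "\<xi> \<noteq> 0" "\<xi> \<noteq> 0 \<longrightarrow> norm \<xi> \<notin> N"
    then have "norm \<xi> \<notin> N" "0 < norm \<xi>" by auto
    then show "w (norm \<xi>) = w' (norm \<xi>)"
      using subsetD[OF N(1), of "norm \<xi>"] by auto
  qed
qed

lemma sphere_trace_const_borel:
  assumes "AE r in lborel. 0 < r \<longrightarrow> w r = w' r"
  shows "sphere_trace_const n \<sigma> w = ennreal_sqrt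
    (SUP (t, k) \<in> {0<..} \<times> UNIV. 1 / ennreal ((\<sigma> t)\<^sup>2) * bessel_weight_integral n w' t k)"
proof -
  have "(\<integral>\<^sup>+r\<in>{0<..}. ennreal ((bessel_J (real n / 2 + real k - 1) (r * t))\<^sup>2) *
            (ennreal r / ennreal ((w r)\<^sup>2)) \<partial>lebesgue) = bessel_weight_integral n w' t k" for t k
    unfolding bessel_weight_integral_def nn_integral_completion
  proof (rule nn_integral_cong_AE)
    show "AE r in lborel. ennreal ((bessel_J (real n / 2 + real k - 1) (r * t))\<^sup>2) *
        (ennreal r / ennreal ((w r)\<^sup>2)) * indicator {0<..} r =
      ennreal ((bessel_J (real n / 2 + real k - 1) (r * t))\<^sup>2) *
        (ennreal r / ennreal ((w' r)\<^sup>2)) * indicator {0<..} r"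
      using assms by eventually_elim (auto simp: indicator_def)
  qed
  then show ?thesis
    unfolding sphere_trace_const_def by simp
qed

lemma borel_representative:
  fixes F :: "'a::euclidean_space \<Rightarrow> complex"
  assumes "integrable lebesgue F"
  obtains F' where "integrable lborel F'" "AE \<xi> in lborel. F \<xi> = F' \<xi>"
proof -
  have "(\<lambda>\<xi>. Re (F \<xi>)) \<in> borel_measurable lebesgue" "(\<lambda>\<xi>. Im (F \<xi>)) \<in> borel_measurable lebesgue"
    using borel_measurable_integrable[OF assms] by measurable
  then obtain f g where f: "f \<in> borel_measurable lborel" "AE \<xi> in lborel. Re (F \<xi>) = f \<xi>"
    and g: "g \<in> borel_measurable lborel" "AE \<xi> in lborel. Im (F \<xi>) = g \<xi>"
    using completion_ex_borel_measurable_real[of "\<lambda>\<xi>. Re (F \<xi>)" lborel]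
      completion_ex_borel_measurable_real[of "\<lambda>\<xi>. Im (F \<xi>)" lborel] by blast
  define F' where "F' \<xi> = complex_of_real (f \<xi>) + \<i> * complex_of_real (g \<xi>)" for \<xi>
  have m: "F' \<in> borel_measurable lborel"
    unfolding F'_def using f(1) g(1) by measurable
  have ae: "AE \<xi> in lborel. F \<xi> = F' \<xi>"
    using f(2) g(2) by eventually_elim (auto simp: F'_def complex_eq_iff)
  have "integrable lebesgue F'"
    by (rule integrable_cong_AE_imp[OF assms])
       (use m AE_completion[OF ae] in \<open>auto intro: measurable_completion elim!: eventually_mono\<close>)
  then have "integrable lborel F'"
    by (subst (asm) integrable_completion[OF m])
  then show thesis using ae by (rule that)
qed

lemma lebesgue_integral_borel_representative:
  fixes f g :: "'a::euclidean_space \<Rightarrow> 'b::{banach, second_countable_topology}"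
  assumes "AE x in lborel. f x = g x" "f \<in> borel_measurable lebesgue" "g \<in> borel_measurable borel"
  shows "(LINT x|lebesgue. f x) = (LINT x|lborel. g x)" "integrable lebesgue f \<longleftrightarrow> integrable lborel g"
proof -
  have g: "g \<in> borel_measurable lborel" "g \<in> borel_measurable lebesgue"
    using assms(3) by (auto intro: measurable_completion)
  show "(LINT x|lebesgue. f x) = (LINT x|lborel. g x)"
    unfolding integral_completion[OF g(1), symmetric]
    by (rule integral_cong_AE[OF assms(2) g(2) AE_completion[OF assms(1)]])
  show "integrable lebesgue f \<longleftrightarrow> integrable lborel g"
    unfolding integrable_completion[OF g(1), symmetric]
    by (rule integrable_cong_AE[OF assms(2) g(2) AE_completion[OF assms(1)]])
qed

lemma sphere_L2_norm_inv_fourier: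
  fixes F F' :: "'a::euclidean_space \<Rightarrow> complex"
  assumes F: "integrable lebesgue F" and F': "integrable lborel F'" and ae: "AE \<xi> in lborel. F \<xi> = F' \<xi>"
    and "\<rho> > 0"
  shows "sphere_L2_norm \<rho> (inv_fourier F) =
    sqrt (\<rho> ^ (DIM('a) - 1) / ((2 * pi) ^ DIM('a))\<^sup>2 * (LINT \<omega>|surface_measure. (cmod (fourier_trace \<rho> F' \<omega>))\<^sup>2))"
proof -
  have m: "F \<in> borel_measurable lebesgue" "F' \<in> borel_measurable borel"
    using borel_measurable_integrable[OF F] borel_measurable_integrable[OF F'] by auto
  have "inv_fourier F (\<rho> *\<^sub>R \<omega>) = complex_of_real (1 / (2 * pi) ^ DIM('a)) * fourier_trace \<rho> F' \<omega>" for \<omega>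
  proof -
    have "(LINT \<xi>|lebesgue. exp (\<i> * complex_of_real ((\<rho> *\<^sub>R \<omega>) \<bullet> \<xi>)) * F \<xi>) =
        (LINT \<xi>|lborel. exp (\<i> * complex_of_real (\<rho> * (\<omega> \<bullet> \<xi>))) * F' \<xi>)"
    proof (rule lebesgue_integral_borel_representative)
      show "AE \<xi> in lborel. exp (\<i> * complex_of_real ((\<rho> *\<^sub>R \<omega>) \<bullet> \<xi>)) * F \<xi> = exp (\<i> * complex_of_real (\<rho> * (\<omega> \<bullet> \<xi>))) * F' \<xi>"
        using ae by eventually_elim simp
      have "(\<lambda>\<xi>. exp (\<i> * complex_of_real ((\<rho> *\<^sub>R \<omega>) \<bullet> \<xi>))) \<in> borel_measurable lebesgue"
        by (intro measurable_completion) measurable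
      then show "(\<lambda>\<xi>. exp (\<i> * complex_of_real ((\<rho> *\<^sub>R \<omega>) \<bullet> \<xi>)) * F \<xi>) \<in> borel_measurable lebesgue"
        using m(1) by measurable
      show "(\<lambda>\<xi>. exp (\<i> * complex_of_real (\<rho> * (\<omega> \<bullet> \<xi>))) * F' \<xi>) \<in> borel_measurable borel"
        using m(2) by measurable
    qed
    then show ?thesis by (simp add: inv_fourier_def fourier_trace_def)
  qed
  then have "(cmod (inv_fourier F (\<rho> *\<^sub>R \<omega>)))\<^sup>2 * \<rho> ^ (DIM('a) - 1) =
      \<rho> ^ (DIM('a) - 1) / ((2 * pi) ^ DIM('a))\<^sup>2 * (cmod (fourier_trace \<rho> F' \<omega>))\<^sup>2" for \<omega>
    by (simp add: norm_mult norm_divide norm_power power_mult_distrib power_divide)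
  then show ?thesis
    unfolding sphere_L2_norm_def by simp
qed

lemma multiplier_borel:
  fixes F F' :: "'a::euclidean_space \<Rightarrow> complex"
  assumes F: "integrable lebesgue F" and F': "integrable lborel F'" and ae: "AE \<xi> in lborel. F \<xi> = F' \<xi>"
    and w': "w' \<in> borel_measurable borel" and w: "AE r in lborel. 0 < r \<longrightarrow> w r = w' r"
  shows "multiplier_in_L2 w F \<longleftrightarrow> integrable lborel (\<lambda>\<xi>. (w' (norm \<xi>))\<^sup>2 * (cmod (F' \<xi>))\<^sup>2)"
    and "multiplier_L2_norm w F = sqrt ((LINT \<xi>|lborel. (w' (norm \<xi>))\<^sup>2 * (cmod (F' \<xi>))\<^sup>2) / (2 * pi) ^ DIM('a))"
proof -
  let ?f = "\<lambda>\<xi>. (w (norm \<xi>))\<^sup>2 * (cmod (F \<xi>))\<^sup>2" and ?g = "\<lambda>\<xi>. (w' (norm \<xi>))\<^sup>2 * (cmod (F' \<xi>))\<^sup>2"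
  have [measurable]: "F' \<in> borel_measurable borel"
    using borel_measurable_integrable[OF F'] by simp
  note [measurable] = w'
  have eq: "AE \<xi> in lborel. ?f \<xi> = ?g \<xi>"
    using AE_norm_eq[OF w, where 'a='a] ae by eventually_elim simp
  have g: "?g \<in> borel_measurable borel" by measurable
  \<comment> \<open>Measurability of w composed with the norm is not obtained by composition; it
    follows from equality almost everywhere with a Borel function and completeness of the
    measure.\<close>
  have f: "?f \<in> borel_measurable lebesgue"
    by (rule borel_measurable_AE[OF measurable_completion AE_completion[OF AE_symmetric[OF eq]]]) (use g in simp)
  note * = lebesgue_integral_borel_representative[OF eq f g]
  show "multiplier_in_L2 w F \<longleftrightarrow> integrable lborel ?g"
    unfolding multiplier_in_L2_def by (rule *(2))
  show "multiplier_L2_norm w F = sqrt ((LINT \<xi>|lborel. ?g \<xi>) / (2 * pi) ^ DIM('a))"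
    unfolding multiplier_L2_norm_def *(1) by simp
qed

text \<open>Both sides are square roots, so the claim is the comparison of their squares with the
  common positive factor removed. The identity \<rho>^(2-n) \<rho>^(n-1) = \<rho> is the origin of
  sqrt(\<rho>) in the theorem. Squaring requires C \<ge> 0.\<close>

lemma trace_inequality_rescale:
  fixes A M C s \<rho> :: real
  assumes "\<rho> > 0" "n > 0" "C \<ge> 0" "M \<ge> 0" "A \<ge> 0"
  shows "sqrt (\<rho> ^ (n - 1) / ((2 * pi) ^ n)\<^sup>2 * A) \<le> C * sqrt \<rho> * \<bar>s\<bar> * sqrt (M / (2 * pi) ^ n) \<longleftrightarrow>
    A \<le> (2 * pi) ^ n * \<rho> powr (2 - real n) * (C\<^sup>2 * s\<^sup>2) * M"
proof -
  define P where "P = (2 * pi) ^ n"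
  define R where "R = \<rho> ^ (n - 1)"
  define q where "q = \<rho> powr (2 - real n)"
  have pos: "P > 0" "R > 0" "q > 0"
    using assms(1) by (auto simp: P_def R_def q_def)
  have qR: "q * R = \<rho>"
  proof -
    have "q * R = \<rho> powr (2 - real n) * \<rho> powr (real n - 1)"
      using assms by (simp add: q_def R_def powr_realpow[symmetric] of_nat_diff Suc_leI)
    then show ?thesis using assms by (simp add: powr_add[symmetric])
  qed
  have "C * sqrt \<rho> * \<bar>s\<bar> * sqrt (M / P) = sqrt (C\<^sup>2 * \<rho> * s\<^sup>2 * (M / P))"
    using assms by (simp only: real_sqrt_mult real_sqrt_abs abs_of_nonneg)
  also have "C\<^sup>2 * \<rho> * s\<^sup>2 * (M / P) = R / P\<^sup>2 * (P * q * (C\<^sup>2 * s\<^sup>2) * M)"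
    using pos unfolding qR[symmetric] by (simp add: power2_eq_square mult_ac)
  finally have "sqrt (R / P\<^sup>2 * A) \<le> C * sqrt \<rho> * \<bar>s\<bar> * sqrt (M / P) \<longleftrightarrow>
      R / P\<^sup>2 * A \<le> R / P\<^sup>2 * (P * q * (C\<^sup>2 * s\<^sup>2) * M)"
    by (simp only: real_sqrt_le_iff)
  also have "\<dots> \<longleftrightarrow> A \<le> P * q * (C\<^sup>2 * s\<^sup>2) * M"
    using pos by (intro mult_le_cancel_left_pos) simp
  finally show ?thesis
    by (simp only: P_def R_def q_def)
qed

theorem theorem1p5:
  fixes \<sigma> w :: "real \<Rightarrow> real" and C1 :: ennreal
  assumes n: "CARD('n::finite) \<ge> 2"
    and w: "w \<in> borel_measurable (lebesgue_on {0<..})"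
    and C1: "C1 = sphere_trace_const CARD('n) \<sigma> w"
    and C1_finite: "C1 < \<infinity>"
  shows "(\<forall>\<rho>>0. \<forall>f F :: real ^ 'n \<Rightarrow> complex.
            has_L1_fourier_transform f F \<and> multiplier_in_L2 w F \<longrightarrow>
            sphere_L2_norm \<rho> f \<le> enn2real C1 * sqrt \<rho> * \<bar>\<sigma> \<rho>\<bar> * multiplier_L2_norm w F) \<and>
         (\<forall>C::real. C < enn2real C1 \<longrightarrow>
            \<not> (\<forall>\<rho>>0. \<forall>f F :: real ^ 'n \<Rightarrow> complex.
              has_L1_fourier_transform f F \<and> multiplier_in_L2 w F \<longrightarrow>
              sphere_L2_norm \<rho> f \<le> C * sqrt \<rho> * \<bar>\<sigma> \<rho>\<bar> * multiplier_L2_norm w F))"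
proof -
  define m where "m = CARD('n)"
  have dim: "DIM(real ^ 'n) = m" by (simp add: m_def)
  have m: "m \<ge> 2" "m > 0" "DIM(real ^ 'n) \<ge> 2" using n by (auto simp: m_def)
  obtain v where v [measurable]: "v \<in> borel_measurable borel" and wv: "AE r in lborel. 0 < r \<longrightarrow> w r = v r"
    using borel_weight[OF w] by blast
  let ?I = "bessel_weight_integral m v"
  define c where "c = enn2real C1"
  have c: "C1 = ennreal c" "c \<ge> 0"
    using C1_finite by (auto simp: c_def)
  have C1_sq: "C1\<^sup>2 = (SUP (t, k) \<in> {0<..} \<times> UNIV. 1 / ennreal ((\<sigma> t)\<^sup>2) * ?I t k)"
    unfolding C1 m_def sphere_trace_const_borel[OF wv] by (rule ennreal_sqrt_power2)
  have le: "1 / ennreal ((\<sigma> t)\<^sup>2) * ?I t k \<le> ennreal (c\<^sup>2)" if "t > 0" for t k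
  proof -
    have "1 / ennreal ((\<sigma> t)\<^sup>2) * ?I t k \<le> C1\<^sup>2"
      unfolding C1_sq using that by (intro SUP_upper2[of "(t, k)"]) auto
    then show ?thesis using c by (simp add: ennreal_power)
  qed
  have I_nz: "?I t k \<noteq> 0" if "t > 0" for t k
    using bessel_weight_integral_nonzero[OF v that m(1)] .
  \<comment> \<open>If \<sigma>(t) were 0, the convention 1/0 = \<infinity> and the nonzero weight
    integral would give an infinite value below the finite C1^2.\<close>
  have \<sigma>: "\<sigma> t \<noteq> 0" if "t > 0" for t
    using le[OF that, of 0] I_nz[OF that, of 0] by (auto simp: ennreal_top_mult top_unique)
  have cancel: "ennreal ((\<sigma> t)\<^sup>2) * (1 / ennreal ((\<sigma> t)\<^sup>2) * x) = x" if "t > 0" for t x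
  proof -
    have "ennreal ((\<sigma> t)\<^sup>2) * (1 / ennreal ((\<sigma> t)\<^sup>2)) = 1"
      using \<sigma>[OF that] by (simp add: ennreal_times_divide)
    then show ?thesis by (simp add: mult.assoc[symmetric])
  qed
  have I_le: "?I t k \<le> ennreal (c\<^sup>2 * (\<sigma> t)\<^sup>2)" if "t > 0" for t k
    using mult_left_mono[OF le[OF that, of k], of "ennreal ((\<sigma> t)\<^sup>2)"] cancel[OF that]
    by (simp add: ennreal_mult mult.commute)
  have I_fin: "?I t k < \<infinity>" if "t > 0" for t k
    using I_le[OF that, of k] by (rule le_less_trans) simp
  have v0: "AE r in lborel. 0 < r \<longrightarrow> v r \<noteq> 0"
    by (rule AE_weight_nonzero[OF v m(1) I_fin])
  have upper: "sphere_L2_norm \<rho> f \<le> c * sqrt \<rho> * \<bar>\<sigma> \<rho>\<bar> * multiplier_L2_norm w F"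
    if \<rho>: "\<rho> > 0" and f: "has_L1_fourier_transform f F" and M: "multiplier_in_L2 w F"
    for \<rho> and f F :: "real ^ 'n \<Rightarrow> complex"
  proof -
    have F: "integrable lebesgue F" and fF: "f = inv_fourier F"
      using f by (auto simp: has_L1_fourier_transform_def)
    obtain G where G: "integrable lborel G" "AE \<xi> in lborel. F \<xi> = G \<xi>"
      using borel_representative[OF F] by blast
    note mult = multiplier_borel[OF F G v wv]
    have "(LINT \<omega>|surface_measure. (cmod (fourier_trace \<rho> G \<omega>))\<^sup>2) \<le>
        (2 * pi) ^ m * \<rho> powr (2 - real m) * (c\<^sup>2 * (\<sigma> \<rho>)\<^sup>2) * (LINT \<xi>|lborel. (v (norm \<xi>))\<^sup>2 * (cmod (G \<xi>))\<^sup>2)"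
      using fourier_trace_bound[OF m(3) \<rho> v v0 G(1) _ _, of "c\<^sup>2 * (\<sigma> \<rho>)\<^sup>2"] M mult(1) I_le[OF \<rho>]
      unfolding dim by auto
    then show ?thesis
      unfolding fF sphere_L2_norm_inv_fourier[OF F G \<rho>] mult(2) dim
      using \<rho> m(2) c(2) by (subst trace_inequality_rescale) (auto intro!: integral_nonneg_AE)
  qed
  \<comment> \<open>An estimate valid for all f at radius t bounds every weight integral at t by (C
    \<sigma>(t))^2; the supremum over t and k then returns C1 \<le> C.\<close>
  have sharp: "c \<le> C"
    if C: "C \<ge> 0" and est: "\<And>\<rho> f F. \<rho> > 0 \<Longrightarrow> has_L1_fourier_transform (f :: real ^ 'n \<Rightarrow> complex) F \<Longrightarrow>
      multiplier_in_L2 w F \<Longrightarrow> sphere_L2_norm \<rho> f \<le> C * sqrt \<rho> * \<bar>\<sigma> \<rho>\<bar> * multiplier_L2_norm w F" for C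
  proof -
    have "1 / ennreal ((\<sigma> t)\<^sup>2) * ?I t k \<le> ennreal (C\<^sup>2)" if t: "t > 0" for t k
    proof -
      define D where "D = (2 * pi) ^ m * t powr (2 - real m)"
      have D: "D > 0" using t by (simp add: D_def)
      have "ennreal D * ?I t k \<le> ennreal (D * (C\<^sup>2 * (\<sigma> t)\<^sup>2))"
        unfolding D_def m_def
      proof (rule fourier_trace_sharp[where 'a="real ^ 'n", unfolded dim m_def])
        fix F :: "real ^ 'n \<Rightarrow> complex"
        assume F: "integrable lborel F"
          and M: "integrable lborel (\<lambda>\<xi>. (v (norm \<xi>))\<^sup>2 * (cmod (F \<xi>))\<^sup>2)"
        have [measurable]: "F \<in> borel_measurable lborel"
          using F by auto
        have FL: "integrable lebesgue F"
          using F by (subst integrable_completion) auto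
        note mult = multiplier_borel[OF FL F AE_I2[OF refl] v wv]
        have "sphere_L2_norm t (inv_fourier F) \<le> C * sqrt t * \<bar>\<sigma> t\<bar> * multiplier_L2_norm w F"
          using FL M mult(1) by (intro est t) (auto simp: has_L1_fourier_transform_def)
        then show "(LINT \<omega>|surface_measure. (cmod (fourier_trace t F \<omega>))\<^sup>2) \<le>
          (2 * pi) ^ CARD('n) * t powr (2 - real CARD('n)) * (C\<^sup>2 * (\<sigma> t)\<^sup>2) *
            (LINT \<xi>|lborel. (v (norm \<xi>))\<^sup>2 * (cmod (F \<xi>))\<^sup>2)"
          unfolding sphere_L2_norm_inv_fourier[OF FL F AE_I2[OF refl] t] mult(2) dim m_def[symmetric]
          using t m(2) C by (subst (asm) trace_inequality_rescale) (auto intro!: integral_nonneg_AE)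
      qed (use t n v v0 I_fin[OF t] in \<open>auto simp: m_def\<close>)
      then have "ennreal (1 / D) * (ennreal D * ?I t k) \<le> ennreal (1 / D) * ennreal (D * (C\<^sup>2 * (\<sigma> t)\<^sup>2))"
        by (rule mult_left_mono) simp
      then have "?I t k \<le> ennreal (C\<^sup>2 * (\<sigma> t)\<^sup>2)"
        using D by (simp add: mult.assoc[symmetric] ennreal_mult[symmetric])
      then have "1 / ennreal ((\<sigma> t)\<^sup>2) * ?I t k \<le> 1 / ennreal ((\<sigma> t)\<^sup>2) * ennreal (C\<^sup>2 * (\<sigma> t)\<^sup>2)"
        by (rule mult_left_mono) simp
      also have "\<dots> = 1 / ennreal ((\<sigma> t)\<^sup>2) * (ennreal ((\<sigma> t)\<^sup>2) * ennreal (C\<^sup>2))"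
        by (simp add: ennreal_mult mult.commute)
      also have "\<dots> = ennreal (C\<^sup>2)"
        using cancel[OF t, of "ennreal (C\<^sup>2)"] by (simp only: mult.left_commute)
      finally show ?thesis .
    qed
    then have "C1\<^sup>2 \<le> ennreal (C\<^sup>2)"
      unfolding C1_sq by (intro SUP_least) auto
    then show ?thesis
      using c C by (simp add: ennreal_power power2_le_iff_abs_le)
  qed
  \<comment> \<open>Needed for negative C: such a C is replaced by max C 0, for which the estimate
    still holds, and c \<le> 0 must then be contradictory.\<close>
  have c_pos: "c > 0"
    using le[of 1 0] I_nz[of 1 0] c(2) \<sigma>[of 1] by (cases "c = 0") (auto simp: ennreal_divide_eq_0_iff)
  have "\<not> (\<forall>\<rho>>0. \<forall>f F :: real ^ 'n \<Rightarrow> complex. has_L1_fourier_transform f F \<and> multiplier_in_L2 w F \<longrightarrow>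
      sphere_L2_norm \<rho> f \<le> C * sqrt \<rho> * \<bar>\<sigma> \<rho>\<bar> * multiplier_L2_norm w F)" if "C < c" for C
  proof
    assume est: "\<forall>\<rho>>0. \<forall>f F :: real ^ 'n \<Rightarrow> complex. has_L1_fourier_transform f F \<and> multiplier_in_L2 w F \<longrightarrow>
      sphere_L2_norm \<rho> f \<le> C * sqrt \<rho> * \<bar>\<sigma> \<rho>\<bar> * multiplier_L2_norm w F"
    have "c \<le> max C 0"
    proof (rule sharp)
      fix \<rho> :: real and f F :: "real ^ 'n \<Rightarrow> complex"
      assume *: "\<rho> > 0" "has_L1_fourier_transform f F" "multiplier_in_L2 w F"
      have "0 \<le> multiplier_L2_norm w F"
        by (auto simp: multiplier_L2_norm_def intro!: divide_nonneg_nonneg integral_nonneg_AE)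
      then have "C * sqrt \<rho> * \<bar>\<sigma> \<rho>\<bar> * multiplier_L2_norm w F \<le> max C 0 * sqrt \<rho> * \<bar>\<sigma> \<rho>\<bar> * multiplier_L2_norm w F"
        using *(1) by (intro mult_right_mono) auto
      with est * show "sphere_L2_norm \<rho> f \<le> max C 0 * sqrt \<rho> * \<bar>\<sigma> \<rho>\<bar> * multiplier_L2_norm w F"
        by (meson order.trans)
    qed simp
    with that c_pos show False by simp
  qed
  with upper show ?thesis
    unfolding c_def by blast
qed

end
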